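(* Let $M$ be a closed (compact, without boundary) smooth connected orientable manifold of dimension $m\neq 1$ and let $F:M\to(\mathbb{R}^n,\langle\cdot,\cdot\rangle)$ be a smooth immersion which is a spacelike self-shrinker of the mean curvature flow, i.e. $\vec H=-F^\perp$. Then the mean curvature vector satisfies $\|\vec H\|^2(p)\neq0$ for all $p\in M$ and the principal normal $\nu$ is parallel in the normal bundle ($\nabla^\perp\nu\equiv0$) if and only if $F$ is a minimal immersion in the hyperquadric $\mathcal{H}^{n-1}(m)$.
   Context: $\langle\cdot,\cdot\rangle$ is a nondegenerate symmetric bilinear form on $\mathbb{R}^n$ (not necessarily positive definite), and $\|X\|^2=\langle X,X\rangle$. An immersion is spacelike if the induced metric $g=F^*\langle\cdot,\cdot\rangle$ is positive definite. $\vec H$ is the mean curvature vector ($g$-trace of the second fundamental tensor), $F^\perp$ the normal part of the position vector $F$, $\nabla^\perp$ the normal connection, and $\nu=\vec H/\sqrt{|\|\vec H\|^2|}$ the principal normal. $\mathcal{H}^{n-1}(k)=\{x\in\mathbb{R}^n:\|x\|^2=k\}$. "$F$ is a minimal immersion in $\mathcal{H}^{n-1}(m)$" means $F(M)\subset\mathcal{H}^{n-1}(m)$ and the mean curvature vector of $F$ as an immersion into the semi-Riemannian hypersurface $\mathcal{H}^{n-1}(m)$ vanishes. $M$ has positive dimension. *)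

theory Defs
  imports "HOL-Analysis.Analysis"
begin

section \<open>Smooth maps between Euclidean spaces\<close>

text \<open>Used for open \<open>S\<close> only, where the full derivative \<open>at x\<close> is the appropriate one.\<close>

fun differentiable_times_on ::
  "nat \<Rightarrow> ('a::euclidean_space \<Rightarrow> 'b::real_normed_vector) \<Rightarrow> 'a set \<Rightarrow> bool" where
  "differentiable_times_on 0 f S \<longleftrightarrow> continuous_on S f"
| "differentiable_times_on (Suc k) f S \<longleftrightarrow>
     (\<forall>x\<in>S. f differentiable (at x)) \<and>
     (\<forall>v. differentiable_times_on k (\<lambda>x. frechet_derivative f (at x) v) S)"

definition smooth_on ::
  "('a::euclidean_space \<Rightarrow> 'b::real_normed_vector) \<Rightarrow> 'a set \<Rightarrow> bool" where
  "smooth_on f S \<longleftrightarrow> (\<forall>k. differentiable_times_on k f S)"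


section \<open>Smooth manifolds\<close>

text \<open>A chart is a pair \<open>(U, \<phi>)\<close>; only the values of \<open>\<phi>\<close> on \<open>U\<close> matter. The model space
  \<open>real^'m\<close> makes the dimension of the manifold \<open>CARD('m)\<close>, which is positive.
  Atlases are not required to be maximal.\<close>

type_synonym ('a, 'm) chart = "'a set \<times> ('a \<Rightarrow> real^'m)"

definition is_chart :: "'a topology \<Rightarrow> ('a, 'm::finite) chart \<Rightarrow> bool" where
  "is_chart M = (\<lambda>(U, \<phi>). openin M U \<and> open (\<phi> ` U) \<and>
     homeomorphic_map (subtopology M U) (top_of_set (\<phi> ` U)) \<phi>)"

definition transition :: "('a, 'm) chart \<Rightarrow> ('a, 'm) chart \<Rightarrow> real^'m \<Rightarrow> real^'m" where
  "transition = (\<lambda>(U, \<phi>) (V, \<psi>). \<psi> \<circ> inv_into U \<phi>)"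

definition smooth_atlas :: "'a topology \<Rightarrow> ('a, 'm::finite) chart set \<Rightarrow> bool" where
  "smooth_atlas M A \<longleftrightarrow>
     (\<forall>c\<in>A. is_chart M c) \<and> (\<Union>c\<in>A. fst c) = topspace M \<and>
     (\<forall>c\<in>A. \<forall>d\<in>A. smooth_on (transition c d) (snd c ` (fst c \<inter> fst d)))"

definition smooth_manifold :: "'a topology \<Rightarrow> ('a, 'm::finite) chart set \<Rightarrow> bool" where
  "smooth_manifold M A \<longleftrightarrow>
     Hausdorff_space M \<and> second_countable M \<and> smooth_atlas M A"

text \<open>\<open>smooth_atlas M (A \<union> A')\<close> says that \<open>A'\<close> belongs to the smooth structure given by \<open>A\<close>.\<close>

definition orientable :: "'a topology \<Rightarrow> ('a, 'm::finite) chart set \<Rightarrow> bool" where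
  "orientable M A \<longleftrightarrow>
     (\<exists>A'. smooth_atlas M A' \<and> smooth_atlas M (A \<union> A') \<and>
       (\<forall>c\<in>A'. \<forall>d\<in>A'. \<forall>x\<in>snd c ` (fst c \<inter> fst d).
          det (matrix (frechet_derivative (transition c d) (at x))) > 0))"


section \<open>Local geometry of a spacelike parametrization\<close>

text \<open>In this section \<open>f :: real^'m \<Rightarrow> real^'n\<close> is a parametrization, namely an immersion \<open>F\<close> read in
  a chart, and \<open>B\<close> is the symmetric bilinear form on \<open>real^'n\<close>.\<close>

definition sqnorm :: "(real^'n \<Rightarrow> real^'n \<Rightarrow> real) \<Rightarrow> real^'n \<Rightarrow> real" where
  "sqnorm B X = B X X"

definition nondegenerate_form :: "(real^'n \<Rightarrow> real^'n \<Rightarrow> real) \<Rightarrow> bool" where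
  "nondegenerate_form B \<longleftrightarrow> (\<forall>X. (\<forall>Y. B X Y = 0) \<longrightarrow> X = 0)"

definition symmetric_form :: "(real^'n \<Rightarrow> real^'n \<Rightarrow> real) \<Rightarrow> bool" where
  "symmetric_form B \<longleftrightarrow> (\<forall>X Y. B X Y = B Y X)"

text \<open>The \<open>B\<close>-orthogonal projections onto a subspace \<open>T\<close> and onto its \<open>B\<close>-orthogonal complement.
  They are well defined when \<open>B\<close> is nondegenerate on \<open>T\<close>, as it is in all uses below.\<close>

definition tangential_part ::
  "(real^'n \<Rightarrow> real^'n \<Rightarrow> real) \<Rightarrow> (real^'n) set \<Rightarrow> real^'n \<Rightarrow> real^'n" where
  "tangential_part B T X = (THE Y. Y \<in> T \<and> (\<forall>Z\<in>T. B (X - Y) Z = 0))"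

definition normal_part ::
  "(real^'n \<Rightarrow> real^'n \<Rightarrow> real) \<Rightarrow> (real^'n) set \<Rightarrow> real^'n \<Rightarrow> real^'n" where
  "normal_part B T X = X - tangential_part B T X"

definition tangent_space :: "(real^'m \<Rightarrow> real^'n) \<Rightarrow> real^'m \<Rightarrow> (real^'n) set" where
  "tangent_space f x = range (frechet_derivative f (at x))"

definition induced_metric ::
  "(real^'n \<Rightarrow> real^'n \<Rightarrow> real) \<Rightarrow> (real^'m \<Rightarrow> real^'n) \<Rightarrow> real^'m \<Rightarrow> real^'m^'m" where
  "induced_metric B f x =
     (\<chi> i j. B (frechet_derivative f (at x) (axis i 1)) (frechet_derivative f (at x) (axis j 1)))"

definition metric_trace ::
  "real^'m^'m \<Rightarrow> (real^'m \<Rightarrow> real^'m \<Rightarrow> real^'n) \<Rightarrow> real^'n" where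
  "metric_trace g h =
     (\<Sum>i\<in>UNIV. \<Sum>j\<in>UNIV. (matrix_inv g $ i $ j) *\<^sub>R h (axis i 1) (axis j 1))"

definition second_derivative ::
  "(real^'m \<Rightarrow> real^'n) \<Rightarrow> real^'m \<Rightarrow> real^'m \<Rightarrow> real^'m \<Rightarrow> real^'n" where
  "second_derivative f x v w =
     frechet_derivative (\<lambda>y. frechet_derivative f (at y) w) (at x) v"

definition second_fundamental_form ::
  "(real^'n \<Rightarrow> real^'n \<Rightarrow> real) \<Rightarrow> (real^'m \<Rightarrow> real^'n) \<Rightarrow> real^'m \<Rightarrow> real^'m \<Rightarrow> real^'m \<Rightarrow> real^'n" where
  "second_fundamental_form B f x v w =
     normal_part B (tangent_space f x) (second_derivative f x v w)"

definition mean_curvature ::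
  "(real^'n \<Rightarrow> real^'n \<Rightarrow> real) \<Rightarrow> (real^'m \<Rightarrow> real^'n) \<Rightarrow> real^'m \<Rightarrow> real^'n" where
  "mean_curvature B f x = metric_trace (induced_metric B f x) (second_fundamental_form B f x)"

definition principal_normal ::
  "(real^'n \<Rightarrow> real^'n \<Rightarrow> real) \<Rightarrow> (real^'m \<Rightarrow> real^'n) \<Rightarrow> real^'m \<Rightarrow> real^'n" where
  "principal_normal B f x =
     mean_curvature B f x /\<^sub>R sqrt \<bar>sqnorm B (mean_curvature B f x)\<bar>"

definition normal_derivative ::
  "(real^'n \<Rightarrow> real^'n \<Rightarrow> real) \<Rightarrow> (real^'m \<Rightarrow> real^'n) \<Rightarrow> (real^'m \<Rightarrow> real^'n) \<Rightarrow>
     real^'m \<Rightarrow> real^'m \<Rightarrow> real^'n" where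
  "normal_derivative B f N x v =
     normal_part B (tangent_space f x) (frechet_derivative N (at x) v)"

subsection \<open>Immersions into a hyperquadric\<close>

definition hyperquadric :: "(real^'n \<Rightarrow> real^'n \<Rightarrow> real) \<Rightarrow> real \<Rightarrow> (real^'n) set" where
  "hyperquadric B k = {y. sqnorm B y = k}"

text \<open>The kernel at \<open>y\<close> of the differential \<open>v \<mapsto> 2 * B y v\<close> of \<open>sqnorm B\<close>.\<close>

definition hyperquadric_tangent ::
  "(real^'n \<Rightarrow> real^'n \<Rightarrow> real) \<Rightarrow> real^'n \<Rightarrow> (real^'n) set" where
  "hyperquadric_tangent B y = {v. B y v = 0}"

text \<open>For \<open>k \<noteq> 0\<close> the Levi-Civita connection of \<open>hyperquadric B k\<close> is the tangential part of the
  flat connection of the ambient space. The second fundamental form of \<open>f\<close> as an immersion into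
  the hyperquadric is the part normal to \<open>f\<close> of that covariant derivative; as the tangent space of
  \<open>f\<close> is contained in that of the hyperquadric, this normal part is again tangent to the
  hyperquadric.\<close>

definition hyperquadric_second_fundamental_form ::
  "(real^'n \<Rightarrow> real^'n \<Rightarrow> real) \<Rightarrow> (real^'m \<Rightarrow> real^'n) \<Rightarrow> real^'m \<Rightarrow> real^'m \<Rightarrow> real^'m \<Rightarrow> real^'n" where
  "hyperquadric_second_fundamental_form B f x v w =
     normal_part B (tangent_space f x)
       (tangential_part B (hyperquadric_tangent B (f x)) (second_derivative f x v w))"

definition hyperquadric_mean_curvature ::
  "(real^'n \<Rightarrow> real^'n \<Rightarrow> real) \<Rightarrow> (real^'m \<Rightarrow> real^'n) \<Rightarrow> real^'m \<Rightarrow> real^'n" where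
  "hyperquadric_mean_curvature B f x =
     metric_trace (induced_metric B f x) (hyperquadric_second_fundamental_form B f x)"


section \<open>Immersed manifolds\<close>

text \<open>The objects above do not depend on the choice of local coordinates, so a condition at a point
  of the manifold is stated in every chart of the atlas around that point.\<close>

definition in_chart :: "('a \<Rightarrow> real^'n) \<Rightarrow> ('a, 'm) chart \<Rightarrow> real^'m \<Rightarrow> real^'n" where
  "in_chart F = (\<lambda>(U, \<phi>). F \<circ> inv_into U \<phi>)"

definition smooth_immersion :: "('a, 'm::finite) chart set \<Rightarrow> ('a \<Rightarrow> real^'n) \<Rightarrow> bool" where
  "smooth_immersion A F \<longleftrightarrow>
     (\<forall>c\<in>A. smooth_on (in_chart F c) (snd c ` fst c) \<and>
       (\<forall>p\<in>fst c. inj (frechet_derivative (in_chart F c) (at (snd c p)))))"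

definition spacelike ::
  "('a, 'm::finite) chart set \<Rightarrow> (real^'n \<Rightarrow> real^'n \<Rightarrow> real) \<Rightarrow> ('a \<Rightarrow> real^'n) \<Rightarrow> bool" where
  "spacelike A B F \<longleftrightarrow>
     (\<forall>c\<in>A. \<forall>p\<in>fst c. \<forall>v. v \<noteq> 0 \<longrightarrow>
        sqnorm B (frechet_derivative (in_chart F c) (at (snd c p)) v) > 0)"

definition self_shrinker ::
  "('a, 'm::finite) chart set \<Rightarrow> (real^'n \<Rightarrow> real^'n \<Rightarrow> real) \<Rightarrow> ('a \<Rightarrow> real^'n) \<Rightarrow> bool" where
  "self_shrinker A B F \<longleftrightarrow>
     (\<forall>c\<in>A. \<forall>p\<in>fst c.
        mean_curvature B (in_chart F c) (snd c p) =
          - normal_part B (tangent_space (in_chart F c) (snd c p)) (F p))"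

definition mean_curvature_nonnull ::
  "('a, 'm::finite) chart set \<Rightarrow> (real^'n \<Rightarrow> real^'n \<Rightarrow> real) \<Rightarrow> ('a \<Rightarrow> real^'n) \<Rightarrow> bool" where
  "mean_curvature_nonnull A B F \<longleftrightarrow>
     (\<forall>c\<in>A. \<forall>p\<in>fst c. sqnorm B (mean_curvature B (in_chart F c) (snd c p)) \<noteq> 0)"

definition parallel_principal_normal ::
  "('a, 'm::finite) chart set \<Rightarrow> (real^'n \<Rightarrow> real^'n \<Rightarrow> real) \<Rightarrow> ('a \<Rightarrow> real^'n) \<Rightarrow> bool" where
  "parallel_principal_normal A B F \<longleftrightarrow>
     (\<forall>c\<in>A. \<forall>p\<in>fst c. \<forall>v.
        normal_derivative B (in_chart F c) (principal_normal B (in_chart F c)) (snd c p) v = 0)"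

definition minimal_in_hyperquadric ::
  "'a topology \<Rightarrow> ('a, 'm::finite) chart set \<Rightarrow> (real^'n \<Rightarrow> real^'n \<Rightarrow> real) \<Rightarrow>
     ('a \<Rightarrow> real^'n) \<Rightarrow> real \<Rightarrow> bool" where
  "minimal_in_hyperquadric M A B F k \<longleftrightarrow>
     F ` topspace M \<subseteq> hyperquadric B k \<and>
     (\<forall>c\<in>A. \<forall>p\<in>fst c. hyperquadric_mean_curvature B (in_chart F c) (snd c p) = 0)"

end

theory Submission
  imports Defs
begin

text \<open>
  Write \<open>H = u \<nu>\<close>, let \<open>a\<close> be the component of the second fundamental form along \<open>\<nu>\<close>, and let
  \<open>L\<close> be the Laplacian minus the derivative along \<open>F\<^sup>T\<close>, so that \<open>L F = - F\<close>. For parallel \<open>\<nu>\<close> of causal sign \<open>e\<close> one finds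
  \<open>L \<nu> = - e |a|\<^sup>2 \<nu>\<close> and \<open>L u = u (1 - e |a|\<^sup>2)\<close>, and Bochner's formula for the map \<open>\<nu>\<close> gives
  \<open>L |a|\<^sup>2 = 2 |a|\<^sup>2 - 2 e |a|\<^sup>4 + 2 |\<nabla>a|\<^sup>2\<close>; by the Gauss equation its
  curvature term cancels against the normal part of \<open>\<nabla>\<nabla>\<nu>\<close>. Hence, as in Huisken's
  argument for hypersurfaces, \<open>w = |a|\<^sup>2 / u\<^sup>2\<close> satisfies
  \<open>L w + 2 / u \<langle>\<nabla>u, \<nabla>w\<rangle> = 2 / u\<^sup>4 |u \<nabla>a - \<nabla>u \<otimes> a|\<^sup>2 \<ge> 0\<close>, and is constant by the strong maximum principle.
  The Codazzi equation then leaves two cases: \<open>a\<close> has rank one, so that \<open>w = 1\<close>, or \<open>\<nabla>u = 0\<close>.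
  At a maximum of \<open>\<parallel>F\<parallel>\<^sup>2\<close> the Hessian \<open>2 (g - u a)\<close> is nonpositive, so \<open>a\<close> has full rank there; as the
  dimension is not one, the first case is excluded. So \<open>u\<close> is constant and \<open>e |a|\<^sup>2 = 1\<close>. Comparing
  traces of \<open>g - u a\<close> at a maximum and at a minimum of \<open>\<parallel>F\<parallel>\<^sup>2\<close> gives \<open>e = 1\<close> and \<open>u\<^sup>2 = m\<close>, so \<open>a\<close> is
  umbilic, \<open>F\<^sup>T = 0\<close> and \<open>\<parallel>F\<parallel>\<^sup>2 = m\<close>.
\<close>

text \<open>Dividing by \<open>u * u\<close> is forced by the zeroth-order terms:
  \<open>L (u^2)\<close> and \<open>L |a|^2\<close> carry the same factor
  \<open>2 - 2 e |a|^2\<close>, so these terms cancel in the quotient and a sum of squares remains.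
  The form may be indefinite on the normal bundle, so positivity is available only for tangent
  vectors. It suffices because parallelism makes the derivative of \<nu> tangent, and the components
  of the second fundamental form in other normal directions cancel. Covariant derivatives are
  avoided: the pointwise identities are computed with ordinary partial derivatives at the origin of
  normal coordinates and carried elsewhere, since the quantities in them are invariant under
  reparametrization. The sign \<open>e\<close> is fixed only locally, as charts need not be
  connected, so charts are cut into smaller patches; constancy of \<open>w\<close> on the whole
  manifold later ties the patches together. For the converse, on the quadric of level
  \<open>m\<close> the position vector is normal, so the shrinker equation becomes
  \<open>H = - F\<close>.\<close>

section \<open>Calculus of smooth maps\<close>

abbreviation sum_univ :: "('i::finite \<Rightarrow> 'b::comm_monoid_add) \<Rightarrow> 'b" (binder "\<Sigma>" 10) where
  "sum_univ t \<equiv> sum t UNIV"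

text \<open>The direction is the first argument, so that \<open>D v f\<close> is again a function
  and iterated derivatives read \<open>D v (D w f)\<close>.\<close>

definition D :: "'a::euclidean_space \<Rightarrow> ('a \<Rightarrow> 'b::real_normed_vector) \<Rightarrow> 'a \<Rightarrow> 'b" where
  "D v f x = frechet_derivative f (at x) v"

lemma D_eq: "(f has_derivative f') (at x) \<Longrightarrow> D v f x = f' v"
  unfolding D_def using frechet_derivative_at by metis

lemma has_derivative_D: "f differentiable (at x) \<Longrightarrow> (f has_derivative (\<lambda>v. D v f x)) (at x)"
  unfolding D_def by (simp add: frechet_derivative_works)

lemma D_cong:
  assumes "open S" "x \<in> S" "\<And>y. y \<in> S \<Longrightarrow> f y = g y"
  shows "D v f x = D v g x"
proof -
  have "(f has_derivative f') (at x) \<longleftrightarrow> (g has_derivative f') (at x)" for f'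
    using has_derivative_transform_within_open[of f f' x UNIV S g]
      has_derivative_transform_within_open[of g f' x UNIV S f] assms by auto
  then show ?thesis unfolding D_def frechet_derivative_def by presburger
qed

lemma linear_D: "f differentiable (at x) \<Longrightarrow> linear (\<lambda>v. D v f x)"
  using has_derivative_D has_derivative_linear by blast

lemma dto_Suc:
  "differentiable_times_on (Suc k) f S \<longleftrightarrow>
    (\<forall>x\<in>S. f differentiable (at x)) \<and> (\<forall>v. differentiable_times_on k (D v f) S)"
  unfolding D_def[abs_def] by simp

declare differentiable_times_on.simps(2) [simp del]

lemma dto_SucD: "differentiable_times_on (Suc k) f S \<Longrightarrow> differentiable_times_on k f S"
proof (induction k arbitrary: f)
  case 0
  then show ?case
    by (simp add: dto_Suc differentiable_at_imp_differentiable_on differentiable_imp_continuous_on)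
next
  case (Suc k)
  then show ?case using dto_Suc by blast
qed

lemma dto_cong:
  assumes "open S" "\<And>y. y \<in> S \<Longrightarrow> f y = g y" "differentiable_times_on k f S"
  shows "differentiable_times_on k g S"
  using assms(2,3)
proof (induction k arbitrary: f g)
  case 0
  then show ?case using continuous_on_cong by force
next
  case (Suc k)
  have "g differentiable (at x)" if "x \<in> S" for x
    using Suc.prems that assms(1) unfolding dto_Suc differentiable_def
    by (meson has_derivative_transform_within_open)
  moreover have "differentiable_times_on k (D v g) S" for v
    using Suc.IH[of "D v f" "D v g"] D_cong[OF assms(1) _ Suc.prems(1)] Suc.prems(2)
    by (auto simp: dto_Suc)
  ultimately show ?case by (simp add: dto_Suc)
qed

lemma dto_const:
  fixes S :: "'a::euclidean_space set"
  shows "differentiable_times_on k (\<lambda>x. c) S"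
proof (induction k arbitrary: c)
  case (Suc k)
  have "D v (\<lambda>x. c) = (\<lambda>x. 0)" for v :: 'a
    by (auto simp: D_def)
  then show ?case using Suc by (auto simp: dto_Suc)
qed simp

lemma D_add:
  "f differentiable (at x) \<Longrightarrow> g differentiable (at x) \<Longrightarrow> D v (\<lambda>x. f x + g x) x = D v f x + D v g x"
  by (rule D_eq) (auto intro!: derivative_intros has_derivative_D)

lemma D_bilinear:
  assumes "bounded_bilinear h" "f differentiable (at x)" "g differentiable (at x)"
  shows "D v (\<lambda>x. h (f x) (g x)) x = h (f x) (D v g x) + h (D v f x) (g x)"
  by (rule D_eq[OF bounded_bilinear.FDERIV[OF assms(1) has_derivative_D[OF assms(2)] has_derivative_D[OF assms(3)]]])

lemma differentiable_bilinear:
  fixes x :: "'a::euclidean_space"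
  assumes "bounded_bilinear h" "f differentiable (at x)" "g differentiable (at x)"
  shows "(\<lambda>x. h (f x) (g x)) differentiable (at x)"
  using bounded_bilinear.FDERIV[OF assms(1) has_derivative_D[OF assms(2)] has_derivative_D[OF assms(3)]]
  unfolding differentiable_def by blast

lemma dto_add:
  assumes "open S"
  shows "differentiable_times_on k f S \<Longrightarrow> differentiable_times_on k g S \<Longrightarrow>
    differentiable_times_on k (\<lambda>x. f x + g x) S"
proof (induction k arbitrary: f g)
  case 0 then show ?case by (auto intro: continuous_intros)
next
  case (Suc k)
  have step: "differentiable_times_on k (\<lambda>x. D v f x + D v g x) S" for v
    using Suc by (auto simp: dto_Suc)
  have "differentiable_times_on k (D v (\<lambda>x. f x + g x)) S" for v
    by (rule dto_cong[OF assms _ step[of v]]) (use Suc.prems in \<open>auto simp: dto_Suc D_add\<close>)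
  then show ?case using Suc.prems by (auto simp: dto_Suc)
qed

text \<open>Stated for an arbitrary bounded bilinear map, so that one induction covers products,
  scalar multiples, inner products and the form \<open>B\<close>.\<close>

lemma dto_bilinear:
  assumes "open S" "bounded_bilinear h"
  shows "differentiable_times_on k f S \<Longrightarrow> differentiable_times_on k g S \<Longrightarrow>
    differentiable_times_on k (\<lambda>x. h (f x) (g x)) S"
proof (induction k arbitrary: f g)
  case 0 then show ?case using bounded_bilinear.continuous_on[OF assms(2)] by auto
next
  case (Suc k)
  have step: "differentiable_times_on k (\<lambda>x. h (f x) (D v g x) + h (D v f x) (g x)) S" for v
    using Suc dto_SucD[OF Suc.prems(1)] dto_SucD[OF Suc.prems(2)]
    by (intro dto_add[OF assms(1)]) (auto simp: dto_Suc)
  have "differentiable_times_on k (D v (\<lambda>x. h (f x) (g x))) S" for v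
    by (rule dto_cong[OF assms(1) _ step[of v]])
       (use Suc.prems in \<open>auto simp: dto_Suc D_bilinear[OF assms(2)]\<close>)
  then show ?case using Suc.prems by (auto simp: dto_Suc intro: differentiable_bilinear[OF assms(2)])
qed

lemma dto_sum:
  assumes "open S" "finite I" "\<And>i. i \<in> I \<Longrightarrow> differentiable_times_on k (f i) S"
  shows "differentiable_times_on k (\<lambda>x. \<Sum>i\<in>I. f i x) S"
  using assms(2,3)
proof (induction I rule: finite_induct)
  case empty then show ?case by (simp add: dto_const)
next
  case (insert i I) then show ?case by (simp add: dto_add[OF assms(1)])
qed

lemma D_real_compose:
  assumes "(r has_real_derivative d) (at (f x))" "f differentiable (at x)"
  shows "D v (\<lambda>x. r (f x)) x = d * D v f x"
proof -
  have "((\<lambda>x. r (f x)) has_derivative (\<lambda>v. d * D v f x)) (at x)"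
    using has_derivative_compose[OF has_derivative_D[OF assms(2)], of r "(*) d"] assms(1)
    by (simp add: has_field_derivative_def)
  then show ?thesis by (rule D_eq)
qed

text \<open>The derivative of \<open>1/f\<close> is a polynomial in \<open>1/f\<close> itself and
  the derivative of \<open>f\<close>, so the induction hypothesis for the same \<open>f\<close>
  feeds the next order.\<close>

lemma dto_inverse:
  fixes f :: "'a::euclidean_space \<Rightarrow> real"
  assumes "open S" "\<And>x. x \<in> S \<Longrightarrow> f x \<noteq> 0"
  shows "differentiable_times_on k f S \<Longrightarrow> differentiable_times_on k (\<lambda>x. inverse (f x)) S"
proof (induction k)
  case 0 then show ?case using assms by (auto intro: continuous_intros)
next
  case (Suc k)
  have diff: "x \<in> S \<Longrightarrow> f differentiable (at x)" for x using Suc.prems by (auto simp: dto_Suc)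
  have eq: "D v (\<lambda>x. inverse (f x)) x = (inverse (f x) * inverse (f x)) * (- 1 * D v f x)"
    if "x \<in> S" for v x
    using D_real_compose[OF DERIV_inverse diff[OF that]] assms(2)[OF that]
    by (simp add: power2_eq_square)
  have k: "differentiable_times_on k (\<lambda>x. inverse (f x)) S"
    using Suc dto_SucD by blast
  have step: "differentiable_times_on k (\<lambda>x. (inverse (f x) * inverse (f x)) * (- 1 * D v f x)) S" for v
    using Suc.prems k
    by (intro dto_bilinear[OF assms(1) bounded_bilinear_mult] dto_const) (auto simp: dto_Suc)
  have "differentiable_times_on k (D v (\<lambda>x. inverse (f x))) S" for v
    by (rule dto_cong[OF assms(1) _ step[of v]]) (simp add: eq)
  then show ?case using diff assms(2) by (auto simp: dto_Suc)
qed

lemma dto_sqrt: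
  fixes f :: "'a::euclidean_space \<Rightarrow> real"
  assumes "open S" "\<And>x. x \<in> S \<Longrightarrow> f x > 0"
  shows "differentiable_times_on k f S \<Longrightarrow> differentiable_times_on k (\<lambda>x. sqrt (f x)) S"
proof (induction k)
  case 0 then show ?case using assms by (auto intro: continuous_intros)
next
  case (Suc k)
  have diff: "x \<in> S \<Longrightarrow> f differentiable (at x)" for x using Suc.prems by (auto simp: dto_Suc)
  have eq: "D v (\<lambda>x. sqrt (f x)) x = inverse (sqrt (f x)) * (1/2 * D v f x)"
    if "x \<in> S" for v x
    using D_real_compose[OF DERIV_real_sqrt[OF assms(2)[OF that]] diff[OF that]] by simp
  have k: "differentiable_times_on k (\<lambda>x. inverse (sqrt (f x))) S"
    using Suc dto_SucD by (intro dto_inverse[OF assms(1)]) (auto dest: assms(2))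
  have step: "differentiable_times_on k (\<lambda>x. inverse (sqrt (f x)) * (1/2 * D v f x)) S" for v
    using Suc.prems k
    by (intro dto_bilinear[OF assms(1) bounded_bilinear_mult] dto_const) (auto simp: dto_Suc)
  have "differentiable_times_on k (D v (\<lambda>x. sqrt (f x))) S" for v
    by (rule dto_cong[OF assms(1) _ step[of v]]) (simp add: eq)
  moreover have "(\<lambda>x. sqrt (f x)) differentiable (at x)" if "x \<in> S" for x
    using has_derivative_real_sqrt[OF assms(2)[OF that] has_derivative_D[OF diff[OF that]]]
    unfolding differentiable_def by blast
  ultimately show ?case by (auto simp: dto_Suc)
qed

lemma D_compose:
  fixes f :: "'b::euclidean_space \<Rightarrow> 'c::real_normed_vector" and P :: "'a::euclidean_space \<Rightarrow> 'b"
  assumes "P differentiable (at x)" "f differentiable (at (P x))"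
  shows "D v (\<lambda>x. f (P x)) x = D (D v P x) f (P x)"
  by (rule D_eq) (rule has_derivative_compose[OF has_derivative_D[OF assms(1)] has_derivative_D[OF assms(2)]])

lemma D_expand:
  fixes f :: "'b::euclidean_space \<Rightarrow> 'c::real_normed_vector"
  assumes "f differentiable (at x)"
  shows "D v f x = (\<Sum>b\<in>Basis. (v \<bullet> b) *\<^sub>R D b f x)"
proof -
  have "D v f x = D (\<Sum>b\<in>Basis. (v \<bullet> b) *\<^sub>R b) f x" by (simp add: euclidean_representation)
  also have "\<dots> = (\<Sum>b\<in>Basis. (v \<bullet> b) *\<^sub>R D b f x)"
    using linear_sum[OF linear_D[OF assms], of "\<lambda>b. (v \<bullet> b) *\<^sub>R b" Basis]
    by (simp add: linear_cmul[OF linear_D[OF assms]])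
  finally show ?thesis .
qed

text \<open>The direction \<open>D v P x\<close> in the chain rule varies with \<open>x\<close>, so
  the outer derivative is expanded in a basis: the induction hypothesis speaks of derivatives in
  fixed directions.\<close>

lemma dto_compose:
  fixes f :: "'b::euclidean_space \<Rightarrow> 'c::real_normed_vector" and P :: "'a::euclidean_space \<Rightarrow> 'b"
  assumes "open S" "P ` S \<subseteq> T"
  shows "differentiable_times_on k P S \<Longrightarrow> differentiable_times_on k f T \<Longrightarrow>
    differentiable_times_on k (\<lambda>x. f (P x)) S"
proof (induction k arbitrary: f)
  case 0 then show ?case using assms by (auto intro: continuous_on_compose2)
next
  case (Suc k)
  have d: "P differentiable (at x)" "f differentiable (at (P x))" if "x \<in> S" for x
    using Suc.prems assms(2) that by (auto simp: dto_Suc)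
  have eq: "D v (\<lambda>x. f (P x)) x = (\<Sum>b\<in>Basis. (D v P x \<bullet> b) *\<^sub>R D b f (P x))" if "x \<in> S" for v x
    using d[OF that] D_compose D_expand by metis
  have step: "differentiable_times_on k (\<lambda>x. \<Sum>b\<in>Basis. (D v P x \<bullet> b) *\<^sub>R D b f (P x)) S" for v
    using Suc.prems Suc.IH[of "D _ f"] dto_SucD[OF Suc.prems(1)]
    by (intro dto_sum[OF assms(1)] dto_bilinear[OF assms(1) bounded_bilinear_scaleR]
         dto_bilinear[OF assms(1) bounded_bilinear_inner] dto_const) (auto simp: dto_Suc)
  have "differentiable_times_on k (D v (\<lambda>x. f (P x))) S" for v
    by (rule dto_cong[OF assms(1) _ step[of v]]) (simp add: eq)
  then show ?case using d by (auto simp: dto_Suc intro: differentiable_compose)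
qed

section \<open>Closure properties of smooth maps\<close>

lemma smooth_on_dto: "smooth_on f S \<Longrightarrow> differentiable_times_on k f S"
  by (simp add: smooth_on_def)

lemma smooth_diff: "smooth_on f S \<Longrightarrow> x \<in> S \<Longrightarrow> f differentiable (at x)"
  using smooth_on_dto[of f S "Suc 0"] by (auto simp: dto_Suc)

lemma smooth_on_D: "smooth_on f S \<Longrightarrow> smooth_on (D v f) S"
  unfolding smooth_on_def by (metis dto_Suc)

lemma smooth_on_continuous: "smooth_on f S \<Longrightarrow> continuous_on S f"
  using smooth_on_dto[of f S 0] by auto

lemma smooth_on_cong: "open S \<Longrightarrow> (\<And>y. y \<in> S \<Longrightarrow> f y = g y) \<Longrightarrow> smooth_on f S \<Longrightarrow> smooth_on g S"
  unfolding smooth_on_def using dto_cong by blast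

lemma smooth_on_const: "smooth_on (\<lambda>x. c) S"
  by (simp add: smooth_on_def dto_const)

lemma smooth_on_add: "open S \<Longrightarrow> smooth_on f S \<Longrightarrow> smooth_on g S \<Longrightarrow> smooth_on (\<lambda>x. f x + g x) S"
  by (simp add: smooth_on_def dto_add)

lemma smooth_on_bilinear:
  "open S \<Longrightarrow> bounded_bilinear h \<Longrightarrow> smooth_on f S \<Longrightarrow> smooth_on g S \<Longrightarrow> smooth_on (\<lambda>x. h (f x) (g x)) S"
  by (simp add: smooth_on_def dto_bilinear)

lemma smooth_on_sum:
  "open S \<Longrightarrow> finite I \<Longrightarrow> (\<And>i. i \<in> I \<Longrightarrow> smooth_on (f i) S) \<Longrightarrow> smooth_on (\<lambda>x. \<Sum>i\<in>I. f i x) S"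
  by (simp add: smooth_on_def dto_sum)

lemma smooth_on_inverse:
  fixes f :: "'a::euclidean_space \<Rightarrow> real"
  shows "open S \<Longrightarrow> (\<And>x. x \<in> S \<Longrightarrow> f x \<noteq> 0) \<Longrightarrow> smooth_on f S \<Longrightarrow> smooth_on (\<lambda>x. inverse (f x)) S"
  by (simp add: smooth_on_def dto_inverse)

lemma smooth_on_sqrt:
  fixes f :: "'a::euclidean_space \<Rightarrow> real"
  shows "open S \<Longrightarrow> (\<And>x. x \<in> S \<Longrightarrow> f x > 0) \<Longrightarrow> smooth_on f S \<Longrightarrow> smooth_on (\<lambda>x. sqrt (f x)) S"
  by (simp add: smooth_on_def dto_sqrt)

lemma smooth_on_compose:
  fixes f :: "'b::euclidean_space \<Rightarrow> 'c::real_normed_vector" and P :: "'a::euclidean_space \<Rightarrow> 'b"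
  shows "open S \<Longrightarrow> P ` S \<subseteq> T \<Longrightarrow> smooth_on P S \<Longrightarrow> smooth_on f T \<Longrightarrow> smooth_on (\<lambda>x. f (P x)) S"
  by (simp add: smooth_on_def dto_compose)

lemma smooth_on_mult:
  fixes f g :: "'a::euclidean_space \<Rightarrow> real"
  shows "open S \<Longrightarrow> smooth_on f S \<Longrightarrow> smooth_on g S \<Longrightarrow> smooth_on (\<lambda>x. f x * g x) S"
  by (rule smooth_on_bilinear[OF _ bounded_bilinear_mult])

lemma smooth_on_scaleR:
  "open S \<Longrightarrow> smooth_on f S \<Longrightarrow> smooth_on g S \<Longrightarrow> smooth_on (\<lambda>x. f x *\<^sub>R g x) S"
  by (rule smooth_on_bilinear[OF _ bounded_bilinear_scaleR])

lemma smooth_on_minus: "open S \<Longrightarrow> smooth_on f S \<Longrightarrow> smooth_on (\<lambda>x. - f x) S"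
  using smooth_on_scaleR[OF _ smooth_on_const[of "-1"]] by fastforce

lemma smooth_on_diff: "open S \<Longrightarrow> smooth_on f S \<Longrightarrow> smooth_on g S \<Longrightarrow> smooth_on (\<lambda>x. f x - g x) S"
  using smooth_on_add[OF _ _ smooth_on_minus] by fastforce

lemma smooth_on_divide:
  fixes f g :: "'a::euclidean_space \<Rightarrow> real"
  shows "open S \<Longrightarrow> (\<And>x. x \<in> S \<Longrightarrow> g x \<noteq> 0) \<Longrightarrow> smooth_on f S \<Longrightarrow> smooth_on g S \<Longrightarrow> smooth_on (\<lambda>x. f x / g x) S"
  unfolding divide_inverse by (intro smooth_on_mult smooth_on_inverse)

lemma smooth_on_prod:
  fixes f :: "'i \<Rightarrow> 'a::euclidean_space \<Rightarrow> real"
  assumes "open S" "finite I" "\<And>i. i \<in> I \<Longrightarrow> smooth_on (f i) S"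
  shows "smooth_on (\<lambda>x. \<Prod>i\<in>I. f i x) S"
  using assms(2,3)
  by (induction I rule: finite_induct) (auto intro: smooth_on_const smooth_on_mult[OF assms(1)])

lemma smooth_on_subset: "smooth_on f S \<Longrightarrow> T \<subseteq> S \<Longrightarrow> smooth_on f T"
proof -
  have "T \<subseteq> S \<Longrightarrow> differentiable_times_on k f S \<Longrightarrow> differentiable_times_on k f T" for k
    by (induction k arbitrary: f) (auto simp: dto_Suc intro: continuous_on_subset)
  then show "smooth_on f S \<Longrightarrow> T \<subseteq> S \<Longrightarrow> smooth_on f T" by (simp add: smooth_on_def)
qed

lemma smooth_on_bounded_linear:
  assumes "open S" "bounded_linear h" "smooth_on f S"
  shows "smooth_on (\<lambda>x. h (f x)) S"
proof -
  interpret h: bounded_linear h by fact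
  \<comment> \<open>The linear map is turned into a bilinear one whose scalar argument is then the
    constant 1.\<close>
  have "bounded_bilinear (\<lambda>(r::real) y. r *\<^sub>R h y)"
    using bounded_bilinear.comp[OF bounded_bilinear_scaleR bounded_linear_ident assms(2)] by simp
  from smooth_on_bilinear[OF assms(1) this smooth_on_const[of 1] assms(3)] show ?thesis by simp
qed

lemma smooth_on_id: "open S \<Longrightarrow> smooth_on (\<lambda>x. x) S"
proof -
  assume "open S"
  have "differentiable_times_on k (\<lambda>x. x) S" for k
  proof (cases k)
    case (Suc l)
    have "D v (\<lambda>x. x) = (\<lambda>x. v)" for v :: 'a by (auto simp: D_def)
    then show ?thesis by (simp add: Suc dto_Suc dto_const)
  qed (simp add: continuous_on_id)
  then show ?thesis by (simp add: smooth_on_def)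
qed

section \<open>Determinants and inverses of matrices with smooth entries\<close>

lemma smooth_on_det:
  fixes A :: "'a::euclidean_space \<Rightarrow> real^'m^'m"
  assumes "open S" "\<And>i j. smooth_on (\<lambda>x. A x $ i $ j) S"
  shows "smooth_on (\<lambda>x. det (A x)) S"
  unfolding det_def
  by (intro smooth_on_sum smooth_on_mult smooth_on_const smooth_on_prod assms finite_permutations) auto

text \<open>Cramer's rule applied to the columns of the identity. It exhibits the entries of the
  inverse as quotients of determinants, hence as smooth functions of the entries.\<close>

lemma matrix_inv_cofactor:
  fixes A :: "real^'m^'m"
  assumes "det A \<noteq> 0"
  shows "matrix_inv A $ k $ l = det (\<chi> i j. if j = k then axis l 1 $ i else A $ i $ j) / det A"
proof -
  have "invertible A" using assms by (simp add: invertible_det_nz)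
  then have "A ** matrix_inv A = mat 1"
    unfolding invertible_def matrix_inv_def by (rule someI2_ex) simp
  then have "A *v (matrix_inv A *v axis l 1) = axis l 1"
    by (simp add: matrix_vector_mul_assoc)
  then have "(matrix_inv A *v axis l 1) $ k = det (\<chi> i j. if j = k then axis l 1 $ i else A $ i $ j) / det A"
    using cramer[OF assms] by simp
  then show ?thesis by (simp add: matrix_vector_mult_basis column_def)
qed

lemma smooth_on_matrix_inv:
  fixes A :: "'a::euclidean_space \<Rightarrow> real^'m^'m"
  assumes "open S" "\<And>i j. smooth_on (\<lambda>x. A x $ i $ j) S" "\<And>x. x \<in> S \<Longrightarrow> det (A x) \<noteq> 0"
  shows "smooth_on (\<lambda>x. matrix_inv (A x) $ k $ l) S"
proof (rule smooth_on_cong[OF assms(1)])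
  have "smooth_on (\<lambda>x. if j = k then axis l 1 $ i else A x $ i $ j) S" for i j
    by (cases "j = k") (simp_all add: smooth_on_const assms(2))
  then show "smooth_on (\<lambda>x. det (\<chi> i j. if j = k then axis l 1 $ i else A x $ i $ j) / det (A x)) S"
    by (intro smooth_on_divide assms smooth_on_det) simp_all
qed (simp add: matrix_inv_cofactor assms(3))

lemma smooth_on_cart:
  fixes f :: "'a::euclidean_space \<Rightarrow> real^'n"
  shows "open S \<Longrightarrow> smooth_on f S \<Longrightarrow> smooth_on (\<lambda>x. f x $ i) S"
  by (rule smooth_on_bounded_linear[OF _ bounded_linear_vec_nth])

section \<open>Rules for first and second directional derivatives\<close>

lemma D_const: "D v (\<lambda>x. c) x = 0"
  by (simp add: D_def)

lemma D_mult:
  fixes f g :: "'a::euclidean_space \<Rightarrow> real"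
  shows "f differentiable (at x) \<Longrightarrow> g differentiable (at x) \<Longrightarrow>
    D v (\<lambda>x. f x * g x) x = f x * D v g x + D v f x * g x"
  by (rule D_bilinear[OF bounded_bilinear_mult])

lemma D_scaleR:
  "f differentiable (at x) \<Longrightarrow> g differentiable (at x) \<Longrightarrow>
    D v (\<lambda>x. f x *\<^sub>R g x) x = f x *\<^sub>R D v g x + D v f x *\<^sub>R g x"
  by (rule D_bilinear[OF bounded_bilinear_scaleR])

lemma D_minus: "f differentiable (at x) \<Longrightarrow> D v (\<lambda>x. - f x) x = - D v f x"
  by (rule D_eq) (auto intro!: derivative_intros has_derivative_D)

lemma D_diff:
  "f differentiable (at x) \<Longrightarrow> g differentiable (at x) \<Longrightarrow> D v (\<lambda>x. f x - g x) x = D v f x - D v g x"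
  by (rule D_eq) (auto intro!: derivative_intros has_derivative_D)

lemma D_sum:
  "(\<And>i. i \<in> I \<Longrightarrow> f i differentiable (at x)) \<Longrightarrow> D v (\<lambda>x. \<Sum>i\<in>I. f i x) x = (\<Sum>i\<in>I. D v (f i) x)"
  by (rule D_eq) (auto intro!: derivative_intros has_derivative_D)

lemma D_bounded_linear:
  assumes "bounded_linear h" "f differentiable (at x)"
  shows "D v (\<lambda>x. h (f x)) x = h (D v f x)"
  by (rule D_eq) (rule bounded_linear.has_derivative[OF assms(1) has_derivative_D[OF assms(2)]])

lemma D_cart:
  fixes f :: "'a::euclidean_space \<Rightarrow> real^'n"
  shows "f differentiable (at x) \<Longrightarrow> D v (\<lambda>x. f x $ i) x = D v f x $ i"
  by (rule D_bounded_linear[OF bounded_linear_vec_nth])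

lemma D_ident: "D v (\<lambda>x. x) x = v"
  by (simp add: D_def)

lemma D_expand_cart:
  fixes f :: "real^'m \<Rightarrow> 'b::real_normed_vector"
  assumes "f differentiable (at x)"
  shows "D v f x = (\<Sigma> k. v $ k *\<^sub>R D (axis k 1) f x)"
proof -
  have "D v f x = D (\<Sigma> k. v $ k *\<^sub>R axis k 1) f x"
    by (simp add: basis_expansion flip: scalar_mult_eq_scaleR)
  also have "\<dots> = (\<Sigma> k. v $ k *\<^sub>R D (axis k 1) f x)"
    using linear_sum[OF linear_D[OF assms], of "\<lambda>k. v $ k *\<^sub>R axis k 1" UNIV]
    by (simp add: linear_cmul[OF linear_D[OF assms]])
  finally show ?thesis .
qed

lemma D2_expand_cart:
  fixes f :: "real^'m \<Rightarrow> 'b::real_normed_vector"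
  assumes "open S" "smooth_on f S" "x \<in> S"
  shows "D v (D w f) x = (\<Sigma> k. \<Sigma> l. (v $ k * w $ l) *\<^sub>R D (axis k 1) (D (axis l 1) f) x)"
proof -
  note d = smooth_diff[OF assms(2)] smooth_diff[OF smooth_on_D[OF assms(2)]]
  have "D v (D w f) x = D v (\<lambda>x. \<Sigma> l. w $ l *\<^sub>R D (axis l 1) f x) x"
    using D_expand_cart[OF d(1)] by (intro D_cong[OF assms(1,3)])
  also have "\<dots> = (\<Sigma> l. w $ l *\<^sub>R D v (D (axis l 1) f) x)"
    using d assms(3) by (simp add: D_sum D_scaleR D_const)
  also have "\<dots> = (\<Sigma> l. w $ l *\<^sub>R (\<Sigma> k. v $ k *\<^sub>R D (axis k 1) (D (axis l 1) f) x))"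
    using D_expand_cart[OF d(2)[OF assms(3)]] by metis
  also have "\<dots> = (\<Sigma> l. \<Sigma> k. (v $ k * w $ l) *\<^sub>R D (axis k 1) (D (axis l 1) f) x)"
    by (simp add: scaleR_sum_right mult.commute)
  also have "\<dots> = (\<Sigma> k. \<Sigma> l. (v $ k * w $ l) *\<^sub>R D (axis k 1) (D (axis l 1) f) x)"
    by (rule sum.swap)
  finally show ?thesis .
qed

lemma D2_cong:
  assumes "open S" "x \<in> S" "\<And>y. y \<in> S \<Longrightarrow> f y = g y"
  shows "D v (D w f) x = D v (D w g) x"
  by (rule D_cong[OF assms(1,2)]) (rule D_cong[OF assms(1) _ assms(3)])

lemma D2_bilinear:
  assumes h: "bounded_bilinear h" and "open S" "smooth_on f S" "smooth_on g S" "x \<in> S"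
  shows "D v (D w (\<lambda>x. h (f x) (g x))) x =
    h (f x) (D v (D w g) x) + h (D v f x) (D w g x) + h (D w f x) (D v g x) + h (D v (D w f) x) (g x)"
proof -
  note df = smooth_diff[OF assms(3)] smooth_diff[OF smooth_on_D[OF assms(3)]]
    and dg = smooth_diff[OF assms(4)] smooth_diff[OF smooth_on_D[OF assms(4)]]
  have "D v (D w (\<lambda>x. h (f x) (g x))) x = D v (\<lambda>x. h (f x) (D w g x) + h (D w f x) (g x)) x"
    by (rule D_cong[OF assms(2,5)]) (simp add: D_bilinear[OF h] df dg)
  also have "\<dots> = D v (\<lambda>x. h (f x) (D w g x)) x + D v (\<lambda>x. h (D w f x) (g x)) x"
    using assms(5) by (intro D_add differentiable_bilinear[OF h] df dg)
  also have "\<dots> = (h (f x) (D v (D w g) x) + h (D v f x) (D w g x)) + (h (D w f x) (D v g x) + h (D v (D w f) x) (g x))"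
    using assms(5) by (simp add: D_bilinear[OF h] df dg)
  finally show ?thesis by (simp add: add.assoc)
qed

lemma D2_sum:
  assumes "open S" "\<And>i. i \<in> I \<Longrightarrow> smooth_on (f i) S" "x \<in> S"
  shows "D v (D w (\<lambda>x. \<Sum>i\<in>I. f i x)) x = (\<Sum>i\<in>I. D v (D w (f i)) x)"
proof -
  have "D v (D w (\<lambda>x. \<Sum>i\<in>I. f i x)) x = D v (\<lambda>x. \<Sum>i\<in>I. D w (f i) x) x"
    by (rule D_cong[OF assms(1,3)]) (simp add: D_sum smooth_diff[OF assms(2)])
  also have "\<dots> = (\<Sum>i\<in>I. D v (D w (f i)) x)"
    using assms(3) by (simp add: D_sum smooth_diff[OF smooth_on_D[OF assms(2)]])
  finally show ?thesis .
qed

lemma D2_add: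
  assumes "open S" "smooth_on f S" "smooth_on g S" "x \<in> S"
  shows "D v (D w (\<lambda>x. f x + g x)) x = D v (D w f) x + D v (D w g) x"
proof -
  have "D v (D w (\<lambda>x. f x + g x)) x = D v (\<lambda>x. D w f x + D w g x) x"
    by (rule D_cong[OF assms(1,4)]) (simp add: D_add smooth_diff[OF assms(2)] smooth_diff[OF assms(3)])
  also have "\<dots> = D v (D w f) x + D v (D w g) x"
    using assms(4)
    by (simp add: D_add smooth_diff[OF smooth_on_D[OF assms(2)]] smooth_diff[OF smooth_on_D[OF assms(3)]])
  finally show ?thesis .
qed

lemma D2_mult:
  fixes f g :: "'a::euclidean_space \<Rightarrow> real"
  shows "open S \<Longrightarrow> smooth_on f S \<Longrightarrow> smooth_on g S \<Longrightarrow> x \<in> S \<Longrightarrow> D v (D w (\<lambda>x. f x * g x)) x =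
    f x * D v (D w g) x + D v f x * D w g x + D w f x * D v g x + D v (D w f) x * g x"
  by (rule D2_bilinear[OF bounded_bilinear_mult])

section \<open>Symmetry of second derivatives\<close>

lemma line_DERIV:
  fixes f :: "'a::euclidean_space \<Rightarrow> real"
  assumes "f differentiable (at (y + t *\<^sub>R v))"
  shows "((\<lambda>t. f (y + t *\<^sub>R v)) has_real_derivative D v f (y + t *\<^sub>R v)) (at t)"
proof -
  have "((\<lambda>t. y + t *\<^sub>R v) has_derivative (\<lambda>h. h *\<^sub>R v)) (at t)"
    by (auto intro!: derivative_eq_intros)
  from has_derivative_compose[OF this has_derivative_D[OF assms]]
  have "((\<lambda>t. f (y + t *\<^sub>R v)) has_derivative (\<lambda>h. D (h *\<^sub>R v) f (y + t *\<^sub>R v))) (at t)" .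
  moreover have "(\<lambda>h. D (h *\<^sub>R v) f (y + t *\<^sub>R v)) = (*) (D v f (y + t *\<^sub>R v))"
    by (rule ext) (simp add: linear_cmul[OF linear_D[OF assms]])
  ultimately show ?thesis by (simp add: has_field_derivative_def)
qed

text \<open>The mean value theorem is used twice: in direction \<open>v\<close> for the difference
  of \<open>f\<close> and its translate by \<open>s w\<close>, then in direction \<open>w\<close>
  for \<open>D v f\<close>. The intermediate point is only known to lie in the
  parallelogram.\<close>

lemma second_difference:
  fixes f :: "'a::euclidean_space \<Rightarrow> real"
  assumes "smooth_on f S" "0 < s"
    and S: "\<And>a b. 0 \<le> a \<Longrightarrow> a \<le> s \<Longrightarrow> 0 \<le> b \<Longrightarrow> b \<le> s \<Longrightarrow> x + a *\<^sub>R v + b *\<^sub>R w \<in> S"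
  shows "\<exists>a b. 0 \<le> a \<and> a \<le> s \<and> 0 \<le> b \<and> b \<le> s \<and>
    f (x + s *\<^sub>R v + s *\<^sub>R w) - f (x + s *\<^sub>R v) - f (x + s *\<^sub>R w) + f x
      = s * s * D w (D v f) (x + a *\<^sub>R v + b *\<^sub>R w)"
proof -
  note d = smooth_diff[OF assms(1)] smooth_diff[OF smooth_on_D[OF assms(1)]]
  have "\<exists>a>0. a < s \<and> (f (x + s *\<^sub>R w + s *\<^sub>R v) - f (x + s *\<^sub>R v)) - (f (x + s *\<^sub>R w + 0 *\<^sub>R v) - f (x + 0 *\<^sub>R v))
      = (s - 0) * (D v f (x + s *\<^sub>R w + a *\<^sub>R v) - D v f (x + a *\<^sub>R v))"
  proof (rule MVT2[OF assms(2)])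
    fix t assume t: "0 \<le> t" "t \<le> s"
    show "((\<lambda>t. f (x + s *\<^sub>R w + t *\<^sub>R v) - f (x + t *\<^sub>R v)) has_real_derivative
        D v f (x + s *\<^sub>R w + t *\<^sub>R v) - D v f (x + t *\<^sub>R v)) (at t)"
      using S[OF t, of s] S[OF t, of 0] assms(2)
      by (intro DERIV_diff line_DERIV d(1)) (simp_all add: add_ac)
  qed
  then obtain a where a: "0 < a" "a < s"
    "f (x + s *\<^sub>R w + s *\<^sub>R v) - f (x + s *\<^sub>R v) - (f (x + s *\<^sub>R w) - f x)
      = s * (D v f (x + s *\<^sub>R w + a *\<^sub>R v) - D v f (x + a *\<^sub>R v))" by auto
  have "\<exists>b>0. b < s \<and> D v f (x + a *\<^sub>R v + s *\<^sub>R w) - D v f (x + a *\<^sub>R v + 0 *\<^sub>R w)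
      = (s - 0) * D w (D v f) (x + a *\<^sub>R v + b *\<^sub>R w)"
    using S a by (intro MVT2[OF assms(2)] line_DERIV d(2)) simp
  then obtain b where "0 < b" "b < s"
    "D v f (x + a *\<^sub>R v + s *\<^sub>R w) - D v f (x + a *\<^sub>R v) = s * D w (D v f) (x + a *\<^sub>R v + b *\<^sub>R w)" by auto
  with a show ?thesis by (intro exI[of _ a] exI[of _ b]) (simp add: algebra_simps)
qed

text \<open>The second difference is symmetric in \<open>v\<close> and \<open>w\<close>, so both
  mixed derivatives take a common value at points arbitrarily close to \<open>x\<close>. By
  continuity they agree at \<open>x\<close>.\<close>

lemma D_symmetric_real:
  fixes f :: "'a::euclidean_space \<Rightarrow> real"
  assumes "open S" "smooth_on f S" "x \<in> S"
  shows "D v (D w f) x = D w (D v f) x"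
proof (rule ccontr)
  let ?p = "D w (D v f)" and ?q = "D v (D w f)"
  assume ne: "?q x \<noteq> ?p x"
  define \<epsilon> where "\<epsilon> = \<bar>?q x - ?p x\<bar> / 2"
  have "\<epsilon> > 0" using ne by (simp add: \<epsilon>_def)
  have "isCont ?p x" "isCont ?q x"
    using smooth_on_continuous[OF smooth_on_D[OF smooth_on_D[OF assms(2)]]] assms(1,3)
    by (auto simp: continuous_on_eq_continuous_at)
  then obtain d1 d2 where d1: "d1 > 0" "\<And>z. dist z x < d1 \<Longrightarrow> dist (?p z) (?p x) < \<epsilon>"
    and d2: "d2 > 0" "\<And>z. dist z x < d2 \<Longrightarrow> dist (?q z) (?q x) < \<epsilon>"
    unfolding continuous_at_eps_delta using \<open>\<epsilon> > 0\<close> by (metis dist_norm)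
  obtain d3 where d3: "d3 > 0" "ball x d3 \<subseteq> S" using assms(1,3) openE by blast
  define d where "d = min d1 (min d2 d3)"
  \<comment> \<open>Every point of the parallelogram spanned by \<open>s v\<close> and
    \<open>s w\<close> at \<open>x\<close> is then closer to \<open>x\<close> than \<open>d\<close>;
    the 1 keeps the denominator positive when both directions vanish.\<close>
  define s where "s = d / (norm v + norm w + 1)"
  have "d > 0" using d1 d2 d3 by (simp add: d_def)
  have "norm v + norm w + 1 > 0" by (smt (verit) norm_ge_zero)
  have "s > 0" using \<open>d > 0\<close> \<open>norm v + norm w + 1 > 0\<close> by (simp add: s_def)
  have near: "dist (x + a *\<^sub>R v + b *\<^sub>R w) x < d" if "0 \<le> a" "a \<le> s" "0 \<le> b" "b \<le> s" for a b
  proof -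
    have "dist (x + a *\<^sub>R v + b *\<^sub>R w) x = norm (a *\<^sub>R v + b *\<^sub>R w)" by (simp add: dist_norm algebra_simps)
    also have "\<dots> \<le> a * norm v + b * norm w" using norm_triangle_ineq[of "a *\<^sub>R v" "b *\<^sub>R w"] that by simp
    also have "\<dots> \<le> s * norm v + s * norm w" using that by (intro add_mono mult_right_mono) auto
    also have "\<dots> < s * (norm v + norm w + 1)" using \<open>s > 0\<close> by (simp add: algebra_simps)
    also have "\<dots> = d" using \<open>norm v + norm w + 1 > 0\<close> by (simp add: s_def)
    finally show ?thesis .
  qed
  have inS: "x + a *\<^sub>R v + b *\<^sub>R w \<in> S" if "0 \<le> a" "a \<le> s" "0 \<le> b" "b \<le> s" for a b
    using near[OF that] d3(2) by (auto simp: d_def mem_ball dist_commute)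
  obtain a b where ab: "0 \<le> a" "a \<le> s" "0 \<le> b" "b \<le> s"
    "f (x + s *\<^sub>R v + s *\<^sub>R w) - f (x + s *\<^sub>R v) - f (x + s *\<^sub>R w) + f x = s * s * ?p (x + a *\<^sub>R v + b *\<^sub>R w)"
    using second_difference[OF assms(2) \<open>s > 0\<close>, of x v w] inS by blast
  have inS': "x + a *\<^sub>R w + b *\<^sub>R v \<in> S" if "0 \<le> a" "a \<le> s" "0 \<le> b" "b \<le> s" for a b
    using inS[of b a] that by (simp add: add_ac)
  obtain a' b' where ab': "0 \<le> a'" "a' \<le> s" "0 \<le> b'" "b' \<le> s"
    "f (x + s *\<^sub>R w + s *\<^sub>R v) - f (x + s *\<^sub>R w) - f (x + s *\<^sub>R v) + f x = s * s * ?q (x + a' *\<^sub>R w + b' *\<^sub>R v)"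
    using second_difference[OF assms(2) \<open>s > 0\<close>, of x w v] inS' by blast
  have e: "x + s *\<^sub>R w + s *\<^sub>R v = x + s *\<^sub>R v + s *\<^sub>R w"
    "x + a' *\<^sub>R w + b' *\<^sub>R v = x + b' *\<^sub>R v + a' *\<^sub>R w" by (simp_all add: add_ac)
  have "s * s * ?p (x + a *\<^sub>R v + b *\<^sub>R w) = s * s * ?q (x + b' *\<^sub>R v + a' *\<^sub>R w)"
    using ab(5) ab'(5) unfolding e by linarith
  then have "?p (x + a *\<^sub>R v + b *\<^sub>R w) = ?q (x + b' *\<^sub>R v + a' *\<^sub>R w)" using \<open>s > 0\<close> by simp
  moreover have "dist (?p (x + a *\<^sub>R v + b *\<^sub>R w)) (?p x) < \<epsilon>"
    using near[OF ab(1-4)] by (intro d1(2)) (simp add: d_def)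
  moreover have "dist (?q (x + b' *\<^sub>R v + a' *\<^sub>R w)) (?q x) < \<epsilon>"
    using near[OF ab'(3,4,1,2)] by (intro d2(2)) (simp add: d_def)
  moreover have "\<not> (\<bar>a - p\<bar> < \<bar>q - p\<bar> / 2 \<and> \<bar>a - q\<bar> < \<bar>q - p\<bar> / 2)" for a p q :: real
    using abs_triangle_ineq[of "q - a" "a - p"] abs_minus_commute[of a q] by auto
  ultimately show False unfolding \<epsilon>_def dist_real_def by metis
qed

lemma D_symmetric:
  fixes f :: "'a::euclidean_space \<Rightarrow> 'b::euclidean_space"
  assumes "open S" "smooth_on f S" "x \<in> S"
  shows "D v (D w f) x = D w (D v f) x"
proof (rule euclidean_eqI)
  fix b :: 'b
  have bl: "bounded_linear (\<lambda>y. y \<bullet> b)" by (rule bounded_linear_inner_left)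
  have eq: "D v (D w (\<lambda>x. f x \<bullet> b)) x = D v (D w f) x \<bullet> b" for v w
  proof -
    have "D v (D w (\<lambda>x. f x \<bullet> b)) x = D v (\<lambda>x. D w f x \<bullet> b) x"
      by (rule D_cong[OF assms(1,3)]) (simp add: D_bounded_linear[OF bl] smooth_diff[OF assms(2)])
    also have "\<dots> = D v (D w f) x \<bullet> b"
      by (rule D_bounded_linear[OF bl smooth_diff[OF smooth_on_D[OF assms(2)] assms(3)]])
    finally show ?thesis .
  qed
  show "D v (D w f) x \<bullet> b = D w (D v f) x \<bullet> b"
    using D_symmetric_real[OF assms(1) smooth_on_bounded_linear[OF assms(1) bl assms(2)] assms(3)] by (simp add: eq)
qed

section \<open>The strong maximum principle\<close>

text \<open>Restrict to a line: were the second derivative positive, the first would be positive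
  just to the right of 0, and the function would exceed its maximum there.\<close>

lemma local_max_D:
  fixes f :: "'a::euclidean_space \<Rightarrow> real"
  assumes "open S" "smooth_on f S" "x \<in> S" "\<And>y. y \<in> S \<Longrightarrow> f y \<le> f x"
  shows "D v f x = 0" "D v (D v f) x \<le> 0"
proof -
  note d = smooth_diff[OF assms(2)] smooth_diff[OF smooth_on_D[OF assms(2)]]
  obtain r where r: "r > 0" "ball x r \<subseteq> S" using assms(1,3) openE by blast
  define e where "e = r / (norm v + 1)"
  have np: "norm v + 1 > 0" by (smt (verit) norm_ge_zero)
  have "e > 0" using r np by (simp add: e_def)
  have inS: "x + t *\<^sub>R v \<in> S" if "\<bar>t\<bar> < e" for t
  proof -
    have "\<bar>t\<bar> * norm v \<le> e * norm v" using that by (intro mult_right_mono) auto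
    also have "\<dots> < e * (norm v + 1)" using \<open>e > 0\<close> by simp
    also have "\<dots> = r" using np by (simp add: e_def)
    finally show ?thesis using r(2) by (auto simp: dist_norm)
  qed
  define h where "h t = f (x + t *\<^sub>R v)" for t
  define h' where "h' t = D v f (x + t *\<^sub>R v)" for t
  have h: "(h has_real_derivative h' t) (at t)" if "\<bar>t\<bar> < e" for t
    unfolding h_def h'_def using d(1)[OF inS[OF that]] by (rule line_DERIV)
  have h2: "(h' has_real_derivative D v (D v f) x) (at 0)"
    unfolding h'_def using line_DERIV[of "D v f" x 0 v] d(2)[OF assms(3)] by simp
  have max: "h t \<le> h 0" if "\<bar>t\<bar> < e" for t
    using assms(4)[OF inS[OF that]] by (simp add: h_def)
  have "h' 0 = 0"
    using \<open>e > 0\<close> max by (intro DERIV_local_max[OF h[of 0], of e]) auto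
  then show "D v f x = 0" by (simp add: h'_def)
  show "D v (D v f) x \<le> 0"
  proof (rule ccontr)
    assume "\<not> D v (D v f) x \<le> 0"
    then obtain \<delta> where \<delta>: "\<delta> > 0" "\<And>t. 0 < t \<Longrightarrow> t < \<delta> \<Longrightarrow> h' 0 < h' (0 + t)"
      using DERIV_pos_inc_right[OF h2] by auto
    define t where "t = min \<delta> e / 2"
    have t: "0 < t" "t < \<delta>" "t < e" using \<delta>(1) \<open>e > 0\<close> by (auto simp: t_def)
    then obtain z where "0 < z" "z < t" "h t - h 0 = (t - 0) * h' z"
      using MVT2[OF t(1), of h h'] h by auto
    then have "h t > h 0" using \<delta>(2)[of z] \<open>h' 0 = 0\<close> t by (simp add: algebra_simps)
    then show False using max[of t] t by simp
  qed
qed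

section \<open>Second-order operators in coordinates\<close>

abbreviation pd :: "'m \<Rightarrow> (real^'m \<Rightarrow> 'b::real_normed_vector) \<Rightarrow> real^'m \<Rightarrow> 'b" where
  "pd k \<equiv> D (axis k 1)"

definition elliptic_op ::
  "(real^'m \<Rightarrow> 'm \<Rightarrow> 'm \<Rightarrow> real) \<Rightarrow> (real^'m \<Rightarrow> 'm \<Rightarrow> real) \<Rightarrow> (real^'m \<Rightarrow> real) \<Rightarrow> real^'m \<Rightarrow> real" where
  "elliptic_op A b w x =
    (\<Sigma> k. \<Sigma> l. A x k l * pd k (pd l w) x) + (\<Sigma> k. b x k * pd k w x)"

text \<open>Writing the leading coefficients as a sum of squares of vectors \<open>E i\<close> turns
  the leading part into a sum of pure second derivatives \<open>D (E i) (D (E i) w)\<close>, each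
  nonpositive at a maximum. This replaces diagonalization.\<close>

lemma elliptic_op_local_max:
  fixes w :: "real^'m \<Rightarrow> real" and E :: "'m \<Rightarrow> real^'m"
  assumes "open S" "smooth_on w S" "x \<in> S" "\<And>y. y \<in> S \<Longrightarrow> w y \<le> w x"
    and "\<And>k l. A x k l = (\<Sigma> i. E i $ k * E i $ l)"
  shows "elliptic_op A b w x \<le> 0"
proof -
  have "(\<Sigma> k. \<Sigma> l. A x k l * pd k (pd l w) x)
      = (\<Sigma> k. \<Sigma> l. \<Sigma> i. E i $ k * E i $ l * pd k (pd l w) x)"
    by (simp add: assms(5) sum_distrib_right)
  also have "\<dots> = (\<Sigma> k. \<Sigma> i. \<Sigma> l. E i $ k * E i $ l * pd k (pd l w) x)"
    by (rule sum.cong[OF refl], rule sum.swap)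
  also have "\<dots> = (\<Sigma> i. \<Sigma> k. \<Sigma> l. E i $ k * E i $ l * pd k (pd l w) x)"
    by (rule sum.swap)
  also have "\<dots> = (\<Sigma> i. D (E i) (D (E i) w) x)"
    by (simp add: D2_expand_cart[OF assms(1-3), of "E i" "E i" for i])
  also have "\<dots> \<le> 0"
    by (rule sum_nonpos) (rule local_max_D(2)[OF assms(1-4)])
  finally show ?thesis
    by (simp add: elliptic_op_def local_max_D(1)[OF assms(1-4)])
qed

lemma elliptic_op_add:
  assumes "open S" "smooth_on f S" "smooth_on g S" "x \<in> S"
  shows "elliptic_op A b (\<lambda>x. f x + g x) x = elliptic_op A b f x + elliptic_op A b g x"
  using assms(4)
  by (simp add: elliptic_op_def D2_add[OF assms] D_add smooth_diff[OF assms(2)]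
      smooth_diff[OF assms(3)] algebra_simps sum.distrib)

lemma elliptic_op_mult:
  assumes "open S" "smooth_on f S" "smooth_on g S" "x \<in> S" and sym: "\<And>k l. A x k l = A x l k"
  shows "elliptic_op A b (\<lambda>x. f x * g x) x = f x * elliptic_op A b g x + g x * elliptic_op A b f x
    + 2 * (\<Sigma> k. \<Sigma> l. A x k l * (pd k f x * pd l g x))"
proof -
  have "(\<Sigma> k. \<Sigma> l. A x k l * (pd l f x * pd k g x))
      = (\<Sigma> l. \<Sigma> k. A x k l * (pd l f x * pd k g x))" by (rule sum.swap)
  also have "\<dots> = (\<Sigma> k. \<Sigma> l. A x k l * (pd k f x * pd l g x))"
    by (simp add: sym)
  finally have *: "(\<Sigma> k. \<Sigma> l. A x k l * (pd l f x * pd k g x)) = \<dots>" .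
  have "elliptic_op A b (\<lambda>x. f x * g x) x =
     (\<Sigma> k. \<Sigma> l. f x * (A x k l * pd k (pd l g) x) + A x k l * (pd k f x * pd l g x)
        + A x k l * (pd l f x * pd k g x) + g x * (A x k l * pd k (pd l f) x))
     + (\<Sigma> k. f x * (b x k * pd k g x) + g x * (b x k * pd k f x))"
    using assms(4)
    by (simp add: elliptic_op_def D2_mult[OF assms(1-4)] D_mult smooth_diff[OF assms(2)]
        smooth_diff[OF assms(3)] algebra_simps)
  then show ?thesis
    by (simp only: sum.distrib * elliptic_op_def sum_distrib_left[symmetric] distrib_left)
qed

lemma elliptic_op_const: "elliptic_op A b (\<lambda>x. c) x = 0"
proof -
  have "pd l (\<lambda>x. c) = (\<lambda>x. 0)" for l :: 'a by (rule ext) (rule D_const)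
  then show ?thesis by (simp add: elliptic_op_def D_const)
qed

lemma elliptic_op_cmult:
  assumes "open S" "smooth_on f S" "x \<in> S" and sym: "\<And>k l. A x k l = A x l k"
  shows "elliptic_op A b (\<lambda>x. c * f x) x = c * elliptic_op A b f x"
  using elliptic_op_mult[OF assms(1) smooth_on_const assms(2,3), of A b c] sym
  by (simp add: elliptic_op_const D_const)

lemma continuous_on_elliptic_op:
  assumes "\<And>k l. continuous_on S (\<lambda>x. A x k l)" "\<And>k. continuous_on S (\<lambda>x. b x k)" "smooth_on w S"
  shows "continuous_on S (elliptic_op A b w)"
proof -
  have "continuous_on S (\<lambda>x. (\<Sigma> k. \<Sigma> l. A x k l * pd k (pd l w) x) + (\<Sigma> k. b x k * pd k w x))"
    by (intro continuous_intros assms(1,2) smooth_on_continuous smooth_on_D assms(3))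
  then show ?thesis by (simp add: elliptic_op_def[abs_def])
qed

text \<open>Hopf's argument: the interior of the set where the maximum is not attained would contain a ball
  touching the maximum set in a single point \<open>z\<close>. With \<open>q\<close> the power of a point with respect to the
  boundary sphere, the barrier \<open>K * q^2 - q\<close> is strictly subharmonic near \<open>z\<close>, so adding a small
  multiple of it to \<open>w\<close> creates an impossible interior maximum near \<open>z\<close>.\<close>

lemma strong_maximum_principle:
  fixes w :: "real^'m \<Rightarrow> real"
  assumes S: "open S"
    and contA: "\<And>k l. continuous_on S (\<lambda>x. A x k l)" and contb: "\<And>k. continuous_on S (\<lambda>x. b x k)"
    and frame: "\<And>x. x \<in> S \<Longrightarrow> \<exists>E::'m \<Rightarrow> real^'m. \<forall>k l. A x k l = (\<Sigma> i. E i $ k * E i $ l)"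
    and pos: "\<And>x y. x \<in> S \<Longrightarrow> y \<noteq> 0 \<Longrightarrow> 0 < (\<Sigma> k. \<Sigma> l. A x k l * (y $ k * y $ l))"
    and w: "smooth_on w S"
    and sub: "\<And>x. x \<in> S \<Longrightarrow> 0 \<le> elliptic_op A b w x"
    and R: "0 < R" "cball x0 R \<subseteq> S" and max: "\<And>x. x \<in> cball x0 R \<Longrightarrow> w x \<le> w x0"
    and y: "y \<in> ball x0 (R / 2)"
  shows "w y = w x0"
proof (rule ccontr)
  assume ne: "w y \<noteq> w x0"
  have sym: "A x k l = A x l k" if "x \<in> S" for x k l
    using frame[OF that] by (metis (no_types, lifting) mult.commute sum.cong)
  have contw: "continuous_on S w" by (rule smooth_on_continuous[OF w])
  define Z where "Z = {x \<in> cball x0 R. w x = w x0}"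
  have "closed Z"
    unfolding Z_def using contw R(2)
    by (intro continuous_closed_preimage_constant) (auto intro: continuous_on_subset)
  moreover have "x0 \<in> Z" using R by (simp add: Z_def)
  ultimately obtain z where z: "z \<in> Z" "\<And>p. p \<in> Z \<Longrightarrow> dist y z \<le> dist y p"
    using distance_attains_inf[of Z y] by blast
  define r where "r = dist y z"
  have "r > 0" using z(1) ne by (auto simp: r_def Z_def)
  \<comment> \<open>The centre \<open>x0\<close> itself competes for the nearest point, so
    \<open>z\<close> stays inside the ball of radius \<open>R\<close>. This is the reason for the
    radius \<open>R / 2\<close> in the conclusion.\<close>
  have "r < R / 2" using z(2)[OF \<open>x0 \<in> Z\<close>] y by (simp add: r_def dist_commute)
  have zR: "z \<in> ball x0 R"
    using dist_triangle[of x0 z y] \<open>r < R / 2\<close> y by (simp add: r_def)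
  then have zS: "z \<in> S" using R(2) by auto
  \<comment> \<open>The open ball of radius \<open>r\<close> about \<open>y\<close> misses
    \<open>Z\<close> but may touch it in many points. The ball with half the radius that is
    internally tangent at \<open>z\<close> has \<open>z\<close> as its only contact.\<close>
  define c where "c = midpoint y z"
  define h where "h = (1/2) *\<^sub>R (z - y)"
  have ch: "c - y = h" "z - c = h" by (simp_all add: vec_eq_iff c_def h_def midpoint_def field_simps)
  have hh: "h \<bullet> h = (r/2)\<^sup>2"
    by (simp add: h_def r_def dist_norm norm_minus_commute power2_norm_eq_inner[symmetric] power_divide power_mult_distrib
        del: inner_diff_left inner_diff_right)
  have touch: "p = z" if p: "p \<in> Z" "(p - c) \<bullet> (p - c) \<le> (r/2)\<^sup>2" for p
  proof -
    have "r \<le> dist y p" using z(2)[OF p(1)] by (simp add: r_def)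
    then have "r\<^sup>2 \<le> (dist y p)\<^sup>2" using \<open>r > 0\<close> by (intro power_mono) auto
    also have "\<dots> = ((p - c) + h) \<bullet> ((p - c) + h)"
      by (simp add: dist_norm norm_minus_commute power2_norm_eq_inner[symmetric] flip: ch(1))
    \<comment> \<open>Parallelogram law: the squared norms of \<open>p - c + h\<close> and
      \<open>p - c - h\<close> add up to at most \<open>r^2\<close>, and the first is already at
      least \<open>r^2\<close>.\<close>
    finally have "((p - c) - h) \<bullet> ((p - c) - h) \<le> 0"
      using p(2) hh by (simp add: inner_diff_left inner_diff_right inner_add_left inner_add_right inner_commute power_divide)
    then have "p - c = h" using inner_ge_zero[of "p - c - h"] by (metis eq_iff_diff_eq_0 inner_eq_zero_iff order_antisym)
    then show ?thesis using ch(2) by (metis diff_add_cancel)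
  qed
  define q where "q x = (x - c) \<bullet> (x - c) + - (r/2)\<^sup>2" for x
  have sm_lin: "smooth_on (\<lambda>x. x - c) T" if "open T" for T
    by (intro smooth_on_diff smooth_on_id smooth_on_const that)
  have q: "smooth_on q S"
    unfolding q_def[abs_def]
    by (intro smooth_on_add smooth_on_const S smooth_on_bilinear[OF S bounded_bilinear_inner] sm_lin)
  have Dq: "D v q x = 2 * (v \<bullet> (x - c))" for v x
  proof -
    have d: "(\<lambda>x. x - c) differentiable (at x)" by simp
    have "D v q x = (x - c) \<bullet> v + v \<bullet> (x - c)"
      unfolding q_def[abs_def] using differentiable_bilinear[OF bounded_bilinear_inner d d]
      by (simp add: D_add D_const D_bilinear[OF bounded_bilinear_inner d d] D_diff D_ident)
    then show ?thesis by (simp add: inner_commute)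
  qed
  have qz: "q z = 0" using hh by (simp add: q_def ch)
  define G where "G x = (\<Sigma> k. \<Sigma> l. A x k l * (pd k q x * pd l q x))" for x
  have contG: "continuous_on S G"
    unfolding G_def[abs_def] by (intro continuous_intros contA smooth_on_continuous smooth_on_D q)
  have "G z = 4 * (\<Sigma> k. \<Sigma> l. A z k l * (h $ k * h $ l))"
    by (simp add: G_def Dq ch(2) inner_axis' sum_distrib_left algebra_simps)
  moreover have "h \<noteq> 0" using hh \<open>r > 0\<close> by auto
  ultimately have Gz: "G z > 0" using pos[OF zS, of h] by simp
  define Lq where "Lq = elliptic_op A b q"
  have contLq: "continuous_on S Lq"
    unfolding Lq_def by (rule continuous_on_elliptic_op[OF contA contb q])
  define C where "C = \<bar>Lq z\<bar> + 1"
  \<comment> \<open>The operator maps the barrier to \<open>(2 K q - 1) Lq + 2 K G\<close>. Where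
    \<open>|K q| < 1/2\<close> and \<open>|Lq| < C\<close>, the first term is at least
    \<open>- 2 C\<close>, while \<open>G > G z / 2\<close> makes the second exceed
    \<open>2 (C + 1)\<close>.\<close>
  define K where "K = (C + 1) / (G z / 2)"
  have CK: "C > 0" "K > 0" "K * (G z / 2) = C + 1" using Gz by (simp_all add: C_def K_def)
  have cont: "isCont G z" "isCont Lq z" "isCont q z"
    using contG contLq smooth_on_continuous[OF q] zS S by (auto simp: continuous_on_eq_continuous_at)
  have "\<forall>\<^sub>F x in nhds z. G z / 2 < G x" "\<forall>\<^sub>F x in nhds z. \<bar>Lq x\<bar> < C" "\<forall>\<^sub>F x in nhds z. \<bar>q x\<bar> < 1 / (2 * K)"
    using order_tendstoD(1)[OF cont(1)[unfolded isCont_def tendsto_at_iff_tendsto_nhds], of "G z / 2"] Gz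
      order_tendstoD(2)[OF tendsto_rabs[OF cont(2)[unfolded isCont_def tendsto_at_iff_tendsto_nhds]], of C]
      order_tendstoD(2)[OF tendsto_rabs[OF cont(3)[unfolded isCont_def tendsto_at_iff_tendsto_nhds]], of "1 / (2 * K)"]
      qz CK(2)
    by (auto simp: C_def)
  moreover have "\<forall>\<^sub>F x in nhds z. x \<in> ball x0 R"
    by (rule eventually_nhds_in_open[OF open_ball zR])
  ultimately have "\<forall>\<^sub>F x in nhds z. G z / 2 < G x \<and> \<bar>Lq x\<bar> < C \<and> \<bar>q x\<bar> < 1 / (2 * K) \<and> x \<in> ball x0 R"
    by (auto simp: eventually_conj_iff)
  then obtain \<rho>0 where \<rho>0: "\<rho>0 > 0" "\<And>x. dist x z < \<rho>0 \<Longrightarrow>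
      G z / 2 < G x \<and> \<bar>Lq x\<bar> < C \<and> \<bar>q x\<bar> < 1 / (2 * K) \<and> x \<in> ball x0 R"
    unfolding eventually_nhds_metric by blast
  define \<rho> where "\<rho> = \<rho>0 / 2"
  have \<rho>: "\<rho> > 0" "\<And>x. x \<in> cball z \<rho> \<Longrightarrow> G z / 2 < G x \<and> \<bar>Lq x\<bar> < C \<and> \<bar>q x\<bar> < 1 / (2 * K) \<and> x \<in> ball x0 R"
    using \<rho>0 by (auto simp: \<rho>_def dist_commute)
  have sub_S: "cball z \<rho> \<subseteq> S" using \<rho>(2) R(2) by fastforce
  define v where "v x = K * (q x * q x) + (- 1) * q x" for x
  have v: "smooth_on v S"
    unfolding v_def[abs_def] by (intro smooth_on_add smooth_on_mult smooth_on_const S q)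
  have Kq: "\<bar>K * q x\<bar> < 1/2" if "x \<in> cball z \<rho>" for x
    using \<rho>(2)[OF that] CK(2) by (simp add: abs_mult field_simps)
  have Lv: "elliptic_op A b v x > 0" if x: "x \<in> cball z \<rho>" for x
  proof -
    have xS: "x \<in> S" using x sub_S by auto
    note cmult = elliptic_op_cmult[where A = A and b = b, OF S _ xS sym[OF xS]]
    have "elliptic_op A b v x = elliptic_op A b (\<lambda>x. K * (q x * q x)) x + elliptic_op A b (\<lambda>x. (- 1) * q x) x"
      unfolding v_def[abs_def] by (intro elliptic_op_add[OF S _ _ xS] smooth_on_mult smooth_on_const S q)
    also have "\<dots> = K * elliptic_op A b (\<lambda>x. q x * q x) x + (- 1) * Lq x"
      unfolding Lq_def by (simp only: cmult[OF smooth_on_mult[OF S q q]] cmult[OF q])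
    also have "\<dots> = K * (2 * q x * Lq x + 2 * G x) - Lq x"
      by (simp add: elliptic_op_mult[where A = A and b = b, OF S q q xS sym[OF xS]] Lq_def G_def)
    also have "\<dots> = (2 * (K * q x) - 1) * Lq x + 2 * (K * G x)" by (simp add: algebra_simps)
    finally have eq: "elliptic_op A b v x = \<dots>" .
    have "\<bar>(2 * (K * q x) - 1) * Lq x\<bar> \<le> 2 * C"
      unfolding abs_mult using Kq[OF x] \<rho>(2)[OF x] by (intro mult_mono) auto
    moreover have "K * G x > C + 1" using \<rho>(2)[OF x] CK by (metis mult_strict_left_mono)
    ultimately show ?thesis unfolding eq by linarith
  qed
  define T where "T = sphere z \<rho> \<inter> cball c (r/2)"
  have inT: "p \<in> cball c (r/2) \<longleftrightarrow> q p \<le> 0" for p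
    using \<open>r > 0\<close> abs_le_square_iff[of "dist c p" "r/2"]
    by (simp add: q_def dist_norm norm_minus_commute power2_norm_eq_inner[symmetric])
  have lessT: "w p < w x0" if "p \<in> T" for p
  proof -
    have p: "p \<in> cball x0 R" "p \<noteq> z" "q p \<le> 0"
      using that \<rho>(1) \<rho>(2)[of p] inT by (auto simp: T_def)
    then have "p \<notin> Z" using touch[of p] by (auto simp: q_def)
    then show ?thesis using max[OF p(1)] p(1) by (auto simp: Z_def)
  qed
  have "\<exists>g>0. \<forall>p\<in>T. w p \<le> w x0 - g"
  proof (cases "T = {}")
    case False
    have "compact T" "T \<subseteq> S" using sub_S by (auto simp: T_def intro!: compact_Int)
    then obtain p where "p \<in> T" "\<And>p'. p' \<in> T \<Longrightarrow> w p' \<le> w p"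
      using continuous_attains_sup[of T w] False continuous_on_subset[OF contw] by blast
    then show ?thesis using lessT[of p] by (intro exI[of _ "w x0 - w p"]) auto
  qed (auto intro: exI[of _ 1])
  then obtain g where g: "g > 0" "\<And>p. p \<in> T \<Longrightarrow> w p \<le> w x0 - g" by blast
  \<comment> \<open>On \<open>T\<close> the barrier is at most \<open>1 / K\<close>, so its multiple
    contributes at most \<open>g / 2\<close>, less than the gap of \<open>w\<close>. On the rest of
    the sphere \<open>q\<close> is positive and the barrier negative.\<close>
  define \<delta> where "\<delta> = g * K / 2"
  have "\<delta> > 0" using g CK by (simp add: \<delta>_def)
  define \<psi> where "\<psi> x = w x + \<delta> * v x" for x
  have \<psi>: "smooth_on \<psi> S"
    unfolding \<psi>_def[abs_def] by (intro smooth_on_add smooth_on_mult smooth_on_const S w v)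
  obtain x where x: "x \<in> cball z \<rho>" "\<And>p. p \<in> cball z \<rho> \<Longrightarrow> \<psi> p \<le> \<psi> x"
    using continuous_attains_sup[of "cball z \<rho>" \<psi>] continuous_on_subset[OF smooth_on_continuous[OF \<psi>] sub_S] \<rho>(1)
    by (metis compact_cball cball_eq_empty not_less_iff_gr_or_eq)
  have "\<psi> z = w x0" using z(1) qz by (simp add: \<psi>_def v_def Z_def)
  then have ge: "w x0 \<le> \<psi> x" using x(2)[of z] \<rho>(1) by auto
  have v_eq: "v x = q x * (K * q x - 1)" by (simp add: v_def algebra_simps)
  have int: "x \<in> ball z \<rho>"
  proof (rule ccontr)
    assume "x \<notin> ball z \<rho>"
    then have sph: "x \<in> sphere z \<rho>" using x(1) by auto
    show False
    proof (cases "q x \<le> 0")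
      case True
      then have "w x \<le> w x0 - g" using g(2) sph inT by (simp add: T_def)
      moreover have "\<delta> * v x < g"
      proof -
        have "v x \<le> \<bar>q x\<bar> * \<bar>K * q x - 1\<bar>" unfolding v_eq by (simp add: abs_mult[symmetric])
        also have "\<dots> \<le> 1 / (2 * K) * 2"
          using Kq[OF x(1)] \<rho>(2)[OF x(1)] CK by (intro mult_mono) auto
        finally have "\<delta> * v x \<le> \<delta> * (1 / K)" using \<open>\<delta> > 0\<close> by (intro mult_left_mono) auto
        also have "\<dots> < g" using CK g by (simp add: \<delta>_def)
        finally show ?thesis .
      qed
      ultimately show False using ge by (simp add: \<psi>_def)
    next
      case False
      then have "v x < 0" unfolding v_eq using Kq[OF x(1)] by (intro mult_pos_neg) auto
      then have "\<delta> * v x < 0" using \<open>\<delta> > 0\<close> by (simp add: mult_pos_neg)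
      moreover have "w x \<le> w x0" using \<rho>(2)[OF x(1)] by (intro max) auto
      ultimately show False using ge by (simp add: \<psi>_def)
    qed
  qed
  have xS: "x \<in> S" using x(1) sub_S by auto
  obtain E :: "'m \<Rightarrow> real^'m" where "\<forall>k l. A x k l = (\<Sigma> i. E i $ k * E i $ l)"
    using frame[OF xS] by blast
  moreover have "smooth_on \<psi> (ball z \<rho>)"
    using smooth_on_subset[OF \<psi>] sub_S ball_subset_cball by blast
  ultimately have "elliptic_op A b \<psi> x \<le> 0"
    using x(2) int
    by (intro elliptic_op_local_max[of "ball z \<rho>"]) auto
  moreover have "elliptic_op A b \<psi> x = elliptic_op A b w x + \<delta> * elliptic_op A b v x"
    unfolding \<psi>_def[abs_def]
    by (simp add: elliptic_op_add[OF S w _ xS] smooth_on_mult[OF S smooth_on_const v]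
        elliptic_op_cmult[where A = A and b = b, OF S v xS sym[OF xS]])
  ultimately show False using sub[OF xS] Lv[OF x(1)] \<open>\<delta> > 0\<close> by (smt (verit) mult_pos_pos)
qed

section \<open>Orthonormal frames\<close>

text \<open>Gram-Schmidt as an induction over sets of indices: while an index is left over, fewer
  vectors than the dimension are in use, so some vector lies outside their span.\<close>

lemma orthonormal_frame_exists:
  fixes g :: "real^'m \<Rightarrow> real^'m \<Rightarrow> real"
  assumes "bilinear g" and sym: "\<And>v w. g v w = g w v" and pos: "\<And>v. v \<noteq> 0 \<Longrightarrow> 0 < g v v"
  shows "\<exists>E::'m \<Rightarrow> real^'m. \<forall>i j. g (E i) (E j) = (if i = j then 1 else 0)"
proof -
  interpret g: bounded_bilinear g using assms(1) by (simp add: bilinear_conv_bounded_bilinear)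
  have "\<exists>E::'m \<Rightarrow> real^'m. \<forall>i\<in>I. \<forall>j\<in>I. g (E i) (E j) = (if i = j then 1 else 0)" if "finite I" for I
    using that
  proof (induction I rule: finite_induct)
    case (insert a I)
    then obtain E :: "'m \<Rightarrow> real^'m" where E: "\<And>i j. i \<in> I \<Longrightarrow> j \<in> I \<Longrightarrow> g (E i) (E j) = (if i = j then 1 else 0)"
      by blast
    have "dim (span (E ` I)) \<le> card I"
      using dim_le_card[of "span (E ` I)" "E ` I"] card_image_le[of I E] insert(1) by fastforce
    also have "\<dots> < CARD('m)"
      using insert(1,2) by (metis UNIV_I finite psubset_card_mono subset_UNIV psubsetI)
    finally have "span (E ` I) \<noteq> UNIV" by (metis dim_span dim_UNIV DIM_cart DIM_real mult.right_neutral less_irrefl)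
    then obtain v where v: "v \<notin> span (E ` I)" by blast
    define z where "z = v - (\<Sum>i\<in>I. g v (E i) *\<^sub>R E i)"
    have "(\<Sum>i\<in>I. g v (E i) *\<^sub>R E i) \<in> span (E ` I)"
      by (intro span_sum span_scale span_base) auto
    then have "z \<noteq> 0" using v by (auto simp: z_def)
    have orth: "g z (E j) = 0" if "j \<in> I" for j
    proof -
      have "(\<Sum>i\<in>I. g v (E i) * g (E i) (E j)) = (\<Sum>i\<in>I. if i = j then g v (E i) else 0)"
        using E that by (intro sum.cong) auto
      then show ?thesis
        using that insert(1) by (simp add: z_def g.diff_left g.sum_left g.scaleR_left)
    qed
    define c where "c = 1 / sqrt (g z z)"
    have "c * (c * g z z) = 1" using pos[OF \<open>z \<noteq> 0\<close>] by (simp add: c_def field_simps)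
    then have "\<forall>i\<in>insert a I. \<forall>j\<in>insert a I. g ((E(a := c *\<^sub>R z)) i) ((E(a := c *\<^sub>R z)) j) = (if i = j then 1 else 0)"
      using insert(2) E orth sym[of "E i" z for i] by (auto simp: g.scaleR_left g.scaleR_right)
    then show ?case by blast
  qed simp
  from this[of UNIV] show ?thesis by simp
qed

lemma matrix_inv_left_right:
  assumes "invertible (A :: real^'m^'m)"
  shows "A ** matrix_inv A = mat 1" "matrix_inv A ** A = mat 1"
proof -
  have "A ** matrix_inv A = mat 1 \<and> matrix_inv A ** A = mat 1"
    using assms unfolding invertible_def matrix_inv_def by (rule someI_ex)
  then show "A ** matrix_inv A = mat 1" "matrix_inv A ** A = mat 1" by auto
qed

text \<open>With the frame as columns of \<open>M\<close>, orthonormality reads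
  \<open>M^T G M = 1\<close>. Moving \<open>M\<close> to the other side gives
  \<open>M M^T G = 1\<close>, which contains both the formula for the inverse and the expansion of a
  vector in the frame.\<close>

lemma frame_matrix:
  fixes g :: "real^'m \<Rightarrow> real^'m \<Rightarrow> real" and E :: "'m \<Rightarrow> real^'m"
  assumes "bilinear g" and E: "\<And>i j. g (E i) (E j) = (if i = j then 1 else 0)"
  defines "G \<equiv> \<chi> k l. g (axis k 1) (axis l 1)"
  shows "det G \<noteq> 0" "matrix_inv G $ k $ l = (\<Sigma> i. E i $ k * E i $ l)"
    "v = (\<Sigma> i. g (E i) v *\<^sub>R E i)"
proof -
  interpret g: bounded_bilinear g using assms(1) by (simp add: bilinear_conv_bounded_bilinear)
  have expand: "g v w = (\<Sigma> k. \<Sigma> l. v $ k * w $ l * G $ k $ l)" for v w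
  proof -
    have "g v w = g (\<Sigma> k. v $ k *\<^sub>R axis k 1) (\<Sigma> l. w $ l *\<^sub>R axis l 1)"
      by (simp add: basis_expansion flip: scalar_mult_eq_scaleR)
    then have "g v w = (\<Sigma> l. \<Sigma> k. v $ k * w $ l * G $ k $ l)"
      by (simp add: g.sum_left g.sum_right g.scaleR_left g.scaleR_right G_def sum_distrib_left mult_ac)
    also have "\<dots> = (\<Sigma> k. \<Sigma> l. v $ k * w $ l * G $ k $ l)" by (rule sum.swap)
    finally show ?thesis .
  qed
  define M :: "real^'m^'m" where "M = (\<chi> k i. E i $ k)"
  have 1: "transpose M ** (G ** M) = mat 1"
  proof -
    have "(transpose M ** (G ** M)) $ i $ j = g (E i) (E j)" for i j
      by (simp add: matrix_matrix_mult_def transpose_def M_def expand sum_distrib_left mult_ac)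
    then show ?thesis by (simp add: vec_eq_iff mat_def E)
  qed
  then have "det (transpose M) * (det G * det M) = 1" by (metis det_I det_mul)
  then show detG: "det G \<noteq> 0" by auto
  have 2: "M ** (transpose M ** G) = mat 1"
    using 1 matrix_left_right_inverse by (metis matrix_mul_assoc)
  have "matrix_inv G = (M ** transpose M) ** (G ** matrix_inv G)"
    using 2 by (metis matrix_mul_assoc matrix_mul_lid)
  also have "\<dots> = M ** transpose M"
    using matrix_inv_left_right(1)[of G] detG by (simp add: invertible_det_nz matrix_mul_rid)
  finally show "matrix_inv G $ k $ l = (\<Sigma> i. E i $ k * E i $ l)"
    by (simp add: matrix_matrix_mult_def transpose_def M_def)
  have "v = M *v ((transpose M ** G) *v v)"
    by (simp add: matrix_vector_mul_assoc 2)
  moreover have "((transpose M ** G) *v v) $ i = g (E i) v" for i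
  proof -
    have "((transpose M ** G) *v v) $ i = (\<Sigma> l. \<Sigma> k. E i $ k * v $ l * G $ k $ l)"
      by (simp add: matrix_matrix_mult_def matrix_vector_mult_def transpose_def M_def sum_distrib_left mult_ac)
    also have "\<dots> = g (E i) v" unfolding expand by (rule sum.swap)
    finally show ?thesis .
  qed
  moreover have "M *v c = (\<Sigma> i. c $ i *\<^sub>R E i)" for c
    by (simp add: vec_eq_iff matrix_vector_mult_def M_def mult.commute)
  ultimately show "v = (\<Sigma> i. g (E i) v *\<^sub>R E i)"
    by (metis (no_types, lifting) sum.cong)
qed

text \<open>Links the coordinate traces of the definitions to traces over orthonormal frames, for
  which independence of coordinates is evident. The first assumption expresses that \<open>h\<close>
  is bilinear.\<close>

lemma frame_trace:
  fixes h :: "real^'m \<Rightarrow> real^'m \<Rightarrow> 'b::real_normed_vector" and E :: "'m \<Rightarrow> real^'m"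
  assumes h: "\<And>v w. h v w = (\<Sigma> k. \<Sigma> l. (v $ k * w $ l) *\<^sub>R h (axis k 1) (axis l 1))"
    and G: "\<And>k l. G k l = (\<Sigma> i. E i $ k * E i $ l)"
  shows "(\<Sigma> k. \<Sigma> l. G k l *\<^sub>R h (axis k 1) (axis l 1)) = (\<Sigma> i. h (E i) (E i))"
proof -
  have "(\<Sigma> k. \<Sigma> l. G k l *\<^sub>R h (axis k 1) (axis l 1))
      = (\<Sigma> k. \<Sigma> l. \<Sigma> i. (E i $ k * E i $ l) *\<^sub>R h (axis k 1) (axis l 1))"
    by (simp add: G scaleR_sum_left)
  also have "\<dots> = (\<Sigma> k. \<Sigma> i. \<Sigma> l. (E i $ k * E i $ l) *\<^sub>R h (axis k 1) (axis l 1))"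
    by (rule sum.cong[OF refl], rule sum.swap)
  also have "\<dots> = (\<Sigma> i. \<Sigma> k. \<Sigma> l. (E i $ k * E i $ l) *\<^sub>R h (axis k 1) (axis l 1))"
    by (rule sum.swap)
  also have "\<dots> = (\<Sigma> i. h (E i) (E i))" by (simp flip: h)
  finally show ?thesis .
qed

text \<open>The last term, a first derivative along the second derivative of \<open>P\<close>, is
  the obstruction to invariance of \<open>metric_laplacian\<close>; the drift will compensate
  it.\<close>

lemma D2_compose:
  fixes \<phi> :: "real^'k \<Rightarrow> 'b::real_normed_vector" and P :: "real^'m \<Rightarrow> real^'k"
  assumes "open T" "smooth_on P T" "P ` T \<subseteq> S" "open S" "smooth_on \<phi> S" "x \<in> T"
  shows "D v (D w (\<lambda>x. \<phi> (P x))) x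
    = D (D v P x) (D (D w P x) \<phi>) (P x) + D (D v (D w P) x) \<phi> (P x)"
proof -
  have PS: "P y \<in> S" if "y \<in> T" for y using that assms(3) by auto
  note dP = smooth_diff[OF assms(2)] and dP' = smooth_diff[OF smooth_on_D[OF assms(2)]]
    and d\<phi> = smooth_diff[OF assms(5)] and d\<phi>' = smooth_diff[OF smooth_on_D[OF assms(5)]]
  have comp: "(\<lambda>x. D w' \<phi> (P x)) differentiable (at x)" for w'
    using smooth_diff[OF smooth_on_compose[OF assms(1,3,2) smooth_on_D[OF assms(5)]] assms(6)] .
  have cart: "(\<lambda>x. D w P x $ k) differentiable (at x)" for k
    using smooth_diff[OF smooth_on_cart[OF assms(1) smooth_on_D[OF assms(2)]] assms(6)] .
  have "D v (D w (\<lambda>x. \<phi> (P x))) x = D v (\<lambda>x. \<Sigma> k. D w P x $ k *\<^sub>R pd k \<phi> (P x)) x"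
  proof (rule D_cong[OF assms(1,6)])
    fix y assume y: "y \<in> T"
    show "D w (\<lambda>x. \<phi> (P x)) y = (\<Sigma> k. D w P y $ k *\<^sub>R pd k \<phi> (P y))"
      using D_compose[OF dP[OF y] d\<phi>[OF PS[OF y]]] D_expand_cart[OF d\<phi>[OF PS[OF y]]] by metis
  qed
  also have "\<dots> = (\<Sigma> k. D w P x $ k *\<^sub>R D (D v P x) (pd k \<phi>) (P x) + D v (D w P) x $ k *\<^sub>R pd k \<phi> (P x))"
    using assms(6) PS
    by (simp add: D_sum D_scaleR comp cart D_cart[OF dP'] D_compose[OF dP d\<phi>'])
  also have "\<dots> = D (D v P x) (D (D w P x) \<phi>) (P x) + D (D v (D w P) x) \<phi> (P x)"
  proof -
    have "D (D v P x) (D (D w P x) \<phi>) (P x) = D (D v P x) (\<lambda>y. \<Sigma> k. D w P x $ k *\<^sub>R pd k \<phi> y) (P x)"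
      using D_expand_cart[OF d\<phi>] by (intro D_cong[OF assms(4) PS[OF assms(6)]])
    also have "\<dots> = (\<Sigma> k. D w P x $ k *\<^sub>R D (D v P x) (pd k \<phi>) (P x))"
      using d\<phi>' PS[OF assms(6)] by (simp add: D_sum D_scaleR D_const)
    finally show ?thesis
      using D_expand_cart[OF d\<phi>[OF PS[OF assms(6)]], of "D v (D w P) x"] by (simp add: sum.distrib)
  qed
  finally show ?thesis .
qed

section \<open>Self-shrinkers with parallel principal normal in local coordinates\<close>

definition inv_metric :: "(real^'n \<Rightarrow> real^'n \<Rightarrow> real) \<Rightarrow> (real^'m \<Rightarrow> real^'n) \<Rightarrow> real^'m \<Rightarrow> 'm \<Rightarrow> 'm \<Rightarrow> real" where
  "inv_metric B f x k l = matrix_inv (induced_metric B f x) $ k $ l"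

text \<open>For arbitrary \<open>X\<close> these are the contravariant components of its tangential
  part, see \<open>tangential_part_coord\<close>. In this form they are visibly smooth.\<close>

definition tangent_coord ::
  "(real^'n \<Rightarrow> real^'n \<Rightarrow> real) \<Rightarrow> (real^'m \<Rightarrow> real^'n) \<Rightarrow> (real^'m \<Rightarrow> real^'n) \<Rightarrow> 'm \<Rightarrow> real^'m \<Rightarrow> real" where
  "tangent_coord B f X k x = (\<Sigma> l. inv_metric B f x k l * B (X x) (pd l f x))"

text \<open>Only the principal part of the Laplace-Beltrami operator, with ordinary partial
  derivatives; by itself it depends on the coordinates.\<close>

definition metric_laplacian ::
  "(real^'n \<Rightarrow> real^'n \<Rightarrow> real) \<Rightarrow> (real^'m \<Rightarrow> real^'n) \<Rightarrow> (real^'m \<Rightarrow> 'b::real_normed_vector) \<Rightarrow> real^'m \<Rightarrow> 'b" where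
  "metric_laplacian B f \<phi> x = (\<Sigma> k. \<Sigma> l. inv_metric B f x k l *\<^sub>R pd k (pd l \<phi>) x)"

text \<open>The drift is chosen so that the operator \<open>L\<close> satisfies \<open>L F = - F\<close>. This makes the first-order part
  of the Laplacian and the drift along \<open>F\<^sup>T\<close> one vector field, and no Christoffel symbols are needed.\<close>

definition shrinker_drift :: "(real^'n \<Rightarrow> real^'n \<Rightarrow> real) \<Rightarrow> (real^'m \<Rightarrow> real^'n) \<Rightarrow> 'm \<Rightarrow> real^'m \<Rightarrow> real" where
  "shrinker_drift B f k = tangent_coord B f (\<lambda>x. metric_laplacian B f f x + f x) k"

text \<open>This is \<open>|a|^2\<close>, written as the energy of the map \<open>N\<close>: for
  parallel \<open>N\<close> the derivative of \<open>N\<close> is tangent and given by the shape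
  operator, see \<open>D_N0\<close> and \<open>shape_sq0\<close>.\<close>

definition shape_sq ::
  "(real^'n \<Rightarrow> real^'n \<Rightarrow> real) \<Rightarrow> (real^'m \<Rightarrow> real^'n) \<Rightarrow> (real^'m \<Rightarrow> real^'n) \<Rightarrow> real^'m \<Rightarrow> real" where
  "shape_sq B f N x = (\<Sigma> k. \<Sigma> l. inv_metric B f x k l *\<^sub>R B (pd k N x) (pd l N x))"

lemma D_lincomb:
  assumes "f differentiable (at x)"
  shows "D (\<Sum>i\<in>I. c i *\<^sub>R v i) f x = (\<Sum>i\<in>I. c i *\<^sub>R D (v i) f x)"
  using linear_sum[OF linear_D[OF assms], of "\<lambda>i. c i *\<^sub>R v i" I]
  by (simp add: linear_cmul[OF linear_D[OF assms]])

locale spacelike_patch =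
  fixes B :: "real^'n \<Rightarrow> real^'n \<Rightarrow> real" and f :: "real^'m \<Rightarrow> real^'n" and S :: "(real^'m) set"
  assumes bilin: "bilinear B" and B_sym: "B X Y = B Y X"
    and open_S: "open S" and smooth_f: "smooth_on f S"
    and spacelike: "x \<in> S \<Longrightarrow> v \<noteq> 0 \<Longrightarrow> 0 < B (D v f x) (D v f x)"
begin

sublocale B: bounded_bilinear B
  using bilin by (simp add: bilinear_conv_bounded_bilinear)

lemmas f_diff = smooth_diff[OF smooth_f]
  and f_diff1 = smooth_diff[OF smooth_on_D[OF smooth_f]]

lemma smooth_B: "smooth_on X S \<Longrightarrow> smooth_on Y S \<Longrightarrow> smooth_on (\<lambda>x. B (X x) (Y x)) S"
  by (rule smooth_on_bilinear[OF open_S B.bounded_bilinear_axioms])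

lemma pullback_bilinear:
  assumes "x \<in> S"
  shows "bilinear (\<lambda>v w. B (D v f x) (D w f x))"
  using linear_D[OF f_diff[OF assms]]
  by (auto simp: bilinear_def linear_iff B.add_left B.add_right B.scaleR_left B.scaleR_right)

lemma frame_exists:
  assumes "x \<in> S"
  obtains E :: "'m \<Rightarrow> real^'m" where "\<And>i j. B (D (E i) f x) (D (E j) f x) = (if i = j then 1 else 0)"
  using orthonormal_frame_exists[OF pullback_bilinear[OF assms]] B_sym spacelike[OF assms] by metis

lemma induced_metric_D: "induced_metric B f x = (\<chi> k l. B (pd k f x) (pd l f x))"
  by (simp add: induced_metric_def D_def)

lemma inv_metric_frame:
  fixes E :: "'m \<Rightarrow> real^'m"
  assumes "x \<in> S" "\<And>i j. B (D (E i) f x) (D (E j) f x) = (if i = j then 1 else 0)"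
  shows "inv_metric B f x k l = (\<Sigma> i. E i $ k * E i $ l)"
  unfolding inv_metric_def induced_metric_D
  by (rule frame_matrix(2)[OF pullback_bilinear[OF assms(1)] assms(2)])

lemma inv_metric_sym:
  assumes "x \<in> S"
  shows "inv_metric B f x k l = inv_metric B f x l k"
proof -
  obtain E :: "'m \<Rightarrow> real^'m" where "\<And>i j. B (D (E i) f x) (D (E j) f x) = (if i = j then 1 else 0)"
    using frame_exists[OF assms] by blast
  from inv_metric_frame[OF assms this] show ?thesis by (simp add: mult.commute)
qed

lemma det_induced_metric:
  assumes "x \<in> S"
  shows "det (induced_metric B f x) \<noteq> 0"
proof -
  obtain E :: "'m \<Rightarrow> real^'m" where "\<And>i j. B (D (E i) f x) (D (E j) f x) = (if i = j then 1 else 0)"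
    using frame_exists[OF assms] by blast
  from frame_matrix(1)[OF pullback_bilinear[OF assms] this] show ?thesis by (simp add: induced_metric_D)
qed

lemma smooth_inv_metric: "smooth_on (\<lambda>x. inv_metric B f x k l) S"
  unfolding inv_metric_def
proof (rule smooth_on_matrix_inv[OF open_S _ det_induced_metric])
  show "smooth_on (\<lambda>x. induced_metric B f x $ i $ j) S" for i j
    by (simp add: induced_metric_D smooth_B smooth_on_D smooth_f)
qed

lemma smooth_tangent_coord: "smooth_on X S \<Longrightarrow> smooth_on (tangent_coord B f X k) S"
  unfolding tangent_coord_def[abs_def]
  by (intro smooth_on_sum smooth_on_mult smooth_inv_metric smooth_B smooth_on_D smooth_f open_S) auto

lemma smooth_metric_laplacian: "smooth_on \<phi> S \<Longrightarrow> smooth_on (metric_laplacian B f \<phi>) S"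
  unfolding metric_laplacian_def[abs_def]
  by (intro smooth_on_sum smooth_on_scaleR smooth_inv_metric smooth_on_D open_S) auto

lemma smooth_shrinker_drift: "smooth_on (shrinker_drift B f k) S"
  unfolding shrinker_drift_def
  by (intro smooth_tangent_coord smooth_on_add smooth_metric_laplacian smooth_f open_S)

lemma tangent_coord_eq:
  assumes "x \<in> S" "X x = D v f x"
  shows "tangent_coord B f X k x = v $ k"
proof -
  obtain E :: "'m \<Rightarrow> real^'m" where E: "\<And>i j. B (D (E i) f x) (D (E j) f x) = (if i = j then 1 else 0)"
    using frame_exists[OF assms(1)] by blast
  have "tangent_coord B f X k x = (\<Sigma> l. \<Sigma> i. E i $ k * (E i $ l * B (D v f x) (pd l f x)))"
    by (simp add: tangent_coord_def inv_metric_frame[OF assms(1) E] assms(2) sum_distrib_left sum_distrib_right mult_ac)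
  also have "\<dots> = (\<Sigma> i. \<Sigma> l. E i $ k * (E i $ l * B (D v f x) (pd l f x)))"
    by (rule sum.swap)
  also have "\<dots> = (\<Sigma> i. E i $ k * B (D v f x) (\<Sigma> l. E i $ l *\<^sub>R pd l f x))"
    by (simp add: B.sum_right B.scaleR_right sum_distrib_left)
  also have "\<dots> = (\<Sigma> i. B (D (E i) f x) (D v f x) * E i $ k)"
    by (simp add: D_expand_cart[OF f_diff[OF assms(1)], symmetric] B_sym[of "D v f x"] mult.commute)
  also have "\<dots> = (\<Sigma> i. B (D (E i) f x) (D v f x) *\<^sub>R E i) $ k" by simp
  also have "(\<Sigma> i. B (D (E i) f x) (D v f x) *\<^sub>R E i) = v"
    by (rule frame_matrix(3)[OF pullback_bilinear[OF assms(1)] E, symmetric])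
  finally show ?thesis .
qed

text \<open>Converts membership in the moving tangent space into an equation with smooth
  coefficients, which can then be differentiated.\<close>

lemma tangent_expand:
  assumes "x \<in> S" "X x \<in> range (\<lambda>v. D v f x)"
  shows "X x = (\<Sigma> k. tangent_coord B f X k x *\<^sub>R pd k f x)"
proof -
  obtain v where v: "X x = D v f x" using assms(2) by blast
  show ?thesis
    using D_expand_cart[OF f_diff[OF assms(1)], of v] by (simp add: tangent_coord_eq[OF assms(1), of X v] v)
qed

lemma tangent_normal_zero:
  assumes "x \<in> S" "X \<in> range (\<lambda>v. D v f x)" "\<And>k. B X (pd k f x) = 0"
  shows "X = 0"
  using tangent_expand[of x "\<lambda>_. X"] assms by (simp add: tangent_coord_def)

lemma laplacian_frame:
  fixes E :: "'m \<Rightarrow> real^'m" and \<phi> :: "real^'m \<Rightarrow> 'b::real_normed_vector"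
  assumes "x \<in> S" "\<And>i j. B (D (E i) f x) (D (E j) f x) = (if i = j then 1 else 0)" "smooth_on \<phi> S"
  shows "metric_laplacian B f \<phi> x = (\<Sigma> i. D (E i) (D (E i) \<phi>) x)"
  unfolding metric_laplacian_def
  by (rule frame_trace[OF D2_expand_cart[OF open_S assms(3,1)] inv_metric_frame[OF assms(1,2)]])

lemma inv_metric_trace:
  fixes E :: "'m \<Rightarrow> real^'m"
  assumes "x \<in> S" "\<And>i j. B (D (E i) f x) (D (E j) f x) = (if i = j then 1 else 0)"
    and "\<phi> differentiable (at x)" "\<psi> differentiable (at x)" and h: "bounded_bilinear h"
  shows "(\<Sigma> k. \<Sigma> l. inv_metric B f x k l *\<^sub>R h (pd k \<phi> x) (pd l \<psi> x))
    = (\<Sigma> i. h (D (E i) \<phi> x) (D (E i) \<psi> x))"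
proof (rule frame_trace[OF _ inv_metric_frame[OF assms(1,2)]])
  interpret h: bounded_bilinear h by fact
  fix v w
  have "h (D v \<phi> x) (D w \<psi> x) = h (\<Sigma> k. v $ k *\<^sub>R pd k \<phi> x) (\<Sigma> k. w $ k *\<^sub>R pd k \<psi> x)"
    using D_expand_cart[OF assms(3), of v] D_expand_cart[OF assms(4), of w] by simp
  also have "\<dots> = (\<Sigma> l. \<Sigma> k. (v $ k * w $ l) *\<^sub>R h (pd k \<phi> x) (pd l \<psi> x))"
    by (simp add: h.sum_left h.sum_right h.scaleR_left h.scaleR_right scaleR_sum_right mult.commute)
  also have "\<dots> = (\<Sigma> k. \<Sigma> l. (v $ k * w $ l) *\<^sub>R h (pd k \<phi> x) (pd l \<psi> x))"
    by (rule sum.swap)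
  finally show "h (D v \<phi> x) (D w \<psi> x) = \<dots>" .
qed

lemma D_f_inj:
  assumes "x \<in> S" "D v f x = D w f x"
  shows "v = w"
proof (rule ccontr)
  assume "v \<noteq> w"
  then have "0 < B (D (v - w) f x) (D (v - w) f x)" using spacelike[OF assms(1)] by simp
  then show False using assms(2) linear_diff[OF linear_D[OF f_diff[OF assms(1)]]] by (simp add: B.zero_left)
qed

lemma metric_inverse:
  assumes "x \<in> S"
  shows "(\<Sigma> l. inv_metric B f x k l * B (pd l f x) (pd j f x)) = (if k = j then 1 else 0)"
proof -
  have "matrix_inv (induced_metric B f x) ** induced_metric B f x = mat 1"
    using matrix_inv_left_right(2) det_induced_metric[OF assms] by (simp add: invertible_det_nz)
  from arg_cong[OF this, of "\<lambda>A. A $ k $ j"] show ?thesis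
    by (simp add: matrix_matrix_mult_def inv_metric_def mat_def induced_metric_D)
qed

end

text \<open>\<open>N\<close> is the principal normal \<open>\<nu>\<close>, \<open>u\<close> the length of the mean curvature vector and \<open>e\<close> its
  causal sign. All conditions are stated without reference to coordinates, which makes their
  invariance under reparametrization evident.\<close>

locale shrinker_patch = spacelike_patch B f S
  for B :: "real^'n \<Rightarrow> real^'n \<Rightarrow> real" and f N :: "real^'m \<Rightarrow> real^'n" and u :: "real^'m \<Rightarrow> real"
    and e :: real and S :: "(real^'m) set" +
  assumes smooth_N: "smooth_on N S" and smooth_u: "smooth_on u S"
    and N_normal: "x \<in> S \<Longrightarrow> B (N x) (D v f x) = 0"
    and N_unit: "x \<in> S \<Longrightarrow> B (N x) (N x) = e"
    and e: "e * e = 1"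
    and u_nz: "x \<in> S \<Longrightarrow> u x \<noteq> 0"
    and position: "x \<in> S \<Longrightarrow> f x + u x *\<^sub>R N x \<in> range (\<lambda>v. D v f x)"
    and N_parallel: "x \<in> S \<Longrightarrow> D v N x \<in> range (\<lambda>v. D v f x)"
    and shrinker: "x \<in> S \<Longrightarrow> (\<And>i j. B (D (E i) f x) (D (E j) f x) = (if i = j then 1 else 0)) \<Longrightarrow>
      (\<Sum>i\<in>(UNIV::'m set). D (E i) (D (E i) f) x) + f x \<in> range (\<lambda>v. D v f x)"
begin

lemmas N_diff = smooth_diff[OF smooth_N]
  and u_diff = smooth_diff[OF smooth_u]

lemma smooth_shape_sq: "smooth_on (shape_sq B f N) S"
  unfolding shape_sq_def[abs_def]
  by (intro smooth_on_sum smooth_on_scaleR smooth_inv_metric smooth_B smooth_on_D open_S smooth_N) auto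

lemma shape_sq_frame:
  fixes E :: "'m \<Rightarrow> real^'m"
  assumes "x \<in> S" "\<And>i j. B (D (E i) f x) (D (E j) f x) = (if i = j then 1 else 0)"
  shows "shape_sq B f N x = (\<Sigma> i. B (D (E i) N x) (D (E i) N x))"
  unfolding shape_sq_def
  by (rule inv_metric_trace[OF assms N_diff[OF assms(1)] N_diff[OF assms(1)] B.bounded_bilinear_axioms])

lemma shrinker_equation:
  assumes "x \<in> S"
  shows "metric_laplacian B f f x + f x = (\<Sigma> k. shrinker_drift B f k x *\<^sub>R pd k f x)"
proof -
  obtain E :: "'m \<Rightarrow> real^'m" where E: "\<And>i j. B (D (E i) f x) (D (E j) f x) = (if i = j then 1 else 0)"
    using frame_exists[OF assms] by blast
  show ?thesis
    unfolding shrinker_drift_def using shrinker[OF assms E] laplacian_frame[OF assms E smooth_f]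
    by (intro tangent_expand[OF assms]) simp
qed

text \<open>Only the condition on second derivatives is delicate: the second derivatives of
  \<open>P\<close> contribute vectors in the image of the differential of \<open>f\<close>, which
  the condition ignores.\<close>

lemma reparametrize:
  fixes P :: "real^'m \<Rightarrow> real^'m"
  assumes T: "open T" and P: "smooth_on P T" "P ` T \<subseteq> S"
    and inj: "\<And>x. x \<in> T \<Longrightarrow> inj (\<lambda>v. D v P x)"
  shows "shrinker_patch B (\<lambda>x. f (P x)) (\<lambda>x. N (P x)) (\<lambda>x. u (P x)) e T"
proof -
  have PS: "P x \<in> S" if "x \<in> T" for x using that P(2) by auto
  note dP = smooth_diff[OF P(1)]
  have D1: "D v (\<lambda>x. f (P x)) x = D (D v P x) f (P x)" "D v (\<lambda>x. N (P x)) x = D (D v P x) N (P x)" if "x \<in> T" for x v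
    by (rule D_compose[OF dP[OF that] f_diff[OF PS[OF that]]], rule D_compose[OF dP[OF that] N_diff[OF PS[OF that]]])
  have surj: "surj (\<lambda>v. D v P x)" if "x \<in> T" for x
    using linear_injective_imp_surjective[OF linear_D[OF dP[OF that]] inj[OF that]] by simp
  have range: "range (\<lambda>v. D v (\<lambda>x. f (P x)) x) = range (\<lambda>v. D v f (P x))" if "x \<in> T" for x
  proof -
    have "range (\<lambda>v. D v (\<lambda>x. f (P x)) x) = (\<lambda>v. D v f (P x)) ` range (\<lambda>v. D v P x)"
      by (auto simp: D1[OF that])
    then show ?thesis by (simp add: surj[OF that])
  qed
  have nz: "D v P x \<noteq> 0" if "x \<in> T" "v \<noteq> 0" for x v
    using inj[OF that(1)] that(2) linear_0[OF linear_D[OF dP[OF that(1)]]] by (metis injD)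
  show ?thesis
  proof
    fix x and E :: "'m \<Rightarrow> real^'m"
    assume x: "x \<in> T"
      and E: "\<And>i j. B (D (E i) (\<lambda>x. f (P x)) x) (D (E j) (\<lambda>x. f (P x)) x) = (if i = j then 1 else 0)"
    let ?R = "range (\<lambda>v. D v f (P x))"
    have "subspace ?R"
      using linear_subspace_image[OF linear_D[OF f_diff[OF PS[OF x]]] subspace_UNIV] .
    moreover have "(\<Sigma> i. D (D (E i) P x) (D (D (E i) P x) f) (P x)) + f (P x) \<in> ?R"
      using E by (intro shrinker[OF PS[OF x]]) (simp add: D1[OF x])
    moreover have "(\<Sigma> i. D (D (E i) (D (E i) P) x) f (P x)) \<in> ?R"
      using \<open>subspace ?R\<close> by (intro subspace_sum) auto
    ultimately have "((\<Sigma> i. D (D (E i) P x) (D (D (E i) P x) f) (P x)) + f (P x))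
        + (\<Sigma> i. D (D (E i) (D (E i) P) x) f (P x)) \<in> ?R"
      by (rule subspace_add)
    then show "(\<Sigma> i. D (E i) (D (E i) (\<lambda>x. f (P x))) x) + f (P x) \<in> range (\<lambda>v. D v (\<lambda>x. f (P x)) x)"
      by (simp add: range[OF x] D2_compose[OF T P open_S smooth_f x] sum.distrib add_ac)
  next
    fix x v assume x: "x \<in> T"
    show "f (P x) + u (P x) *\<^sub>R N (P x) \<in> range (\<lambda>v. D v (\<lambda>x. f (P x)) x)"
      unfolding range[OF x] by (rule position[OF PS[OF x]])
    show "D v (\<lambda>x. N (P x)) x \<in> range (\<lambda>v. D v (\<lambda>x. f (P x)) x)"
      using N_parallel[OF PS[OF x], of "D v P x"] by (simp only: range[OF x] D1(2)[OF x])
  qed (use bilin B_sym T e in \<open>simp_all add: smooth_on_compose[OF T P(2,1)] smooth_f smooth_N smooth_u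
      PS D1 spacelike nz N_normal N_unit u_nz\<close>)
qed

lemma shape_sq_reparametrize:
  fixes P :: "real^'m \<Rightarrow> real^'m"
  assumes T: "open T" and P: "smooth_on P T" "P ` T \<subseteq> S"
    and inj: "\<And>x. x \<in> T \<Longrightarrow> inj (\<lambda>v. D v P x)" and x: "x \<in> T"
  shows "shape_sq B (\<lambda>x. f (P x)) (\<lambda>x. N (P x)) x = shape_sq B f N (P x)"
proof -
  interpret P: shrinker_patch B "\<lambda>x. f (P x)" "\<lambda>x. N (P x)" "\<lambda>x. u (P x)" e T
    by (rule reparametrize[OF T P inj])
  have PS: "P x \<in> S" using x P(2) by auto
  note dP = smooth_diff[OF P(1)]
  have D1: "D v (\<lambda>x. f (P x)) x = D (D v P x) f (P x)" "D v (\<lambda>x. N (P x)) x = D (D v P x) N (P x)" for v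
    by (rule D_compose[OF dP[OF x] f_diff[OF PS]], rule D_compose[OF dP[OF x] N_diff[OF PS]])
  obtain E :: "'m \<Rightarrow> real^'m"
    where E: "\<And>i j. B (D (E i) (\<lambda>x. f (P x)) x) (D (E j) (\<lambda>x. f (P x)) x) = (if i = j then 1 else 0)"
    using P.frame_exists[OF x] by blast
  show ?thesis
    using P.shape_sq_frame[OF x E] shape_sq_frame[OF PS, of "\<lambda>i. D (E i) P x"] E by (simp add: D1)
qed

text \<open>\<open>P\<close> is a quadratic polynomial: the linear part makes the metric the identity at \<open>0\<close>, the quadratic
  part cancels the tangential part of the second derivatives, that is, the Christoffel symbols.\<close>

lemma normal_coordinates:
  assumes x: "x \<in> S"
  obtains P :: "real^'m \<Rightarrow> real^'m" and T where "open T" "0 \<in> T" "smooth_on P T" "P ` T \<subseteq> S" "P 0 = x"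
    "\<And>y. y \<in> T \<Longrightarrow> inj (\<lambda>v. D v P y)"
    "\<And>i j. B (pd i (\<lambda>y. f (P y)) 0) (pd j (\<lambda>y. f (P y)) 0) = (if i = j then 1 else 0)"
    "\<And>i j k. B (pd i (pd j (\<lambda>y. f (P y))) 0) (pd k (\<lambda>y. f (P y)) 0) = 0"
proof -
  obtain E :: "'m \<Rightarrow> real^'m" where E: "\<And>i j. B (D (E i) f x) (D (E j) f x) = (if i = j then 1 else 0)"
    using frame_exists[OF x] by blast
  define Q where "Q i j = - (\<Sigma> l. B (D (E i) (D (E j) f) x) (D (E l) f x) *\<^sub>R E l)" for i j
  have Q_sym: "Q i j = Q j i" for i j
    unfolding Q_def using D_symmetric[OF open_S smooth_f x] by metis
  \<comment> \<open>The polynomial sums over all ordered pairs, so each mixed second derivative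
    collects \<open>H k l + H l k\<close>; halving makes this equal to \<open>Q k l\<close>.\<close>
  define H where "H i j = Q i j /\<^sub>R 2" for i j
  define P where "P y = x + ((\<Sigma> i. y $ i *\<^sub>R E i) + (\<Sigma> i. \<Sigma> j. (y $ i * y $ j) *\<^sub>R H i j))" for y
  have sm_cart: "smooth_on (\<lambda>y::real^'m. y $ i) UNIV" for i
    by (rule smooth_on_cart[OF open_UNIV smooth_on_id[OF open_UNIV]])
  have P: "smooth_on P UNIV"
    unfolding P_def[abs_def]
    by (intro smooth_on_add smooth_on_const smooth_on_sum smooth_on_scaleR smooth_on_mult sm_cart open_UNIV finite)
  note dP = smooth_diff[OF P UNIV_I]
  have dc: "(\<lambda>y::real^'m. y $ i) differentiable (at y)" for i y
    by (rule smooth_diff[OF sm_cart UNIV_I])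
  have Dc: "D v (\<lambda>y::real^'m. y $ i) y = v $ i" for v y i
    using D_cart[of "\<lambda>y. y" y v i] by (simp add: D_ident)
  have DP: "D v P y = (\<Sigma> i. v $ i *\<^sub>R E i)
      + (\<Sigma> i. \<Sigma> j. (y $ i * v $ j + v $ i * y $ j) *\<^sub>R H i j)" for v y
    unfolding P_def[abs_def] by (simp add: D_add D_const D_sum D_scaleR D_mult dc Dc)
  have D2P: "D w (D v P) y = (\<Sigma> i. \<Sigma> j. (w $ i * v $ j + v $ i * w $ j) *\<^sub>R H i j)" for v w y
    unfolding DP[abs_def] by (simp add: D_add D_const D_sum D_scaleR D_mult dc Dc)
  have P0: "P 0 = x" by (simp add: P_def)
  have DP0: "D v P 0 = (\<Sigma> i. v $ i *\<^sub>R E i)" for v by (simp add: DP)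
  have pdP0: "pd k P 0 = E k" for k
    by (simp add: DP0 axis_def if_distrib[of "\<lambda>c. c *\<^sub>R _"] cong: if_cong)
  have pd2P0: "pd k (pd l P) 0 = Q k l" for k l
  proof -
    have "pd k (pd l P) 0 = (\<Sigma> i. \<Sigma> j. (axis k 1 $ i * axis l 1 $ j) *\<^sub>R H i j)
        + (\<Sigma> i. \<Sigma> j. (axis l 1 $ i * axis k 1 $ j) *\<^sub>R H i j)"
      by (simp only: D2P scaleR_add_left sum.distrib)
    also have "\<dots> = H k l + H l k"
    proof -
      have "(\<Sigma> i. \<Sigma> j. (axis a 1 $ i * axis b 1 $ j) *\<^sub>R H i j) = H a b" for a b
      proof -
        have "(axis a 1 $ i * axis b 1 $ j) *\<^sub>R H i j
            = (if i = a then if j = b then H i j else 0 else 0)" for i j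
          by (simp add: axis_def)
        moreover have "(\<Sigma> j. if i = a then if j = b then H i j else 0 else 0)
            = (if i = a then H i b else 0)" for i by simp
        ultimately show ?thesis by simp
      qed
      then show ?thesis by simp
    qed
    also have "\<dots> = Q k l" by (simp add: H_def Q_sym[of l k] flip: scaleR_add_left)
    finally show ?thesis .
  qed
  define T where "T = {y. P y \<in> S \<and> det (matrix (\<lambda>v. D v P y)) \<noteq> 0}"
  have inj_iff: "det (matrix (\<lambda>v. D v P y)) \<noteq> 0 \<longleftrightarrow> inj (\<lambda>v. D v P y)" for y
    by (rule det_nz_iff_inj[OF linear_D[OF dP]])
  have "smooth_on (\<lambda>y. det (matrix (\<lambda>v. D v P y))) UNIV"
    by (intro smooth_on_det open_UNIV) (simp add: matrix_def smooth_on_cart smooth_on_D P)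
  then have "open ((\<lambda>y. det (matrix (\<lambda>v. D v P y))) -` (- {0}))"
    by (intro open_vimage smooth_on_continuous) auto
  moreover have "open (P -` S)"
    using open_S P by (intro open_vimage smooth_on_continuous)
  ultimately have "open T"
    using open_Int by (auto simp: T_def vimage_def Collect_conj_eq)
  have TS: "P ` T \<subseteq> S" by (auto simp: T_def)
  have injT: "inj (\<lambda>v. D v P y)" if "y \<in> T" for y using that inj_iff by (simp add: T_def)
  have "inj (\<lambda>v. D v P 0)"
    unfolding linear_inj_iff_eq_0[OF linear_D[OF dP]]
  proof (intro allI impI)
    fix v assume "D v P 0 = 0"
    then have z: "(\<Sigma> i. v $ i *\<^sub>R E i) = 0" by (simp add: DP0)
    have "v $ j = 0" for j
    proof -
      have "0 = B (D (\<Sigma> i. v $ i *\<^sub>R E i) f x) (D (E j) f x)"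
        unfolding z using linear_0[OF linear_D[OF f_diff[OF x]]] by (simp add: B.zero_left)
      also have "\<dots> = v $ j"
        by (simp add: D_lincomb[OF f_diff[OF x]] B.sum_left B.scaleR_left E if_distrib cong: if_cong)
      finally show ?thesis by simp
    qed
    then show "v = 0" by (simp add: vec_eq_iff)
  qed
  then have "0 \<in> T" using inj_iff x by (simp add: T_def P0)
  have PT: "smooth_on P T" by (rule smooth_on_subset[OF P]) simp
  have fP: "D v (\<lambda>y. f (P y)) 0 = D (D v P 0) f x" for v
    using D_compose[OF dP f_diff] x by (simp add: P0)
  have n1: "B (pd i (\<lambda>y. f (P y)) 0) (pd j (\<lambda>y. f (P y)) 0) = (if i = j then 1 else 0)" for i j
    by (simp add: fP pdP0 E)
  have n2: "B (pd i (pd j (\<lambda>y. f (P y))) 0) (pd k (\<lambda>y. f (P y)) 0) = 0" for i j k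
  proof -
    have "pd i (pd j (\<lambda>y. f (P y))) 0 = D (E i) (D (E j) f) x + D (Q i j) f x"
      using D2_compose[OF \<open>open T\<close> PT TS open_S smooth_f \<open>0 \<in> T\<close>, of "axis i 1" "axis j 1"]
      by (simp add: P0 pdP0 pd2P0)
    also have "D (Q i j) f x = - (\<Sigma> l. B (D (E i) (D (E j) f) x) (D (E l) f x) *\<^sub>R D (E l) f x)"
      unfolding Q_def by (simp add: linear_neg[OF linear_D[OF f_diff[OF x]]] D_lincomb[OF f_diff[OF x]])
    finally show ?thesis
      by (simp add: fP pdP0 B.add_left B.diff_left B.sum_left B.scaleR_left E if_distrib cong: if_cong)
  qed
  show ?thesis
    by (rule that[OF \<open>open T\<close> \<open>0 \<in> T\<close> PT TS P0 injT n1 n2])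
qed

end

text \<open>The operator \<open>L\<close> of the overview: Laplacian minus derivative along the
  tangential part of the position, with both first-order parts contained in the drift.\<close>

definition drift_laplacian ::
  "(real^'n \<Rightarrow> real^'n \<Rightarrow> real) \<Rightarrow> (real^'m \<Rightarrow> real^'n) \<Rightarrow> (real^'m \<Rightarrow> 'b::real_normed_vector) \<Rightarrow> real^'m \<Rightarrow> 'b" where
  "drift_laplacian B f \<phi> x = metric_laplacian B f \<phi> x - (\<Sigma> k. shrinker_drift B f k x *\<^sub>R pd k \<phi> x)"

definition grad_prod ::
  "(real^'n \<Rightarrow> real^'n \<Rightarrow> real) \<Rightarrow> (real^'m \<Rightarrow> real^'n) \<Rightarrow> (real^'m \<Rightarrow> real) \<Rightarrow> (real^'m \<Rightarrow> real) \<Rightarrow> real^'m \<Rightarrow> real" where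
  "grad_prod B f \<phi> \<psi> x = (\<Sigma> k. \<Sigma> l. inv_metric B f x k l *\<^sub>R (pd k \<phi> x * pd l \<psi> x))"

section \<open>Invariance of the drift Laplacian under change of parameters\<close>

context shrinker_patch
begin

lemma drift_vector:
  assumes "x \<in> S" "\<phi> differentiable (at x)"
  shows "(\<Sigma> k. shrinker_drift B f k x *\<^sub>R pd k \<phi> x) = D (\<chi> k. shrinker_drift B f k x) \<phi> x"
  using D_expand_cart[OF assms(2), of "\<chi> k. shrinker_drift B f k x"] by simp

context
  fixes P :: "real^'m \<Rightarrow> real^'m" and T
  assumes T: "open T" and P: "smooth_on P T" "P ` T \<subseteq> S"
    and injP: "\<And>x. x \<in> T \<Longrightarrow> inj (\<lambda>v. D v P x)"
begin

text \<open>Under reparametrization \<open>metric_laplacian\<close> gains the derivative along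
  \<open>q\<close>, the trace of the second derivative of \<open>P\<close>. Applying this to
  \<open>f\<close> itself, where \<open>L f = - f\<close> on both sides, shows that the drift vector
  gains the same \<open>q\<close>, since the differential of \<open>f\<close> is injective. The two
  gains cancel.\<close>

lemma drift_laplacian_reparametrize:
  assumes x: "x \<in> T" and \<phi>: "smooth_on \<phi> S"
  shows "drift_laplacian B (\<lambda>x. f (P x)) (\<lambda>x. \<phi> (P x)) x = drift_laplacian B f \<phi> (P x)"
proof -
  interpret P: shrinker_patch B "\<lambda>x. f (P x)" "\<lambda>x. N (P x)" "\<lambda>x. u (P x)" e T
    by (rule reparametrize[OF T P injP])
  have PS: "P x \<in> S" using x P(2) by auto
  note dP = smooth_diff[OF P(1) x] and d\<phi> = smooth_diff[OF \<phi> PS]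
  have D1: "D v (\<lambda>x. f (P x)) x = D (D v P x) f (P x)" "D v (\<lambda>x. \<phi> (P x)) x = D (D v P x) \<phi> (P x)" for v
    by (rule D_compose[OF dP f_diff[OF PS]], rule D_compose[OF dP d\<phi>])
  have smooth_\<phi>P: "smooth_on (\<lambda>x. \<phi> (P x)) T" by (rule smooth_on_compose[OF T P(2,1) \<phi>])
  obtain E :: "'m \<Rightarrow> real^'m"
    where E: "\<And>i j. B (D (E i) (\<lambda>x. f (P x)) x) (D (E j) (\<lambda>x. f (P x)) x) = (if i = j then 1 else 0)"
    using P.frame_exists[OF x] by blast
  define E' where "E' i = D (E i) P x" for i
  have E': "B (D (E' i) f (P x)) (D (E' j) f (P x)) = (if i = j then 1 else 0)" for i j
    using E by (simp add: E'_def D1)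
  define q where "q = (\<Sigma> i. D (E i) (D (E i) P) x)"
  define \<xi> where "\<xi> = (\<chi> k. shrinker_drift B f k (P x))"
  define \<xi>' where "\<xi>' = (\<chi> k. shrinker_drift B (\<lambda>x. f (P x)) k x)"
  have lap: "metric_laplacian B (\<lambda>x. f (P x)) (\<lambda>x. \<psi> (P x)) x = metric_laplacian B f \<psi> (P x) + D q \<psi> (P x)"
    if \<psi>: "smooth_on \<psi> S" for \<psi> :: "real^'m \<Rightarrow> 'c::real_normed_vector"
    unfolding P.laplacian_frame[OF x E smooth_on_compose[OF T P(2,1) \<psi>]] laplacian_frame[OF PS E' \<psi>]
    using linear_sum[OF linear_D[OF smooth_diff[OF \<psi> PS]], of "\<lambda>i. D (E i) (D (E i) P) x" UNIV]
    by (simp add: D2_compose[OF T P open_S \<psi> x] sum.distrib q_def E'_def)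
  have "D (D \<xi>' P x) f (P x) = metric_laplacian B (\<lambda>x. f (P x)) (\<lambda>x. f (P x)) x + f (P x)"
    using P.shrinker_equation[OF x] P.drift_vector[OF x P.f_diff[OF x]] by (simp add: \<xi>'_def D1)
  also have "\<dots> = D \<xi> f (P x) + D q f (P x)"
    using shrinker_equation[OF PS] drift_vector[OF PS f_diff[OF PS]] by (simp add: lap[OF smooth_f] \<xi>_def algebra_simps)
  also have "\<dots> = D (\<xi> + q) f (P x)" by (rule linear_add[OF linear_D[OF f_diff[OF PS]], symmetric])
  finally have "D \<xi>' P x = \<xi> + q" by (rule D_f_inj[OF PS])
  then have "D \<xi>' (\<lambda>x. \<phi> (P x)) x = D \<xi> \<phi> (P x) + D q \<phi> (P x)"
    using linear_add[OF linear_D[OF d\<phi>]] by (simp add: D1)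
  then show ?thesis
    unfolding drift_laplacian_def P.drift_vector[OF x smooth_diff[OF smooth_\<phi>P x]]
      drift_vector[OF PS d\<phi>] lap[OF \<phi>]
    by (simp add: \<xi>_def \<xi>'_def)
qed

lemma grad_prod_reparametrize:
  assumes x: "x \<in> T" and \<phi>: "smooth_on \<phi> S" and \<psi>: "smooth_on \<psi> S"
  shows "grad_prod B (\<lambda>x. f (P x)) (\<lambda>x. \<phi> (P x)) (\<lambda>x. \<psi> (P x)) x = grad_prod B f \<phi> \<psi> (P x)"
proof -
  interpret P: shrinker_patch B "\<lambda>x. f (P x)" "\<lambda>x. N (P x)" "\<lambda>x. u (P x)" e T
    by (rule reparametrize[OF T P injP])
  have PS: "P x \<in> S" using x P(2) by auto
  note dP = smooth_diff[OF P(1) x]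
  have D1: "D v (\<lambda>x. \<eta> (P x)) x = D (D v P x) \<eta> (P x)" if "smooth_on \<eta> S"
    for v and \<eta> :: "real^'m \<Rightarrow> 'c::real_normed_vector"
    by (rule D_compose[OF dP smooth_diff[OF that PS]])
  have d: "(\<lambda>x. \<eta> (P x)) differentiable (at x)" if "smooth_on \<eta> S" for \<eta> :: "real^'m \<Rightarrow> real"
    by (rule smooth_diff[OF smooth_on_compose[OF T P(2,1) that] x])
  obtain E :: "'m \<Rightarrow> real^'m"
    where E: "\<And>i j. B (D (E i) (\<lambda>x. f (P x)) x) (D (E j) (\<lambda>x. f (P x)) x) = (if i = j then 1 else 0)"
    using P.frame_exists[OF x] by blast
  have E': "B (D (D (E i) P x) f (P x)) (D (D (E j) P x) f (P x)) = (if i = j then 1 else 0)" for i j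
    using E by (simp add: D1[OF smooth_f])
  show ?thesis
    unfolding grad_prod_def P.inv_metric_trace[OF x E d[OF \<phi>] d[OF \<psi>] bounded_bilinear_mult]
      inv_metric_trace[OF PS E' smooth_diff[OF \<phi> PS] smooth_diff[OF \<psi> PS] bounded_bilinear_mult]
    by (simp add: D1[OF \<phi>] D1[OF \<psi>])
qed

end

end

section \<open>Pointwise identities in normal coordinates\<close>

text \<open>Two equal summands collect to \<open>2 * v\<close>, the componentwise product with the
  constant vector 2; this returns to scalar multiplication.\<close>

lemma scaleR_double: "c *\<^sub>R (2 * v) = (2 * c) *\<^sub>R (v :: real^'n)"
  by (simp add: vec_eq_iff)

text \<open>At the origin the Christoffel symbols vanish, so second partial derivatives of
  \<open>f\<close> are values of the second fundamental form and first covariant derivatives are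
  partial derivatives.\<close>

locale normal_patch = shrinker_patch B f N u e S
  for B :: "real^'n \<Rightarrow> real^'n \<Rightarrow> real" and f N :: "real^'m \<Rightarrow> real^'n" and u e S +
  assumes zero_in: "0 \<in> S"
    and orthonormal: "B (pd i f 0) (pd j f 0) = (if i = j then 1 else 0)"
    and f2_normal: "B (pd i (pd j f) 0) (pd k f 0) = 0"
begin

abbreviation "f1 i \<equiv> pd i f 0"
abbreviation "f2 i j \<equiv> pd i (pd j f) 0"
abbreviation "f3 i j k \<equiv> pd i (pd j (pd k f)) 0"
abbreviation "n1 i \<equiv> pd i N 0"
abbreviation "n2 i j \<equiv> pd i (pd j N) 0"
abbreviation "n3 i j k \<equiv> pd i (pd j (pd k N)) 0"

text \<open>At the origin \<open>a\<close> and \<open>da\<close> are the tensors \<open>a\<close> and \<open>\<nabla>a\<close>, and \<open>\<theta>\<close> is \<open>F\<^sup>T\<close>.\<close>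

definition a where "a i j = B (N 0) (f2 i j)"
definition da where "da k i j = B (N 0) (f3 k i j)"
definition \<theta> where "\<theta> k = B (f 0) (f1 k)"

lemma smooth_pd: "smooth_on \<phi> S \<Longrightarrow> smooth_on (pd i \<phi>) S"
  by (rule smooth_on_D)

lemma diff0: "smooth_on \<phi> S \<Longrightarrow> \<phi> differentiable (at 0)"
  using smooth_diff zero_in by blast

lemma f2_sym: "f2 i j = f2 j i"
  by (rule D_symmetric[OF open_S smooth_f zero_in])

lemma f3_sym: "f3 i j k = f3 j i k" "f3 i j k = f3 i k j"
   apply (rule D_symmetric[OF open_S smooth_pd[OF smooth_f] zero_in])
  by (rule D_cong[OF open_S zero_in]) (rule D_symmetric[OF open_S smooth_f])

lemma a_sym: "a i j = a j i"
  by (simp add: a_def f2_sym)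

text \<open>The Codazzi equation: at the origin \<open>da\<close> is a normal component of third
  partial derivatives of \<open>f\<close>, and these commute.\<close>

lemma da_sym: "da k i j = da i k j" "da k i j = da k j i"
  by (simp_all add: da_def f3_sym)

lemma f2_normal': "B (f1 k) (f2 i j) = 0"
  using f2_normal B_sym by metis

lemma N0: "B (N 0) (f1 k) = 0" "B (f1 k) (N 0) = 0" "B (N 0) (N 0) = e"
  using N_normal[OF zero_in] N_unit[OF zero_in] B_sym by metis+

lemma inv_metric0: "inv_metric B f 0 k l = (if k = l then 1 else 0)"
proof -
  have "inv_metric B f 0 k l = (\<Sigma> i. axis i 1 $ k * axis i 1 $ l)"
    by (rule inv_metric_frame[OF zero_in]) (rule orthonormal)
  also have "\<dots> = (\<Sigma> i. if i = k then if i = l then 1 else 0 else 0)"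
    by (rule sum.cong) (auto simp: axis_def)
  finally show ?thesis by simp
qed

lemma smooth_metric: "smooth_on (\<lambda>x. B (pd k f x) (pd l f x)) S"
  by (intro smooth_B smooth_pd smooth_f)

lemma D_metric0: "pd i (\<lambda>x. B (pd k f x) (pd l f x)) 0 = 0"
  by (simp add: D_bilinear[OF B.bounded_bilinear_axioms] diff0 smooth_pd smooth_f f2_normal f2_normal')

lemma D_inv_metric0: "pd i (\<lambda>x. inv_metric B f x k j) 0 = 0"
proof -
  have "0 = pd i (\<lambda>x. \<Sigma> l. inv_metric B f x k l * B (pd l f x) (pd j f x)) 0"
    using D_cong[OF open_S zero_in metric_inverse[of _ k j], where v = "axis i 1"] by (simp add: D_const)
  also have "\<dots> = (\<Sigma> l. inv_metric B f 0 k l * pd i (\<lambda>x. B (pd l f x) (pd j f x)) 0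
      + pd i (\<lambda>x. inv_metric B f x k l) 0 * B (f1 l) (f1 j))"
    by (simp add: D_sum D_mult diff0 smooth_on_mult[OF open_S] smooth_inv_metric smooth_metric)
  also have "\<dots> = pd i (\<lambda>x. inv_metric B f x k j) 0"
    by (simp add: D_metric0 orthonormal if_distrib cong: if_cong)
  finally show ?thesis by simp
qed

text \<open>Differentiate "inverse times metric is the identity" twice. First derivatives vanish at
  the origin, so minus the second derivative of the metric is left. Curvature enters the Bochner
  computation through these terms.\<close>

lemma D2_inv_metric0:
  "pd i (pd i (\<lambda>x. inv_metric B f x k j)) 0 = - (B (f1 k) (f3 i i j)
    + 2 * B (f2 i k) (f2 i j) + B (f3 i i k) (f1 j))"
proof -
  have "0 = pd i (pd i (\<lambda>x. \<Sigma> l. inv_metric B f x k l * B (pd l f x) (pd j f x))) 0"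
  proof -
    have "pd i (pd i (\<lambda>x. \<Sigma> l. inv_metric B f x k l * B (pd l f x) (pd j f x))) 0
        = pd i (pd i (\<lambda>x. if k = j then 1 else 0)) 0"
      by (rule D2_cong[OF open_S zero_in]) (rule metric_inverse)
    also have "pd i (\<lambda>x. if k = j then 1 else 0) = (\<lambda>x. 0 :: real)" by (rule ext) (rule D_const)
    finally show ?thesis by (simp add: D_const)
  qed
  also have "\<dots> = (\<Sigma> l. inv_metric B f 0 k l * pd i (pd i (\<lambda>x. B (pd l f x) (pd j f x))) 0
      + pd i (pd i (\<lambda>x. inv_metric B f x k l)) 0 * B (f1 l) (f1 j))"
    by (subst D2_sum[OF open_S _ zero_in], intro smooth_on_mult open_S smooth_inv_metric smooth_metric)
       (simp add: D2_bilinear[OF bounded_bilinear_mult open_S smooth_inv_metric smooth_metric zero_in]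
         D_inv_metric0 D_metric0)
  also have "\<dots> = pd i (pd i (\<lambda>x. B (pd k f x) (pd j f x))) 0 + pd i (pd i (\<lambda>x. inv_metric B f x k j)) 0"
    by (simp add: inv_metric0 orthonormal sum.distrib if_distrib[of "\<lambda>c. c * _"] if_distrib[of "(*) _"] cong: if_cong)
  finally show ?thesis
    by (simp add: D2_bilinear[OF B.bounded_bilinear_axioms open_S smooth_pd[OF smooth_f] smooth_pd[OF smooth_f] zero_in])
qed

lemma tangent_coord0: "tangent_coord B f X k 0 = B (X 0) (f1 k)"
  by (simp add: tangent_coord_def inv_metric0 if_distrib[of "\<lambda>c. c * _"] cong: if_cong)

lemma laplacian0: "metric_laplacian B f \<phi> 0 = (\<Sigma> i. pd i (pd i \<phi>) 0)"
  by (simp add: metric_laplacian_def inv_metric0 if_distrib[of "\<lambda>c. c *\<^sub>R _"] cong: if_cong)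

lemma D_laplacian0:
  assumes "smooth_on \<phi> S"
  shows "pd j (metric_laplacian B f \<phi>) 0 = (\<Sigma> i. pd j (pd i (pd i \<phi>)) 0)"
  unfolding metric_laplacian_def[abs_def]
  by (simp add: D_sum D_scaleR diff0 smooth_on_scaleR[OF open_S] smooth_on_sum[OF open_S] smooth_inv_metric smooth_pd assms
      D_inv_metric0 inv_metric0 if_distrib[of "\<lambda>c. c *\<^sub>R _"] cong: if_cong)

lemma position0: "f 0 + u 0 *\<^sub>R N 0 = (\<Sigma> k. \<theta> k *\<^sub>R f1 k)"
  using tangent_expand[where X = "\<lambda>x. f x + u x *\<^sub>R N x", OF zero_in position[OF zero_in]]
  by (simp add: tangent_coord0 \<theta>_def B.add_left B.scaleR_left N0)

text \<open>Second derivatives are normal at the origin, so only the tangential part of the position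
  survives in the drift. Comparison with \<open>position0\<close> then identifies the trace in
  \<open>trace_f2\<close>.\<close>

lemma drift0: "shrinker_drift B f k 0 = \<theta> k"
  by (simp add: shrinker_drift_def tangent_coord0 laplacian0 \<theta>_def B.add_left B.sum_left f2_normal)

lemma trace_f2: "(\<Sigma> i. f2 i i) = u 0 *\<^sub>R N 0"
proof -
  have "(\<Sigma> i. f2 i i) + f 0 = f 0 + u 0 *\<^sub>R N 0"
    unfolding position0 using shrinker_equation[OF zero_in] by (simp only: drift0 laplacian0)
  then show ?thesis by (simp add: add.commute[of "f 0"])
qed

lemma trace_a: "(\<Sigma> i. a i i) = u 0 * e"
  using arg_cong[OF trace_f2, of "B (N 0)"] by (simp add: a_def B.sum_right B.scaleR_right N0)

lemma drift_laplacian0: "drift_laplacian B f \<phi> 0 = (\<Sigma> i. pd i (pd i \<phi>) 0) - (\<Sigma> k. \<theta> k *\<^sub>R pd k \<phi> 0)"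
  by (simp add: drift_laplacian_def laplacian0 drift0)

lemma grad_prod0: "grad_prod B f \<phi> \<psi> 0 = (\<Sigma> k. pd k \<phi> 0 * pd k \<psi> 0)"
  by (simp add: grad_prod_def inv_metric0 if_distrib[of "\<lambda>c. c *\<^sub>R _"] if_distrib[of "\<lambda>c. c * _"] cong: if_cong)

lemma weingarten: "x \<in> S \<Longrightarrow> B (pd i N x) (pd j f x) = - B (N x) (pd i (pd j f) x)"
proof -
  assume x: "x \<in> S"
  have "pd i (\<lambda>x. B (N x) (pd j f x)) x = pd i (\<lambda>x. 0) x"
    by (rule D_cong[OF open_S x]) (rule N_normal)
  then show ?thesis
    by (simp add: D_bilinear[OF B.bounded_bilinear_axioms] N_diff f_diff1 x D_const)
qed

lemma weingarten0: "B (n1 i) (f1 j) = - a i j"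
  using weingarten[OF zero_in] by (simp add: a_def)

text \<open>Here parallelism enters: the derivative of \<open>N\<close> has no normal component and
  is determined by the Weingarten relation.\<close>

lemma D_N0: "n1 i = - (\<Sigma> j. a i j *\<^sub>R f1 j)"
  using tangent_expand[where X = "pd i N", OF zero_in N_parallel[OF zero_in]]
  by (simp add: tangent_coord0 weingarten0 sum_negf)

lemma D_shape0: "pd k (tangent_coord B f (pd i N) j) 0 = - da k i j"
proof -
  have "pd k (tangent_coord B f (pd i N) j) 0 = pd k (\<lambda>x. B (pd i N x) (pd j f x)) 0"
    unfolding tangent_coord_def[abs_def]
    by (simp add: D_sum D_mult diff0 smooth_on_mult[OF open_S] smooth_inv_metric smooth_B smooth_pd smooth_N smooth_f
        D_inv_metric0 inv_metric0 if_distrib[of "\<lambda>c. c * _"] cong: if_cong)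
  also have "\<dots> = pd k (\<lambda>x. - B (N x) (pd i (pd j f) x)) 0"
    by (rule D_cong[OF open_S zero_in]) (rule weingarten)
  also have "\<dots> = - (B (N 0) (f3 k i j) + B (n1 k) (f2 i j))"
    by (simp add: D_minus D_bilinear[OF B.bounded_bilinear_axioms] diff0 smooth_B smooth_pd smooth_N smooth_f)
  also have "B (n1 k) (f2 i j) = 0"
    by (simp add: D_N0 B.minus_left B.sum_left B.scaleR_left f2_normal')
  finally show ?thesis by (simp add: da_def)
qed

text \<open>The first sum is tangent, the second normal. The normal one involves the whole second
  fundamental form, not only its component along \<open>N\<close>.\<close>

lemma D2_N0: "n2 k i = - (\<Sigma> j. da k i j *\<^sub>R f1 j) - (\<Sigma> j. a i j *\<^sub>R f2 k j)"
proof -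
  have "n2 k i = pd k (\<lambda>x. \<Sigma> j. tangent_coord B f (pd i N) j x *\<^sub>R pd j f x) 0"
    by (rule D_cong[OF open_S zero_in]) (rule tangent_expand[OF _ N_parallel])
  also have "\<dots> = (\<Sigma> j. tangent_coord B f (pd i N) j 0 *\<^sub>R f2 k j
      + pd k (tangent_coord B f (pd i N) j) 0 *\<^sub>R f1 j)"
    by (simp add: D_sum D_scaleR diff0 smooth_on_scaleR[OF open_S] smooth_tangent_coord smooth_pd smooth_N smooth_f)
  finally show ?thesis
    by (simp add: D_shape0 tangent_coord0 weingarten0 sum.distrib sum_negf sum_subtractf)
qed

lemma shape_sq0: "shape_sq B f N 0 = (\<Sigma> i. \<Sigma> j. a i j * a i j)"
proof -
  have "shape_sq B f N 0 = (\<Sigma> i. B (n1 i) (n1 i))"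
    by (rule shape_sq_frame[OF zero_in]) (rule orthonormal)
  moreover have "B (n1 i) (n1 i) = (\<Sigma> j. a i j * a i j)" for i
    by (simp add: D_N0 B.minus_left B.minus_right B.sum_left B.sum_right B.scaleR_left B.scaleR_right orthonormal
        sum_negf if_distrib[of "(*) _"] cong: if_cong)
  ultimately show ?thesis by simp
qed

text \<open>\<open>t\<close>, \<open>t2\<close> and \<open>dx\<close> name derivatives of tangential
  coefficients. In \<open>contraction0\<close> the last two multiply tangent vectors only and remain
  unevaluated.\<close>

definition t where "t k j = pd j (tangent_coord B f (\<lambda>x. f x + u x *\<^sub>R N x) k) 0"
definition t2 where "t2 k j = pd j (pd j (tangent_coord B f (\<lambda>x. f x + u x *\<^sub>R N x) k)) 0"
definition dx where "dx l k = pd k (shrinker_drift B f l) 0"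

lemma smooth_position: "smooth_on (\<lambda>x. f x + u x *\<^sub>R N x) S"
  by (intro smooth_on_add smooth_on_scaleR smooth_f smooth_u smooth_N open_S)

lemma position_coord0: "tangent_coord B f (\<lambda>x. f x + u x *\<^sub>R N x) k 0 = \<theta> k"
  by (simp add: tangent_coord0 \<theta>_def B.add_left B.scaleR_left N0)

lemma D_position0:
  "f1 j + (u 0 *\<^sub>R n1 j + pd j u 0 *\<^sub>R N 0)
    = (\<Sigma> k. \<theta> k *\<^sub>R f2 j k + t k j *\<^sub>R f1 k)"
proof -
  have "pd j (\<lambda>x. f x + u x *\<^sub>R N x) 0
      = pd j (\<lambda>x. \<Sigma> k. tangent_coord B f (\<lambda>x. f x + u x *\<^sub>R N x) k x *\<^sub>R pd k f x) 0"
    by (rule D_cong[OF open_S zero_in]) (rule tangent_expand[OF _ position])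
  then show ?thesis
    by (simp add: D_add D_sum D_scaleR diff0 smooth_on_scaleR[OF open_S] smooth_tangent_coord smooth_pd smooth_N smooth_u smooth_f
        smooth_position position_coord0 t_def)
qed

text \<open>Tangential component of \<open>D_position0\<close>. It is half the Hessian of the
  squared length of the position vector, compare \<open>D2_height0\<close>.\<close>

lemma t_eq: "t k j = (if j = k then 1 else 0) - u 0 * a j k"
  using arg_cong[OF D_position0[of j], of "\<lambda>X. B X (f1 k)"]
  by (simp add: B.add_left B.sum_left B.scaleR_left orthonormal f2_normal N0 D_N0 B.minus_left B.diff_left sum.distrib
      if_distrib[of "(*) _"] cong: if_cong)

text \<open>The normal component of \<open>D_position0\<close>, as an equation of vectors: the
  second fundamental form applied to the tangential position is a multiple of
  \<open>N\<close>.\<close>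

lemma D_u0: "pd j u 0 *\<^sub>R N 0 = (\<Sigma> k. \<theta> k *\<^sub>R f2 j k)"
  using D_position0[of j]
  by (simp add: t_eq D_N0 sum.distrib scaleR_diff_left sum_subtractf scaleR_sum_right
      if_distrib[of "\<lambda>c. c *\<^sub>R _"] cong: if_cong) 

lemma D_u0_a: "e * pd j u 0 = (\<Sigma> k. a j k * \<theta> k)"
  using arg_cong[OF D_u0[of j], of "B (N 0)"]
  by (simp add: B.sum_right B.scaleR_right N0 a_def mult.commute)

lemma D2_position0:
  "f2 j j + (u 0 *\<^sub>R n2 j j + 2 *\<^sub>R (pd j u 0 *\<^sub>R n1 j) + pd j (pd j u) 0 *\<^sub>R N 0)
    = (\<Sigma> k. \<theta> k *\<^sub>R f3 j j k + 2 *\<^sub>R (t k j *\<^sub>R f2 j k) + t2 k j *\<^sub>R f1 k)"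
proof -
  have "pd j (pd j (\<lambda>x. f x + u x *\<^sub>R N x)) 0
      = pd j (pd j (\<lambda>x. \<Sigma> k. tangent_coord B f (\<lambda>x. f x + u x *\<^sub>R N x) k x *\<^sub>R pd k f x)) 0"
    by (rule D2_cong[OF open_S zero_in]) (rule tangent_expand[OF _ position])
  also have "\<dots> = (\<Sigma> k. \<theta> k *\<^sub>R f3 j j k + 2 *\<^sub>R (t k j *\<^sub>R f2 j k) + t2 k j *\<^sub>R f1 k)"
    by (subst D2_sum[OF open_S _ zero_in], intro smooth_on_scaleR open_S smooth_tangent_coord smooth_position smooth_pd smooth_f)
       (simp add: D2_bilinear[OF bounded_bilinear_scaleR open_S smooth_tangent_coord[OF smooth_position] smooth_pd[OF smooth_f] zero_in]
          position_coord0 t_def t2_def scaleR_double add.assoc)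
  finally show ?thesis
    by (simp add: D2_add[OF open_S smooth_f smooth_on_scaleR[OF open_S smooth_u smooth_N] zero_in]
        D2_bilinear[OF bounded_bilinear_scaleR open_S smooth_u smooth_N zero_in] scaleR_double add.assoc)
qed

lemma D_shrinker0:
  "(\<Sigma> i. f3 i i k) + f1 k
    = (\<Sigma> l. \<theta> l *\<^sub>R f2 k l + dx l k *\<^sub>R f1 l)"
proof -
  have "pd k (\<lambda>x. metric_laplacian B f f x + f x) 0
      = pd k (\<lambda>x. \<Sigma> l. shrinker_drift B f l x *\<^sub>R pd l f x) 0"
    by (rule D_cong[OF open_S zero_in]) (rule shrinker_equation)
  moreover have "f3 k i i = f3 i i k" for i
    by (metis f3_sym)
  ultimately show ?thesis
    by (simp add: D_add D_sum D_scaleR diff0 smooth_on_scaleR[OF open_S] smooth_shrinker_drift smooth_pd smooth_metric_laplacian smooth_f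
        D_laplacian0 drift0 dx_def)
qed

lemma tangent_subspace: "subspace (range (\<lambda>v. D v f 0))"
  by (rule linear_subspace_image[OF linear_D[OF f_diff[OF zero_in]] subspace_UNIV])

lemma tangent_sum: "(\<Sigma> k. c k *\<^sub>R f1 k) \<in> range (\<lambda>v. D v f 0)"
  by (intro subspace_sum[OF tangent_subspace] subspace_scale[OF tangent_subspace]) auto

text \<open>Normal component of the differentiated shrinker equation; together with
  \<open>D_u0_a\<close> and \<open>trace_a\<close> it is the traced Codazzi equation.\<close>

lemma divergence_a: "(\<Sigma> j. da j j k) = (\<Sigma> l. a k l * \<theta> l)"
  using arg_cong[OF D_shrinker0[of k], of "B (N 0)"]
  by (simp add: da_def a_def B.add_right B.sum_right B.scaleR_right N0 sum.distrib mult.commute)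

text \<open>Both statements come from one identity, the trace of the second derivative of
  "\<open>f + u N\<close> is tangent". Its normal part says that \<open>u\<close> times the
  contraction is a multiple of \<open>N\<close> whose coefficient contains the Laplacian of
  \<open>u\<close>; pairing with \<open>N\<close> evaluates that coefficient.\<close>

lemma contraction0: "(\<Sigma> j. \<Sigma> k. a j k *\<^sub>R f2 j k) = (e * shape_sq B f N 0) *\<^sub>R N 0"
  and drift_laplacian_u0: "drift_laplacian B f u 0 = u 0 * (1 - e * shape_sq B f N 0)"
proof -
  define X where "X = (\<Sigma> j. \<Sigma> k. a j k *\<^sub>R f2 j k)"
  define Lu where "Lu = (\<Sigma> j. pd j (pd j u) 0)"
  define Y1 where "Y1 = (\<Sigma> j. pd j u 0 *\<^sub>R n1 j)"
  define Y2 where "Y2 = (\<Sigma> j. \<Sigma> k. da j j k *\<^sub>R f1 k)"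
  define Y3 where "Y3 = (\<Sigma> j. \<Sigma> k. t2 k j *\<^sub>R f1 k)"
  define Y4 where "Y4 = (\<Sigma> k. \<theta> k *\<^sub>R ((\<Sigma> l. dx l k *\<^sub>R f1 l) - f1 k))"
  define s where "s = (\<Sigma> k. \<theta> k * pd k u 0)"
  let ?R = "range (\<lambda>v. D v f 0)"
  have Y: "Y1 \<in> ?R" "Y2 \<in> ?R" "Y3 \<in> ?R" "Y4 \<in> ?R"
    unfolding Y1_def Y2_def Y3_def Y4_def
    by (intro subspace_sum[OF tangent_subspace] subspace_scale[OF tangent_subspace] subspace_diff[OF tangent_subspace]
        tangent_sum N_parallel[OF zero_in] rangeI)+
  have n2: "(\<Sigma> j. n2 j j) = - Y2 - X"
    by (simp add: D2_N0 X_def Y2_def sum_subtractf sum_negf)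
  have f3: "(\<Sigma> j. \<Sigma> k. \<theta> k *\<^sub>R f3 j j k) = s *\<^sub>R N 0 + Y4"
  proof -
    have "(\<Sigma> j. \<Sigma> k. \<theta> k *\<^sub>R f3 j j k) = (\<Sigma> k. \<theta> k *\<^sub>R (\<Sigma> j. f3 j j k))"
      unfolding scaleR_sum_right by (rule sum.swap)
    also have "\<dots> = (\<Sigma> k. \<theta> k *\<^sub>R (pd k u 0 *\<^sub>R N 0 + ((\<Sigma> l. dx l k *\<^sub>R f1 l) - f1 k)))"
    proof (rule sum.cong[OF refl])
      fix k
      have "(\<Sigma> j. f3 j j k) = pd k u 0 *\<^sub>R N 0 + ((\<Sigma> l. dx l k *\<^sub>R f1 l) - f1 k)"
        using D_shrinker0[of k] by (simp add: sum.distrib D_u0 algebra_simps)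
      then show "\<theta> k *\<^sub>R (\<Sigma> j. f3 j j k) = \<theta> k *\<^sub>R (pd k u 0 *\<^sub>R N 0 + ((\<Sigma> l. dx l k *\<^sub>R f1 l) - f1 k))"
        by simp
    qed
    also have "\<dots> = s *\<^sub>R N 0 + Y4"
      by (simp add: s_def Y4_def scaleR_add_right sum.distrib scaleR_sum_left)
    finally show ?thesis .
  qed
  have tf: "(\<Sigma> j. \<Sigma> k. t k j *\<^sub>R f2 j k) = u 0 *\<^sub>R N 0 - u 0 *\<^sub>R X"
    by (simp add: t_eq X_def scaleR_diff_left sum_subtractf scaleR_sum_right trace_f2[symmetric]
      if_distrib[of "\<lambda>c. c *\<^sub>R _"] cong: if_cong)
  have "u 0 *\<^sub>R N 0 + (u 0 *\<^sub>R (- Y2 - X) + 2 *\<^sub>R Y1 + Lu *\<^sub>R N 0)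
      = (s *\<^sub>R N 0 + Y4) + 2 *\<^sub>R (u 0 *\<^sub>R N 0 - u 0 *\<^sub>R X) + Y3"
  proof -
    have "u 0 *\<^sub>R N 0 + (u 0 *\<^sub>R (- Y2 - X) + 2 *\<^sub>R Y1 + Lu *\<^sub>R N 0)
       = (\<Sigma> j. f2 j j + (u 0 *\<^sub>R n2 j j + 2 *\<^sub>R (pd j u 0 *\<^sub>R n1 j) + pd j (pd j u) 0 *\<^sub>R N 0))"
      unfolding sum.distrib trace_f2 scaleR_sum_right[symmetric] scaleR_sum_left[symmetric] n2 Y1_def[symmetric] Lu_def[symmetric] ..
    also have "\<dots> = (\<Sigma> j. \<Sigma> k. \<theta> k *\<^sub>R f3 j j k + 2 *\<^sub>R (t k j *\<^sub>R f2 j k) + t2 k j *\<^sub>R f1 k)"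
      by (simp only: D2_position0)
    also have "\<dots> = (s *\<^sub>R N 0 + Y4) + 2 *\<^sub>R (u 0 *\<^sub>R N 0 - u 0 *\<^sub>R X) + Y3"
      unfolding sum.distrib f3 scaleR_sum_right[symmetric] tf Y3_def[symmetric] ..
    finally show ?thesis .
  qed
  \<comment> \<open>The left side is normal and the right side tangent, so both vanish.\<close>
  then have X_eq: "u 0 *\<^sub>R X - (s + u 0 - Lu) *\<^sub>R N 0 = Y4 + Y3 + u 0 *\<^sub>R Y2 - 2 *\<^sub>R Y1"
    by (simp add: vec_eq_iff algebra_simps)
  have normal: "B (u 0 *\<^sub>R X - (s + u 0 - Lu) *\<^sub>R N 0) (f1 k) = 0" for k
    by (simp add: X_def B.diff_left B.scaleR_left B.sum_left f2_normal N0)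
  have "u 0 *\<^sub>R X - (s + u 0 - Lu) *\<^sub>R N 0 = 0"
  proof (rule tangent_normal_zero[OF zero_in _ normal])
    show "u 0 *\<^sub>R X - (s + u 0 - Lu) *\<^sub>R N 0 \<in> ?R"
      unfolding X_eq
      by (intro subspace_add[OF tangent_subspace] subspace_diff[OF tangent_subspace] subspace_scale[OF tangent_subspace] Y)
  qed
  then have uX: "u 0 *\<^sub>R X = (s + u 0 - Lu) *\<^sub>R N 0" by simp
  have "B (N 0) X = shape_sq B f N 0"
    by (simp add: X_def B.sum_right B.scaleR_right shape_sq0 flip: a_def)
  then have "u 0 * shape_sq B f N 0 = (s + u 0 - Lu) * e"
    using arg_cong[OF uX, of "B (N 0)"] by (simp add: B.scaleR_right N0)
  then have c: "s + u 0 - Lu = u 0 * (e * shape_sq B f N 0)"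
    using e by (metis mult.assoc mult.commute mult.right_neutral)
  then have "u 0 *\<^sub>R X = u 0 *\<^sub>R ((e * shape_sq B f N 0) *\<^sub>R N 0)" using uX by simp
  then show "X = (e * shape_sq B f N 0) *\<^sub>R N 0" using u_nz[OF zero_in] scaleR_left_imp_eq by blast
  show "drift_laplacian B f u 0 = u 0 * (1 - e * shape_sq B f N 0)"
    using c by (simp add: drift_laplacian0 Lu_def s_def algebra_simps)
qed

text \<open>The tangential part of the trace of \<open>n2\<close> is minus the divergence of
  \<open>a\<close>, which by \<open>divergence_a\<close> equals the drift term. What is left is
  \<open>contraction0\<close>.\<close>

lemma drift_laplacian_N0: "drift_laplacian B f N 0 = - (e * shape_sq B f N 0) *\<^sub>R N 0"
proof -
  have "(\<Sigma> i. n2 i i) = - (\<Sigma> k. (\<Sigma> j. da j j k) *\<^sub>R f1 k) - (e * shape_sq B f N 0) *\<^sub>R N 0"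
    unfolding D2_N0 sum_subtractf sum_negf contraction0 scaleR_sum_left
    using sum.swap[of "\<lambda>k j. da j j k *\<^sub>R f1 k" UNIV UNIV] by simp
  moreover have "(\<Sigma> k. \<theta> k *\<^sub>R n1 k) = - (\<Sigma> k. (\<Sigma> j. da j j k) *\<^sub>R f1 k)"
  proof -
    have "(\<Sigma> k. \<theta> k *\<^sub>R n1 k) = - (\<Sigma> k. \<Sigma> j. (\<theta> k * a k j) *\<^sub>R f1 j)"
      by (simp add: D_N0 scaleR_sum_right sum_negf)
    also have "\<dots> = - (\<Sigma> j. \<Sigma> k. (\<theta> k * a k j) *\<^sub>R f1 j)"
      by (rule arg_cong[where f = uminus], rule sum.swap)
    also have "\<dots> = - (\<Sigma> j. \<Sigma> k. (a j k * \<theta> k) *\<^sub>R f1 j)"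
      by (simp add: a_sym mult.commute)
    also have "\<dots> = - (\<Sigma> k. (\<Sigma> j. da j j k) *\<^sub>R f1 k)"
      by (simp add: divergence_a scaleR_sum_left)
    finally show ?thesis .
  qed
  ultimately show ?thesis by (simp add: drift_laplacian0)
qed

end

section \<open>Transfer from the origin of normal coordinates to every point\<close>

context shrinker_patch
begin

definition normal_chart :: "real^'m \<Rightarrow> (real^'m \<Rightarrow> real^'m) \<Rightarrow> (real^'m) set \<Rightarrow> bool" where
  "normal_chart x P T \<longleftrightarrow> open T \<and> 0 \<in> T \<and> smooth_on P T \<and> P ` T \<subseteq> S \<and> P 0 = x \<and>
    (\<forall>y\<in>T. inj (\<lambda>v. D v P y)) \<and> normal_patch B (\<lambda>y. f (P y)) (\<lambda>y. N (P y)) (\<lambda>y. u (P y)) e T"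

lemma normal_chartD:
  assumes "normal_chart x P T"
  shows "open T" "0 \<in> T" "smooth_on P T" "P ` T \<subseteq> S" "P 0 = x" "y \<in> T \<Longrightarrow> inj (\<lambda>v. D v P y)"
    "normal_patch B (\<lambda>y. f (P y)) (\<lambda>y. N (P y)) (\<lambda>y. u (P y)) e T"
  using assms unfolding normal_chart_def by blast+

lemma normal_chart_exists:
  assumes x: "x \<in> S"
  shows "\<exists>P T. normal_chart x P T"
proof (rule normal_coordinates[OF x])
  fix P :: "real^'m \<Rightarrow> real^'m" and T
  assume P: "open T" "0 \<in> T" "smooth_on P T" "P ` T \<subseteq> S" "P 0 = x"
    "\<And>y. y \<in> T \<Longrightarrow> inj (\<lambda>v. D v P y)"
    "\<And>i j. B (pd i (\<lambda>y. f (P y)) 0) (pd j (\<lambda>y. f (P y)) 0) = (if i = j then 1 else 0)"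
    "\<And>i j k. B (pd i (pd j (\<lambda>y. f (P y))) 0) (pd k (\<lambda>y. f (P y)) 0) = 0"
  have "normal_patch B (\<lambda>y. f (P y)) (\<lambda>y. N (P y)) (\<lambda>y. u (P y)) e T"
    using reparametrize[OF P(1,3,4,6)] P(2,7,8) by (simp add: normal_patch_def normal_patch_axioms_def)
  with P(1-6) show ?thesis unfolding normal_chart_def by blast
qed

text \<open>Stated at all points of the patch because \<open>D_drift_laplacian_N0\<close>
  differentiates it.\<close>

lemma drift_laplacian_N:
  assumes x: "x \<in> S"
  shows "drift_laplacian B f N x = - (e * shape_sq B f N x) *\<^sub>R N x"
proof -
  obtain P T where nc: "normal_chart x P T" using normal_chart_exists[OF x] by blast
  note P = normal_chartD[OF nc]
  interpret P: normal_patch B "\<lambda>y. f (P y)" "\<lambda>y. N (P y)" "\<lambda>y. u (P y)" e T by (rule P(7))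
  show ?thesis
    using P.drift_laplacian_N0 drift_laplacian_reparametrize[OF P(1,3,4,6,2) smooth_N]
      shape_sq_reparametrize[OF P(1,3,4,6,2)] by (simp add: P(5))
qed

lemma drift_laplacian_u:
  assumes x: "x \<in> S"
  shows "drift_laplacian B f u x = u x * (1 - e * shape_sq B f N x)"
proof -
  obtain P T where nc: "normal_chart x P T" using normal_chart_exists[OF x] by blast
  note P = normal_chartD[OF nc]
  interpret P: normal_patch B "\<lambda>y. f (P y)" "\<lambda>y. N (P y)" "\<lambda>y. u (P y)" e T by (rule P(7))
  show ?thesis
    using P.drift_laplacian_u0 drift_laplacian_reparametrize[OF P(1,3,4,6,2) smooth_u]
      shape_sq_reparametrize[OF P(1,3,4,6,2)] by (simp add: P(5))
qed

lemma drift_laplacian_elliptic_op: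
  "drift_laplacian B f \<phi> x = elliptic_op (inv_metric B f) (\<lambda>x k. - shrinker_drift B f k x) \<phi> x"
  by (simp add: drift_laplacian_def elliptic_op_def metric_laplacian_def sum_negf)

lemma drift_laplacian_mult:
  assumes "x \<in> S" "smooth_on \<phi> S" "smooth_on \<psi> S"
  shows "drift_laplacian B f (\<lambda>x. \<phi> x * \<psi> x) x =
    \<phi> x * drift_laplacian B f \<psi> x + \<psi> x * drift_laplacian B f \<phi> x + 2 * grad_prod B f \<phi> \<psi> x"
  using elliptic_op_mult[OF open_S assms(2,3,1), of "inv_metric B f" "\<lambda>x k. - shrinker_drift B f k x"]
    inv_metric_sym[OF assms(1)]
  by (simp add: drift_laplacian_elliptic_op grad_prod_def)

end

text \<open>Huisken's quotient. As \<open>a\<close> has trace \<open>e u\<close>, its value is 1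
  when \<open>a\<close> has rank one and \<open>1/m\<close> when \<open>a\<close> is
  umbilic.\<close>

definition pinching ::
  "(real^'n \<Rightarrow> real^'n \<Rightarrow> real) \<Rightarrow> (real^'m \<Rightarrow> real^'n) \<Rightarrow> (real^'m \<Rightarrow> real^'n) \<Rightarrow> (real^'m \<Rightarrow> real) \<Rightarrow> real^'m \<Rightarrow> real" where
  "pinching B f N u x = shape_sq B f N x / (u x * u x)"

lemma (in shrinker_patch) smooth_pinching: "smooth_on (pinching B f N u) S"
  unfolding pinching_def[abs_def]
  by (intro smooth_on_divide smooth_shape_sq smooth_on_mult smooth_u open_S) (simp add: u_nz)

section \<open>Bochner's formula and the inequality for the quotient\<close>

context normal_patch
begin

lemma N2_sym: "n2 i j = n2 j i"
  by (rule D_symmetric[OF open_S smooth_N zero_in])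

lemma B_f1: "B (\<Sigma> i. c i *\<^sub>R f1 i) (\<Sigma> i. d i *\<^sub>R f1 i) = (\<Sigma> i. c i * d i)"
  by (simp add: B.sum_left B.sum_right B.scaleR_left B.scaleR_right orthonormal mult.commute
      if_distrib[of "(*) _"] cong: if_cong)

lemma B_N1_N2: "B (n1 i) (n2 k l) = (\<Sigma> j. a i j * da k l j)"
proof -
  have "B (\<Sigma> j. a i j *\<^sub>R f1 j) (\<Sigma> j. a l j *\<^sub>R f2 k j) = 0"
    by (simp add: B.sum_left B.sum_right B.scaleR_left B.scaleR_right f2_normal')
  then show ?thesis
    unfolding D_N0 D2_N0 by (simp add: B.minus_left B.minus_right B.diff_right B_f1)
qed

text \<open>The second sum pairs normal vectors, so it has no sign when the form is indefinite; it
  will cancel in \<open>drift_laplacian_shape_sq0\<close>.\<close>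

lemma B_N2_N2: "B (n2 k i) (n2 k i) = (\<Sigma> j. da k i j * da k i j)
    + (\<Sigma> j. \<Sigma> l. a i j * a i l * B (f2 k j) (f2 k l))"
proof -
  have 1: "B (\<Sigma> j. da k i j *\<^sub>R f1 j) (\<Sigma> j. a i j *\<^sub>R f2 k j) = 0"
    by (simp add: B.sum_left B.sum_right B.scaleR_left B.scaleR_right f2_normal')
  have 2: "B (\<Sigma> j. a i j *\<^sub>R f2 k j) (\<Sigma> j. da k i j *\<^sub>R f1 j) = 0"
    using 1 B_sym by metis
  have "B (\<Sigma> j. a i j *\<^sub>R f2 k j) (\<Sigma> j. a i j *\<^sub>R f2 k j)
      = (\<Sigma> l. \<Sigma> j. a i j * a i l * B (f2 k j) (f2 k l))"
    by (simp add: B.sum_left B.sum_right B.scaleR_left B.scaleR_right sum_distrib_left mult_ac)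
  also have "\<dots> = (\<Sigma> j. \<Sigma> l. a i j * a i l * B (f2 k j) (f2 k l))"
    by (rule sum.swap)
  finally show ?thesis
    unfolding D2_N0 using 1 2 by (simp add: B.minus_left B.minus_right B.diff_left B.diff_right B_f1)
qed

lemma smooth_N1: "smooth_on (\<lambda>x. B (pd i N x) (pd j N x)) S"
  by (intro smooth_B smooth_pd smooth_N)

lemma D_shape_sq0: "pd k (shape_sq B f N) 0 = 2 * (\<Sigma> i. \<Sigma> j. a i j * da k i j)"
proof -
  have "pd k (shape_sq B f N) 0 = (\<Sigma> i. pd k (\<lambda>x. B (pd i N x) (pd i N x)) 0)"
    unfolding shape_sq_def[abs_def]
    by (simp add: D_sum D_mult diff0 smooth_on_mult[OF open_S] smooth_on_sum[OF open_S] smooth_inv_metric smooth_N1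
      D_inv_metric0 inv_metric0 if_distrib[of "\<lambda>c. c * _"] cong: if_cong)
  also have "\<dots> = (\<Sigma> i. 2 * (\<Sigma> j. a i j * da k i j))"
    by (simp add: D_bilinear[OF B.bounded_bilinear_axioms] diff0 smooth_pd smooth_N B_N1_N2 B_sym[of "pd k _ 0"])
  finally show ?thesis by (simp add: sum_distrib_left)
qed

lemma D2_shape_sq0:
  "pd k (pd k (shape_sq B f N)) 0 =
    (\<Sigma> i. \<Sigma> j. pd k (pd k (\<lambda>x. inv_metric B f x i j)) 0 * B (n1 i) (n1 j))
    + 2 * (\<Sigma> i. B (n1 i) (n3 k k i))
    + 2 * (\<Sigma> i. B (n2 k i) (n2 k i))"
proof -
  have summand: "pd k (pd k (\<lambda>x. inv_metric B f x i j * B (pd i N x) (pd j N x))) 0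
      = (if i = j then 2 * B (n1 i) (n3 k k i) + 2 * B (n2 k i) (n2 k i) else 0)
      + pd k (pd k (\<lambda>x. inv_metric B f x i j)) 0 * B (n1 i) (n1 j)" for i j
    using D2_bilinear[OF bounded_bilinear_mult open_S smooth_inv_metric smooth_N1 zero_in, of "axis k 1" "axis k 1" i j i j]
      D2_bilinear[OF B.bounded_bilinear_axioms open_S smooth_pd[OF smooth_N] smooth_pd[OF smooth_N] zero_in, of "axis k 1" "axis k 1" i j]
      B_sym[of "n3 k k i"]
    by (simp add: D_inv_metric0 inv_metric0)
  have "pd k (pd k (shape_sq B f N)) 0
      = (\<Sigma> i. \<Sigma> j. pd k (pd k (\<lambda>x. inv_metric B f x i j * B (pd i N x) (pd j N x))) 0)"
    unfolding shape_sq_def[abs_def] real_scaleR_def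
    by (simp add: D2_sum[OF open_S _ zero_in] smooth_on_sum[OF open_S] smooth_on_mult[OF open_S] smooth_inv_metric smooth_N1)
  then show ?thesis by (simp add: summand sum.distrib sum_distrib_left)
qed

lemma N_N1: "B (n1 i) (N 0) = 0"
  by (simp add: D_N0 B.minus_left B.sum_left B.scaleR_left N0)

text \<open>Differentiating the equation for \<open>N\<close> takes the place of commuting covariant
  derivatives; the curvature is hidden in \<open>dx\<close>.\<close>

lemma D_drift_laplacian_N0:
  "(\<Sigma> i. n3 i i j) - (\<Sigma> k. \<theta> k *\<^sub>R n2 k j + dx k j *\<^sub>R n1 k)
    = - (e * pd j (shape_sq B f N) 0) *\<^sub>R N 0 - (e * shape_sq B f N 0) *\<^sub>R n1 j"
proof -
  have sym3: "n3 j i i = n3 i i j" for i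
  proof -
    have "n3 j i i = n3 i j i"
      by (rule D_symmetric[OF open_S smooth_pd[OF smooth_N] zero_in])
    also have "\<dots> = n3 i i j"
      by (rule D_cong[OF open_S zero_in]) (rule D_symmetric[OF open_S smooth_N])
    finally show ?thesis .
  qed
  have "pd j (drift_laplacian B f N) 0 = pd j (\<lambda>x. - (e * shape_sq B f N x) *\<^sub>R N x) 0"
    by (rule D_cong[OF open_S zero_in]) (rule drift_laplacian_N)
  also have "\<dots> = - (e * pd j (shape_sq B f N) 0) *\<^sub>R N 0 - (e * shape_sq B f N 0) *\<^sub>R n1 j"
    by (simp add: D_minus D_scaleR D_mult D_const diff0 smooth_on_scaleR[OF open_S] smooth_on_mult[OF open_S] smooth_on_const smooth_shape_sq smooth_N)
  finally show ?thesis
    unfolding drift_laplacian_def[abs_def]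
    by (simp add: D_diff D_sum D_scaleR diff0 smooth_on_sum[OF open_S] smooth_on_scaleR[OF open_S] smooth_metric_laplacian
        smooth_shrinker_drift smooth_pd smooth_N D_laplacian0 sym3 drift0 dx_def N2_sym[of j])
qed

text \<open>Curvature appears as \<open>Z1\<close> and \<open>Z2\<close>. Second derivatives of the
  inverse metric give \<open>- 2 Z1 - 2 Z2\<close>, the differentiated equation for \<open>N\<close>
  gives \<open>2 Z1\<close> through \<open>dx\<close>, and the normal part of \<open>n2\<close>
  gives \<open>2 Z2\<close>. The term \<open>2 W\<close> stems from the derivative of the position
  in the shrinker equation, the Kronecker delta in \<open>dx\<close>.\<close>

lemma drift_laplacian_shape_sq0:
  "drift_laplacian B f (shape_sq B f N) 0 = 2 * shape_sq B f N 0 - 2 * e * (shape_sq B f N 0 * shape_sq B f N 0)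
    + 2 * (\<Sigma> k. \<Sigma> i. \<Sigma> j. da k i j * da k i j)"
proof -
  define W where "W = shape_sq B f N 0"
  define m where "m i j = B (n1 i) (n1 j)" for i j
  define Z1 where "Z1 = (\<Sigma> i. \<Sigma> j. m i j * (\<Sigma> k. B (f3 k k i) (f1 j)))"
  define Z2 where "Z2 = (\<Sigma> i. \<Sigma> j. m i j * (\<Sigma> k. B (f2 k i) (f2 k j)))"
  define A1 where "A1 = (\<Sigma> j. \<Sigma> i. B (n1 j) (n3 i i j))"
  define A2 where "A2 = (\<Sigma> k. \<Sigma> i. B (n2 k i) (n2 k i))"
  define DW where "DW k = pd k (shape_sq B f N) 0" for k
  have m_sym: "m i j = m j i" for i j unfolding m_def by (rule B_sym)
  have m_a: "m i j = (\<Sigma> l. a i l * a j l)" for i j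
    by (simp add: m_def D_N0 B.minus_left B.minus_right B_f1)
  have trace_m: "(\<Sigma> i. m i i) = W" by (simp add: W_def shape_sq0 m_a)
  have metric_part: "(\<Sigma> k. \<Sigma> i. \<Sigma> j. pd k (pd k (\<lambda>x. inv_metric B f x i j)) 0 * m i j) = - 2 * Z1 - 2 * Z2"
  proof -
    have "(\<Sigma> k. \<Sigma> i. \<Sigma> j. pd k (pd k (\<lambda>x. inv_metric B f x i j)) 0 * m i j)
        = (\<Sigma> i. \<Sigma> j. \<Sigma> k. pd k (pd k (\<lambda>x. inv_metric B f x i j)) 0 * m i j)"
      by (subst sum.swap, rule sum.cong[OF refl], rule sum.swap)
    also have "\<dots> = (\<Sigma> i. \<Sigma> j. - (m j i * (\<Sigma> k. B (f3 k k j) (f1 i)))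
        - m i j * (\<Sigma> k. B (f3 k k i) (f1 j))
        - 2 * (m i j * (\<Sigma> k. B (f2 k i) (f2 k j))))"
    proof (intro sum.cong refl)
      fix i j
      have "pd k (pd k (\<lambda>x. inv_metric B f x i j)) 0 * m i j = - (m i j * B (f3 k k j) (f1 i))
          - m i j * B (f3 k k i) (f1 j) - 2 * (m i j * B (f2 k i) (f2 k j))" for k
        by (simp add: D2_inv_metric0 B_sym[of "f1 i" "f3 k k j"] algebra_simps)
      then show "(\<Sigma> k. pd k (pd k (\<lambda>x. inv_metric B f x i j)) 0 * m i j)
        = - (m j i * (\<Sigma> k. B (f3 k k j) (f1 i)))
        - m i j * (\<Sigma> k. B (f3 k k i) (f1 j))
        - 2 * (m i j * (\<Sigma> k. B (f2 k i) (f2 k j)))"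
        by (simp add: sum_subtractf sum_negf sum_distrib_left m_sym[of j i])
    qed
    also have "\<dots> = - (\<Sigma> i. \<Sigma> j. m j i * (\<Sigma> k. B (f3 k k j) (f1 i))) - Z1 - 2 * Z2"
      by (simp add: sum_subtractf sum_negf sum_distrib_left Z1_def Z2_def)
    also have "(\<Sigma> i. \<Sigma> j. m j i * (\<Sigma> k. B (f3 k k j) (f1 i))) = Z1"
      unfolding Z1_def by (rule sum.swap)
    finally show ?thesis by simp
  qed
  have dx: "dx k j = (\<Sigma> i. B (f3 i i j) (f1 k)) + (if j = k then 1 else 0)" for k j
    using arg_cong[OF D_shrinker0[of j], of "\<lambda>X. B X (f1 k)"]
    by (simp add: B.add_left B.sum_left B.scaleR_left orthonormal f2_normal sum.distrib if_distrib[of "(*) _"] cong: if_cong)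
  have A1: "2 * A1 = (\<Sigma> k. \<theta> k * DW k) + 2 * Z1 + 2 * W - 2 * e * (W * W)"
  proof -
    have "(\<Sigma> i. B (n1 j) (n3 i i j))
      = (\<Sigma> k. \<theta> k * B (n1 j) (n2 k j)) + (\<Sigma> k. dx k j * m j k) - e * W * m j j" for j
      using arg_cong[OF D_drift_laplacian_N0[of j], of "B (n1 j)"]
      by (simp add: B.diff_right B.add_right B.sum_right B.scaleR_right B.minus_right N_N1 m_def W_def sum.distrib)
    then have "A1 = (\<Sigma> j. \<Sigma> k. \<theta> k * B (n1 j) (n2 k j)) + (\<Sigma> j. \<Sigma> k. dx k j * m j k) - e * W * W"
      by (simp add: A1_def sum.distrib sum_subtractf trace_m[symmetric] sum_distrib_left)
    also have "(\<Sigma> j. \<Sigma> k. dx k j * m j k) = Z1 + W"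
    proof -
      have "dx k j * m j k = m j k * (\<Sigma> i. B (f3 i i j) (f1 k)) + (if j = k then m j j else 0)" for j k
        by (simp add: dx algebra_simps)
      then show ?thesis by (simp add: sum.distrib Z1_def trace_m)
    qed
    finally have A1_eq: "A1 = (\<Sigma> j. \<Sigma> k. \<theta> k * B (n1 j) (n2 k j)) + (Z1 + W) - e * W * W" .
    have "2 * (\<Sigma> j. \<Sigma> k. \<theta> k * B (n1 j) (n2 k j)) = (\<Sigma> k. \<theta> k * DW k)"
    proof -
      have "(\<Sigma> j. \<Sigma> k. \<theta> k * B (n1 j) (n2 k j)) = (\<Sigma> k. \<theta> k * (\<Sigma> i. \<Sigma> j. a i j * da k i j))"
        by (subst sum.swap) (simp add: B_N1_N2 sum_distrib_left)
      then show ?thesis by (simp add: DW_def D_shape_sq0 sum_distrib_left mult_ac)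
    qed
    then show ?thesis unfolding A1_eq by (simp add: algebra_simps)
  qed
  have A2: "A2 = (\<Sigma> k. \<Sigma> i. \<Sigma> j. da k i j * da k i j) + Z2"
  proof -
    have "(\<Sigma> k. \<Sigma> i. \<Sigma> j. \<Sigma> l. a i j * a i l * B (f2 k j) (f2 k l))
      = (\<Sigma> i. \<Sigma> k. \<Sigma> j. \<Sigma> l. a i j * a i l * B (f2 k j) (f2 k l))"
      by (rule sum.swap)
    also have "\<dots> = (\<Sigma> i. \<Sigma> j. \<Sigma> l. \<Sigma> k. a i j * a i l * B (f2 k j) (f2 k l))"
      by (rule sum.cong[OF refl], subst sum.swap, rule sum.cong[OF refl], rule sum.swap)
    also have "\<dots> = (\<Sigma> j. \<Sigma> i. \<Sigma> l. \<Sigma> k. a i j * a i l * B (f2 k j) (f2 k l))"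
      by (rule sum.swap)
    also have "\<dots> = (\<Sigma> j. \<Sigma> l. \<Sigma> i. \<Sigma> k. a i j * a i l * B (f2 k j) (f2 k l))"
      by (rule sum.cong[OF refl], rule sum.swap)
    also have "\<dots> = (\<Sigma> j. \<Sigma> l. \<Sigma> k. \<Sigma> i. a i j * a i l * B (f2 k j) (f2 k l))"
      by (rule sum.cong[OF refl], rule sum.cong[OF refl], rule sum.swap)
    also have "\<dots> = Z2"
      by (simp add: Z2_def m_a sum_distrib_left sum_distrib_right a_sym)
    finally show ?thesis
      by (simp add: A2_def B_N2_N2 sum.distrib)
  qed
  have "(\<Sigma> k. pd k (pd k (shape_sq B f N)) 0) = (- 2 * Z1 - 2 * Z2) + 2 * A1 + 2 * A2"
  proof -
    have "(\<Sigma> k. \<Sigma> i. B (n1 i) (n3 k k i)) = A1"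
      unfolding A1_def by (rule sum.swap)
    then show ?thesis
      unfolding D2_shape_sq0 by (simp add: sum.distrib metric_part m_def[symmetric] A2_def[symmetric] flip: sum_distrib_left)
  qed
  then show ?thesis
    by (simp add: drift_laplacian0 A1 A2 flip: W_def DW_def)
qed

lemma smooth_uu: "smooth_on (\<lambda>x. u x * u x) S"
  by (intro smooth_on_mult smooth_u open_S)

lemma shape_sq_pinching: "x \<in> S \<Longrightarrow> shape_sq B f N x = pinching B f N u x * (u x * u x)"
  using u_nz by (simp add: pinching_def)

lemma D_shape_sq_pinching:
  "pd k (shape_sq B f N) 0 = pinching B f N u 0 * (2 * u 0 * pd k u 0) + pd k (pinching B f N u) 0 * (u 0 * u 0)"
proof -
  have "pd k (shape_sq B f N) 0 = pd k (\<lambda>x. pinching B f N u x * (u x * u x)) 0"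
    by (rule D_cong[OF open_S zero_in]) (rule shape_sq_pinching)
  then show ?thesis by (simp add: D_mult diff0 smooth_pinching smooth_u smooth_uu)
qed

text \<open>The product rule for \<open>W = w u^2\<close> avoids differentiating a quotient. The
  zeroth-order terms of the two sides agree and drop out. \<open>cross\<close> trades the mixed sum
  of \<open>a\<close>, \<open>da\<close> and the gradient of \<open>u\<close> for the gradient of
  \<open>w\<close>, after which the rest is the expanded square.\<close>

lemma drift_laplacian_pinching0:
  "(u 0)^4 * (drift_laplacian B f (pinching B f N u) 0 + 2 / u 0 * grad_prod B f (pinching B f N u) u 0)
    = 2 * (\<Sigma> k. \<Sigma> i. \<Sigma> j. (u 0 * da k i j - pd k u 0 * a i j)\<^sup>2)"
proof -
  define W w V G A where "W = shape_sq B f N 0" and "w = pinching B f N u 0"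
    and "V = (\<Sigma> k. pd k u 0 * pd k u 0)" and "G = grad_prod B f (pinching B f N u) u 0"
    and "A = (\<Sigma> k. \<Sigma> i. \<Sigma> j. da k i j * da k i j)"
  let ?Lw = "drift_laplacian B f (pinching B f N u) 0"
  have Ww: "W = w * (u 0 * u 0)" using shape_sq_pinching[OF zero_in] by (simp add: W_def w_def)
  have "drift_laplacian B f (shape_sq B f N) 0 = drift_laplacian B f (\<lambda>x. pinching B f N u x * (u x * u x)) 0"
  proof -
    have D2: "pd i (pd i (shape_sq B f N)) 0 = pd i (pd i (\<lambda>x. pinching B f N u x * (u x * u x))) 0" for i
      by (rule D2_cong[OF open_S zero_in]) (rule shape_sq_pinching)
    have D1: "pd i (shape_sq B f N) 0 = pd i (\<lambda>x. pinching B f N u x * (u x * u x)) 0" for i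
      by (rule D_cong[OF open_S zero_in]) (rule shape_sq_pinching)
    show ?thesis unfolding drift_laplacian0 D1 D2 ..
  qed
  also have "\<dots> = w * drift_laplacian B f (\<lambda>x. u x * u x) 0 + (u 0 * u 0) * ?Lw + 2 * grad_prod B f (pinching B f N u) (\<lambda>x. u x * u x) 0"
    unfolding w_def by (rule drift_laplacian_mult[OF zero_in smooth_pinching smooth_uu])
  also have "drift_laplacian B f (\<lambda>x. u x * u x) 0 = 2 * (u 0 * (u 0 * (1 - e * W))) + 2 * V"
    using drift_laplacian_mult[OF zero_in smooth_u smooth_u] by (simp add: drift_laplacian_u0 W_def V_def grad_prod0)
  also have "grad_prod B f (pinching B f N u) (\<lambda>x. u x * u x) 0 = 2 * u 0 * G"
    by (simp add: grad_prod0 G_def D_mult diff0 smooth_u sum_distrib_left algebra_simps)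
  finally have LW: "2 * W - 2 * e * (W * W) + 2 * A
      = w * (2 * (u 0 * (u 0 * (1 - e * W))) + 2 * V) + (u 0 * u 0) * ?Lw + 2 * (2 * u 0 * G)"
    by (simp add: drift_laplacian_shape_sq0 W_def A_def)
  have L1: "u 0 * u 0 * ?Lw = 2 * A - 2 * w * V - 4 * u 0 * G"
    using LW unfolding Ww by (simp add: algebra_simps)
  have cross: "2 * (\<Sigma> k. pd k u 0 * (\<Sigma> i. \<Sigma> j. a i j * da k i j)) = 2 * w * u 0 * V + G * (u 0 * u 0)"
  proof -
    have "2 * (\<Sigma> k. pd k u 0 * (\<Sigma> i. \<Sigma> j. a i j * da k i j)) = (\<Sigma> k. pd k u 0 * pd k (shape_sq B f N) 0)"
      by (simp add: D_shape_sq0 sum_distrib_left mult_ac)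
    also have "\<dots> = (\<Sigma> k. 2 * w * u 0 * (pd k u 0 * pd k u 0) + pd k (pinching B f N u) 0 * pd k u 0 * (u 0 * u 0))"
      by (rule sum.cong) (simp_all add: D_shape_sq_pinching w_def algebra_simps)
    also have "\<dots> = 2 * w * u 0 * V + G * (u 0 * u 0)"
      by (simp add: sum.distrib V_def G_def grad_prod0 sum_distrib_left[symmetric] sum_distrib_right[symmetric])
    finally show ?thesis .
  qed
  have "(\<Sigma> k. \<Sigma> i. \<Sigma> j. (u 0 * da k i j - pd k u 0 * a i j)\<^sup>2)
      = (\<Sigma> k. (\<Sigma> i. \<Sigma> j. (u 0 * u 0) * (da k i j * da k i j) + (pd k u 0 * pd k u 0) * (a i j * a i j)
          - 2 * u 0 * (pd k u 0 * (a i j * da k i j))))"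
    by (intro sum.cong refl) (simp add: power2_eq_square algebra_simps)
  also have "\<dots> = (u 0 * u 0) * A + V * W - u 0 * (2 * (\<Sigma> k. pd k u 0 * (\<Sigma> i. \<Sigma> j. a i j * da k i j)))"
    by (simp add: sum.distrib sum_subtractf A_def V_def W_def shape_sq0 sum_distrib_left[symmetric] sum_distrib_right[symmetric])
  also have "\<dots> = (u 0 * u 0) * A + V * (w * (u 0 * u 0)) - u 0 * (2 * w * u 0 * V + G * (u 0 * u 0))"
    unfolding cross Ww ..
  finally have S: "(\<Sigma> k. \<Sigma> i. \<Sigma> j. (u 0 * da k i j - pd k u 0 * a i j)\<^sup>2) = \<dots>" .
  have "(u 0)^4 * (?Lw + 2 / u 0 * G) = (u 0 * u 0) * (u 0 * u 0 * ?Lw) + 2 * (u 0 * u 0 * u 0) * G"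
    using u_nz[OF zero_in] by (simp add: field_simps power4_eq_xxxx)
  also have "\<dots> = 2 * ((u 0 * u 0) * A + V * (w * (u 0 * u 0)) - u 0 * (2 * w * u 0 * V + G * (u 0 * u 0)))"
    unfolding L1 by (simp add: algebra_simps)
  finally show ?thesis unfolding S G_def .
qed

end

section \<open>Extrema of the squared length of the position vector, and the case of constant
  quotient\<close>

context normal_patch
begin

abbreviation "height x \<equiv> B (f x) (f x)"

lemma smooth_height: "smooth_on height S"
  by (intro smooth_B smooth_f)

lemma D2_height0: "pd i (pd j height) 0 = 2 * ((if i = j then 1 else 0) - u 0 * a i j)"
proof -
  have f: "f 0 = (\<Sigma> k. \<theta> k *\<^sub>R f1 k) - u 0 *\<^sub>R N 0" using position0 by (simp add: eq_diff_eq)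
  have "B (f 0) (f2 i j) = - (u 0 * a i j)"
    unfolding f by (simp add: B.diff_left B.sum_left B.scaleR_left f2_normal' a_def)
  then show ?thesis
    using D2_bilinear[OF B.bounded_bilinear_axioms open_S smooth_f smooth_f zero_in, of "axis i 1" "axis j 1"]
    by (simp add: orthonormal B_sym[of _ "f 0"])
qed

lemma D2_height_dir0:
  "D v (D v height) 0 = 2 * ((\<Sigma> i. v $ i * v $ i) - u 0 * (\<Sigma> i. \<Sigma> j. v $ i * v $ j * a i j))"
proof -
  have "v $ i * v $ j * pd i (pd j height) 0 = (if i = j then 2 * (v $ i * v $ i) else 0) - 2 * (u 0 * (v $ i * v $ j * a i j))" for i j
    by (simp add: D2_height0 algebra_simps)
  then show ?thesis
    by (simp add: D2_expand_cart[OF open_S smooth_height zero_in, of v v] sum_subtractf sum_distrib_left)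
qed

lemma height_max0:
  assumes "\<And>y. y \<in> S \<Longrightarrow> height y \<le> height 0"
  shows "(\<Sigma> i. v $ i * v $ i) \<le> u 0 * (\<Sigma> i. \<Sigma> j. v $ i * v $ j * a i j)"
  using local_max_D(2)[OF open_S smooth_height zero_in assms, of v] by (simp add: D2_height_dir0)

lemma quadratic_axis: "(\<Sigma> i. axis k 1 $ i * axis k 1 $ i) = (1::real)"
  "(\<Sigma> i. \<Sigma> j. axis k 1 $ i * axis k 1 $ j * a i j) = a k k"
proof -
  show "(\<Sigma> i. axis k 1 $ i * axis k 1 $ i) = (1::real)"
    by (simp add: axis_def if_distrib[of "\<lambda>c. c * _"] cong: if_cong)
  have "(\<Sigma> j. axis k 1 $ i * axis k 1 $ j * a i j) = (\<Sigma> j. if j = k then if i = k then a k k else 0 else 0)" for i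
    by (rule sum.cong) (auto simp: axis_def)
  then show "(\<Sigma> i. \<Sigma> j. axis k 1 $ i * axis k 1 $ j * a i j) = a k k" by simp
qed

lemma height_max_length0:
  assumes "\<And>y. y \<in> S \<Longrightarrow> height y \<le> height 0"
  shows "1 \<le> u 0 * a k k" "real CARD('m) \<le> u 0 * u 0 * e"
proof -
  show *: "1 \<le> u 0 * a k k" for k using height_max0[OF assms, of "axis k 1"] unfolding quadratic_axis .
  have "real CARD('m) = (\<Sum>k\<in>(UNIV::'m set). 1)" by simp
  also have "\<dots> \<le> (\<Sigma> k. u 0 * a k k)" using * by (intro sum_mono)
  also have "\<dots> = u 0 * u 0 * e" by (simp add: sum_distrib_left[symmetric] trace_a)
  finally show "real CARD('m) \<le> u 0 * u 0 * e" .
qed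

lemma height_min_length0:
  assumes "\<And>y. y \<in> S \<Longrightarrow> height 0 \<le> height y"
  shows "u 0 * u 0 * e \<le> real CARD('m)"
proof -
  have "u 0 * a k k \<le> 1" for k
  proof -
    have "D (axis k 1) (D (axis k 1) (\<lambda>x. - 1 * height x)) 0 \<le> 0"
      using assms by (intro local_max_D(2)[OF open_S _ zero_in] smooth_on_mult smooth_on_const open_S smooth_height) auto
    also have "D (axis k 1) (D (axis k 1) (\<lambda>x. - 1 * height x)) 0 = - 1 * pd k (pd k height) 0"
    proof -
      have "pd k (\<lambda>x. - 1) = (\<lambda>x. 0 :: real)" by (rule ext) (rule D_const)
      then show ?thesis
        using D2_mult[OF open_S smooth_on_const smooth_height zero_in, of "axis k 1" "axis k 1" "-1"] by (simp add: D_const)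
    qed
    finally show ?thesis by (simp add: D2_height0)
  qed
  then have "(\<Sigma> k. u 0 * a k k) \<le> (\<Sum>k\<in>(UNIV::'m set). 1)" by (intro sum_mono)
  then show ?thesis by (simp add: sum_distrib_left[symmetric] trace_a)
qed

lemma trace_a_sq: "(\<Sigma> i. a i i) * (\<Sigma> i. a i i) = u 0 * u 0"
  using e by (simp add: trace_a mult_ac)

text \<open>At a maximum of \<open>height\<close> all \<open>2 \<times> 2\<close> principal minors of \<open>a\<close> are positive, so \<open>a\<close> cannot have rank one.\<close>

lemma height_max_pinching0:
  assumes max: "\<And>y. y \<in> S \<Longrightarrow> height y \<le> height 0" and "CARD('m) \<noteq> 1"
  shows "pinching B f N u 0 < 1"
proof -
  have minor: "a i i * a j j - a i j * a i j > 0" if "i \<noteq> j" for i j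
  proof -
    \<comment> \<open>In the plane of the two axes, \<open>v\<close> is the vector orthogonal to
      \<open>axis j 1\<close> with respect to \<open>a\<close>; on it the quadratic form is
      \<open>a j j\<close> times the minor.\<close>
    define v :: "real^'m" where "v = a j j *\<^sub>R axis i 1 - a i j *\<^sub>R axis j 1"
    have v: "v $ k = (if k = i then a j j else 0) - (if k = j then a i j else 0)" for k
      by (simp add: v_def axis_def)
    have q1: "(\<Sigma> k. v $ k * v $ k) = a j j * a j j + a i j * a i j"
    proof -
      have "v $ k * v $ k = (if k = i then a j j * a j j else 0) + (if k = j then a i j * a i j else 0)" for k
        using that by (auto simp: v)
      then show ?thesis by (simp add: sum.distrib)
    qed
    have q2: "(\<Sigma> k. \<Sigma> l. v $ k * v $ l * a k l) = a j j * (a i i * a j j - a i j * a i j)"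
    proof -
      have 1: "(\<Sigma> l. v $ k * v $ l * a k l) = v $ k * (a j j * a k i - a i j * a k j)" for k
      proof -
        have "v $ k * v $ l * a k l = (if l = i then v $ k * (a j j * a k i) else 0) - (if l = j then v $ k * (a i j * a k j) else 0)" for l
          by (auto simp: v[of l] algebra_simps)
        then show ?thesis by (simp only: sum_subtractf) (simp add: right_diff_distrib)
      qed
      have 2: "v $ k * (a j j * a k i - a i j * a k j)
          = (if k = i then a j j * (a j j * a i i - a i j * a i j) else 0)
          - (if k = j then a i j * (a j j * a j i - a i j * a j j) else 0)" for k
        by (auto simp: v algebra_simps)
      show ?thesis by (simp only: 1 2 sum_subtractf) (simp add: a_sym[of j i] algebra_simps)
    qed
    have "a j j * a j j + a i j * a i j \<le> (u 0 * a j j) * (a i i * a j j - a i j * a i j)"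
      using height_max0[OF max, of v] unfolding q1 q2 by (simp only: mult.assoc)
    moreover have j: "1 \<le> u 0 * a j j" by (rule height_max_length0[OF max])
    moreover have "0 < a j j * a j j"
    proof -
      have "a j j \<noteq> 0" using j by auto
      then show ?thesis by (auto simp: zero_less_mult_iff linorder_neq_iff)
    qed
    moreover have "0 \<le> a i j * a i j" by simp
    ultimately have "0 < (u 0 * a j j) * (a i i * a j j - a i j * a i j)" by linarith
    with j show ?thesis by (simp add: zero_less_mult_iff)
  qed
  have "\<exists>i j :: 'm. i \<noteq> j"
  proof (rule ccontr)
    assume "\<not> (\<exists>i j :: 'm. i \<noteq> j)"
    then have "(UNIV :: 'm set) = {undefined}" by auto
    then have "CARD('m) = 1" by (metis card_1_singleton_iff One_nat_def)
    with assms(2) show False by simp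
  qed
  then obtain p q :: 'm where "p \<noteq> q" by blast
  have nonneg: "0 \<le> a i i * a j j - a i j * a i j" for i j
    using minor[of i j] by (cases "i = j") auto
  have row: "0 < (\<Sigma> j. a p p * a j j - a p j * a p j)"
    by (rule sum_pos2[of _ q]) (use nonneg minor[OF \<open>p \<noteq> q\<close>] in auto)
  \<comment> \<open>Summed over all pairs, the minors give the squared trace minus
    \<open>|a|^2\<close>, that is \<open>u^2 - |a|^2\<close>. A single positive minor off the
    diagonal makes this positive.\<close>
  have "0 < (\<Sigma> i. \<Sigma> j. a i i * a j j - a i j * a i j)"
    by (rule sum_pos2[where i = p and f = "\<lambda>i. \<Sigma> j. a i i * a j j - a i j * a i j"])
       (simp_all only: finite UNIV_I row sum_nonneg nonneg)
  also have "\<dots> = u 0 * u 0 - shape_sq B f N 0"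
    by (simp add: sum_subtractf shape_sq0 flip: trace_a_sq sum_product)
  finally show ?thesis
    using u_nz[OF zero_in] by (simp add: pinching_def divide_less_eq zero_less_mult_iff linorder_neq_iff)
qed

text \<open>Constancy kills the sum of squares in \<open>drift_laplacian_pinching0\<close>, so
  \<open>u da\<close> is the gradient of \<open>u\<close> tensor \<open>a\<close>, and by Codazzi
  this product is symmetric in all indices. Where the gradient is nonzero, \<open>a\<close> must be
  a multiple of its tensor square; the proof extracts only \<open>|a|^2 = (tr a)^2\<close>, by
  exchanging two indices in one factor and contracting.\<close>

lemma pinching_const0:
  assumes const: "\<And>y. y \<in> S \<Longrightarrow> pinching B f N u y = w0"
  shows "w0 = 1 \<or> (\<forall>k. pd k u 0 = 0)"
proof -
  let ?w = "pinching B f N u"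
  have Dw: "pd k ?w x = 0" if "x \<in> S" for k x
    using D_cong[OF open_S that const, where v = "axis k 1"] by (simp add: D_const)
  have D2w: "pd k (pd k ?w) 0 = 0" for k
    using D_cong[OF open_S zero_in Dw, where v = "axis k 1"] by (simp add: D_const)
  have "(\<Sigma> k. \<Sigma> i. \<Sigma> j. (u 0 * da k i j - pd k u 0 * a i j)\<^sup>2) = 0"
    using drift_laplacian_pinching0 by (simp add: drift_laplacian0 grad_prod0 Dw[OF zero_in] D2w)
  then have "(u 0 * da k i j - pd k u 0 * a i j)\<^sup>2 = 0" for k i j
    by (simp add: sum_nonneg_eq_0_iff sum_nonneg)
  then have eq: "u 0 * da k i j = pd k u 0 * a i j" for k i j by simp
  have codazzi: "pd k u 0 * a i j = pd i u 0 * a k j" for k i j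
    using eq[of k i j] eq[of i k j] da_sym(1)[of k i j] by simp
  show ?thesis
  proof (cases "\<forall>k. pd k u 0 = 0")
    case False
    define V where "V = (\<Sigma> k. pd k u 0 * pd k u 0)"
    define tr where "tr = (\<Sigma> i. a i i)"
    have "V > 0"
    proof -
      obtain k where k: "pd k u 0 \<noteq> 0" using False by blast
      have "0 < pd k u 0 * pd k u 0" using k by (auto simp: zero_less_mult_iff linorder_neq_iff)
      then show ?thesis unfolding V_def by (intro sum_pos2[of _ k]) auto
    qed
    have tr: "(\<Sigma> k. pd k u 0 * a k j) = tr * pd j u 0" for j
    proof -
      have "(\<Sigma> k. pd k u 0 * a k j) = (\<Sigma> k. pd j u 0 * a k k)"
        by (rule sum.cong[OF refl]) (metis codazzi a_sym)
      then show ?thesis by (simp add: tr_def sum_distrib_left mult.commute)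
    qed
    have "V * shape_sq B f N 0 = (\<Sigma> k. \<Sigma> i. \<Sigma> j. (pd k u 0 * a i j) * (pd k u 0 * a i j))"
      unfolding V_def shape_sq0 sum_distrib_right by (simp add: sum_distrib_left mult_ac)
    also have "\<dots> = (\<Sigma> k. \<Sigma> i. \<Sigma> j. (pd i u 0 * a k j) * (pd k u 0 * a i j))"
      by (intro sum.cong refl) (metis codazzi)
    also have "\<dots> = (\<Sigma> k. \<Sigma> j. pd k u 0 * a k j * (\<Sigma> i. pd i u 0 * a i j))"
      by (rule sum.cong[OF refl], subst sum.swap) (simp add: sum_distrib_left mult_ac)
    also have "\<dots> = (\<Sigma> j. \<Sigma> k. pd k u 0 * a k j * (\<Sigma> i. pd i u 0 * a i j))"
      by (rule sum.swap)
    also have "\<dots> = (\<Sigma> j. (tr * pd j u 0) * (tr * pd j u 0))"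
      by (simp only: sum_distrib_right[symmetric] tr)
    also have "\<dots> = V * (tr * tr)" by (simp add: V_def sum_distrib_left sum_distrib_right mult_ac)
    also have "tr * tr = u 0 * u 0" unfolding tr_def by (rule trace_a_sq)
    finally have "shape_sq B f N 0 = u 0 * u 0" using \<open>V > 0\<close> by simp
    then have "?w 0 = 1" using u_nz[OF zero_in] by (simp add: pinching_def)
    then show ?thesis using const[OF zero_in] by simp
  qed simp
qed

lemma height_umbilic0:
  assumes "e = 1" "shape_sq B f N 0 = 1" "u 0 * u 0 = real CARD('m)" "\<And>k. pd k u 0 = 0"
  shows "height 0 = real CARD('m)"
proof -
  \<comment> \<open>The only possible factor of an umbilic \<open>a\<close> with trace
    \<open>u 0\<close>. The squared distance of \<open>a\<close> from \<open>c\<close> times the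
    metric is \<open>1 + c^2 m - 2 c u\<close>, which is \<open>1 + 1 - 2\<close>. Then
    \<open>D_u0_a\<close> with vanishing gradient of \<open>u\<close> forces the tangential position
    to vanish.\<close>
  define c where "c = u 0 / real CARD('m)"
  have c: "c * c * real CARD('m) = 1" "c * u 0 = 1" "c \<noteq> 0"
    using assms(3) u_nz[OF zero_in] by (auto simp: c_def field_simps)
  have "(\<Sigma> i. \<Sigma> j. (a i j - (if i = j then c else 0))\<^sup>2)
      = (\<Sigma> i. \<Sigma> j. a i j * a i j + (if i = j then c * c - 2 * c * a i i else 0))"
    by (intro sum.cong refl) (simp add: power2_eq_square algebra_simps)
  also have "\<dots> = 1 + c * c * real CARD('m) - 2 * c * (\<Sigma> i. a i i)"
    using assms(2) by (simp add: sum.distrib sum_subtractf shape_sq0 sum_distrib_left mult.commute)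
  also have "\<dots> = 0" using c by (simp add: trace_a assms(1))
  finally have "(a i j - (if i = j then c else 0))\<^sup>2 = 0" for i j
    by (simp add: sum_nonneg_eq_0_iff sum_nonneg)
  then have a: "a i j = (if i = j then c else 0)" for i j by simp
  have "c * \<theta> j = 0" for j
    using D_u0_a[of j] assms(4) by (simp add: a if_distrib[of "\<lambda>c. c * _"] cong: if_cong)
  then have "\<theta> j = 0" for j using c by simp
  then have "f 0 = - (u 0 *\<^sub>R N 0)" using position0 by (simp add: eq_neg_iff_add_eq_0)
  then show ?thesis by (simp add: B.minus_left B.minus_right B.scaleR_left B.scaleR_right N0 assms)
qed

end

section \<open>Consequences at arbitrary points of a patch\<close>

context shrinker_patch
begin

lemma pinching_reparametrize:
  fixes P :: "real^'m \<Rightarrow> real^'m"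
  assumes "open T" "smooth_on P T" "P ` T \<subseteq> S" "\<And>x. x \<in> T \<Longrightarrow> inj (\<lambda>v. D v P x)" "x \<in> T"
  shows "pinching B (\<lambda>x. f (P x)) (\<lambda>x. N (P x)) (\<lambda>x. u (P x)) x = pinching B f N u (P x)"
  using shape_sq_reparametrize[OF assms] by (simp add: pinching_def)

lemma height_max_length:
  assumes x: "x \<in> S" and "\<And>y. y \<in> S \<Longrightarrow> B (f y) (f y) \<le> B (f x) (f x)"
  shows "real CARD('m) \<le> u x * u x * e"
proof -
  obtain P T where nc: "normal_chart x P T" using normal_chart_exists[OF x] by blast
  note P = normal_chartD[OF nc]
  interpret P: normal_patch B "\<lambda>y. f (P y)" "\<lambda>y. N (P y)" "\<lambda>y. u (P y)" e T by (rule P(7))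
  show ?thesis using P.height_max_length0(2) assms(2) P(4,5) by (simp add: image_subset_iff)
qed

lemma height_max_pinching:
  assumes x: "x \<in> S" and "\<And>y. y \<in> S \<Longrightarrow> B (f y) (f y) \<le> B (f x) (f x)" and "CARD('m) \<noteq> 1"
  shows "pinching B f N u x < 1"
proof -
  obtain P T where nc: "normal_chart x P T" using normal_chart_exists[OF x] by blast
  note P = normal_chartD[OF nc]
  interpret P: normal_patch B "\<lambda>y. f (P y)" "\<lambda>y. N (P y)" "\<lambda>y. u (P y)" e T by (rule P(7))
  show ?thesis
    using P.height_max_pinching0 assms(2,3) P(4,5) pinching_reparametrize[OF P(1,3,4,6,2)]
    by (simp add: image_subset_iff)
qed

lemma height_min_length:
  assumes x: "x \<in> S" and "\<And>y. y \<in> S \<Longrightarrow> B (f x) (f x) \<le> B (f y) (f y)"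
  shows "u x * u x * e \<le> real CARD('m)"
proof -
  obtain P T where nc: "normal_chart x P T" using normal_chart_exists[OF x] by blast
  note P = normal_chartD[OF nc]
  interpret P: normal_patch B "\<lambda>y. f (P y)" "\<lambda>y. N (P y)" "\<lambda>y. u (P y)" e T by (rule P(7))
  show ?thesis using P.height_min_length0 assms(2) P(4,5) by (simp add: image_subset_iff)
qed

lemma surj_D_u:
  fixes P :: "real^'m \<Rightarrow> real^'m"
  assumes "P differentiable (at y)" "inj (\<lambda>v. D v P y)" "P y \<in> S"
  shows "(\<forall>k. pd k (\<lambda>y. u (P y)) y = 0) \<longleftrightarrow> (\<forall>v. D v u (P y) = 0)"
proof -
  have eq: "D v (\<lambda>y. u (P y)) y = D (D v P y) u (P y)" for v
    by (rule D_compose[OF assms(1) u_diff[OF assms(3)]])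
  have "surj (\<lambda>v. D v P y)"
    using linear_injective_imp_surjective[OF linear_D[OF assms(1)] assms(2)] by simp
  then have "D v u (P y) = 0" if "\<forall>v. D v (\<lambda>y. u (P y)) y = 0" for v
    using that unfolding eq by (elim surjE[of _ v]) simp
  then have "(\<forall>v. D v u (P y) = 0) \<longleftrightarrow> (\<forall>v. D v (\<lambda>y. u (P y)) y = 0)"
    unfolding eq by blast
  moreover have "(\<lambda>y. u (P y)) differentiable (at y)"
    using assms(1) u_diff[OF assms(3)] by (rule differentiable_compose[rotated])
  then have "D v (\<lambda>y. u (P y)) y = 0" if "\<forall>k. pd k (\<lambda>y. u (P y)) y = 0" for v
    using D_expand_cart[of "\<lambda>y. u (P y)" y v] that by simp
  ultimately show ?thesis by blast
qed

lemma pinching_const: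
  assumes x: "x \<in> S" and const: "\<And>y. y \<in> S \<Longrightarrow> pinching B f N u y = w0" and "w0 \<noteq> 1"
  shows "D v u x = 0"
proof -
  obtain P T where nc: "normal_chart x P T" using normal_chart_exists[OF x] by blast
  note P = normal_chartD[OF nc]
  interpret P: normal_patch B "\<lambda>y. f (P y)" "\<lambda>y. N (P y)" "\<lambda>y. u (P y)" e T by (rule P(7))
  have "\<forall>k. pd k (\<lambda>y. u (P y)) 0 = 0"
    using P.pinching_const0[of w0] pinching_reparametrize[OF P(1,3,4,6)] const P(4) assms(3)
    by (simp add: image_subset_iff)
  then show ?thesis
    using surj_D_u[OF smooth_diff[OF P(3,2)] P(6)[OF P(2)]] P(5) x by simp
qed

lemma shape_sq_const:
  assumes x: "x \<in> S" and const: "\<And>y v. y \<in> S \<Longrightarrow> D v u y = 0"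
  shows "e * shape_sq B f N x = 1"
proof -
  have "pd k (pd l u) x = 0" for k l
    using D_cong[OF open_S x const, where v = "axis k 1"] by (simp add: D_const)
  then have "drift_laplacian B f u x = 0"
    by (simp add: drift_laplacian_def metric_laplacian_def const[OF x])
  then show ?thesis using drift_laplacian_u[OF x] u_nz[OF x] by simp
qed

lemma height_umbilic:
  assumes x: "x \<in> S" and "e = 1" "shape_sq B f N x = 1" "u x * u x = real CARD('m)" "\<And>v. D v u x = 0"
  shows "B (f x) (f x) = real CARD('m)"
proof -
  obtain P T where nc: "normal_chart x P T" using normal_chart_exists[OF x] by blast
  note P = normal_chartD[OF nc]
  interpret P: normal_patch B "\<lambda>y. f (P y)" "\<lambda>y. N (P y)" "\<lambda>y. u (P y)" e T by (rule P(7))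
  show ?thesis
    using P.height_umbilic0 assms(2-5) shape_sq_reparametrize[OF P(1,3,4,6,2)]
      surj_D_u[OF smooth_diff[OF P(3,2)] P(6)[OF P(2)]] P(5) x by simp
qed

text \<open>The gradient term is linear in the derivative of the quotient, with coefficients built
  from \<open>u\<close>; it is absorbed into the first-order part so that the strong maximum
  principle applies.\<close>

lemma pinching_subsolution:
  assumes x: "x \<in> S"
  shows "0 \<le> elliptic_op (inv_metric B f)
    (\<lambda>x k. 2 / u x * (\<Sigma> l. inv_metric B f x k l * pd l u x) - shrinker_drift B f k x) (pinching B f N u) x"
proof -
  obtain P T where nc: "normal_chart x P T" using normal_chart_exists[OF x] by blast
  note P = normal_chartD[OF nc]
  interpret P: normal_patch B "\<lambda>y. f (P y)" "\<lambda>y. N (P y)" "\<lambda>y. u (P y)" e T by (rule P(7))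
  let ?w = "pinching B f N u" and ?w' = "pinching B (\<lambda>y. f (P y)) (\<lambda>y. N (P y)) (\<lambda>y. u (P y))"
  have "0 \<le> (u x)^4 * (drift_laplacian B (\<lambda>y. f (P y)) ?w' 0 + 2 / u x * grad_prod B (\<lambda>y. f (P y)) ?w' (\<lambda>y. u (P y)) 0)"
    using P.drift_laplacian_pinching0 P(5) by (simp add: sum_nonneg)
  moreover have "0 < (u x)^4" using u_nz[OF x] by simp
  ultimately have nonneg: "0 \<le> drift_laplacian B (\<lambda>y. f (P y)) ?w' 0 + 2 / u x * grad_prod B (\<lambda>y. f (P y)) ?w' (\<lambda>y. u (P y)) 0"
    by (metis zero_le_mult_iff less_le_not_le)
  \<comment> \<open>The two functions are identified on \<open>T\<close> only, so their derivatives
    at 0 are compared by locality.\<close>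
  have w': "?w' y = ?w (P y)" if "y \<in> T" for y by (rule pinching_reparametrize[OF P(1,3,4,6) that])
  have "drift_laplacian B (\<lambda>y. f (P y)) ?w' 0 = drift_laplacian B (\<lambda>y. f (P y)) (\<lambda>y. ?w (P y)) 0"
    by (simp only: P.drift_laplacian0 D2_cong[OF P(1,2) w'] D_cong[OF P(1,2) w'])
  also have "\<dots> = drift_laplacian B f ?w x"
    using drift_laplacian_reparametrize[OF P(1,3,4,6,2) smooth_pinching] by (simp add: P(5))
  finally have 1: "drift_laplacian B (\<lambda>y. f (P y)) ?w' 0 = drift_laplacian B f ?w x" .
  have "grad_prod B (\<lambda>y. f (P y)) ?w' (\<lambda>y. u (P y)) 0 = grad_prod B (\<lambda>y. f (P y)) (\<lambda>y. ?w (P y)) (\<lambda>y. u (P y)) 0"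
    by (simp only: P.grad_prod0 D_cong[OF P(1,2) w'])
  also have "\<dots> = grad_prod B f ?w u x"
    using grad_prod_reparametrize[OF P(1,3,4,6,2) smooth_pinching smooth_u] by (simp add: P(5))
  finally have 2: "grad_prod B (\<lambda>y. f (P y)) ?w' (\<lambda>y. u (P y)) 0 = grad_prod B f ?w u x" .
  have "0 \<le> drift_laplacian B f ?w x + 2 / u x * grad_prod B f ?w u x"
    using nonneg unfolding 1 2 .
  also have "\<dots> = elliptic_op (inv_metric B f)
    (\<lambda>x k. 2 / u x * (\<Sigma> l. inv_metric B f x k l * pd l u x) - shrinker_drift B f k x) ?w x"
    by (simp add: drift_laplacian_def metric_laplacian_def grad_prod_def elliptic_op_def sum_distrib_left sum_distrib_right
        right_diff_distrib left_diff_distrib sum_subtractf mult_ac)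
  finally show ?thesis .
qed

lemma inv_metric_pos:
  assumes x: "x \<in> S" and "y \<noteq> 0"
  shows "0 < (\<Sigma> k. \<Sigma> l. inv_metric B f x k l * (y $ k * y $ l))"
proof -
  obtain E :: "'m \<Rightarrow> real^'m" where E: "\<And>i j. B (D (E i) f x) (D (E j) f x) = (if i = j then 1 else 0)"
    using frame_exists[OF x] by blast
  have "(\<Sigma> k. \<Sigma> l. inv_metric B f x k l *\<^sub>R ((\<lambda>v w. (v \<bullet> y) * (w \<bullet> y)) (axis k 1) (axis l 1)))
      = (\<Sigma> i. (E i \<bullet> y) * (E i \<bullet> y))"
  proof (rule frame_trace[OF _ inv_metric_frame[OF x E]])
    show "(v \<bullet> y) * (w \<bullet> y) = (\<Sigma> k. \<Sigma> l. (v $ k * w $ l) *\<^sub>R ((axis k 1 \<bullet> y) * (axis l 1 \<bullet> y)))" for v w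
      by (simp add: inner_vec_def[of v] inner_vec_def[of w] sum_product inner_axis' mult_ac)
  qed
  then have eq: "(\<Sigma> k. \<Sigma> l. inv_metric B f x k l * (y $ k * y $ l)) = (\<Sigma> i. (E i \<bullet> y) * (E i \<bullet> y))"
    by (simp add: inner_axis')
  have "\<exists>i. E i \<bullet> y \<noteq> 0"
  proof (rule ccontr)
    assume none: "\<not> (\<exists>i. E i \<bullet> y \<noteq> 0)"
    have "y \<bullet> y = (\<Sigma> i. B (D (E i) f x) (D y f x) *\<^sub>R E i) \<bullet> y"
      using frame_matrix(3)[OF pullback_bilinear[OF x] E, of y] by simp
    then have "y \<bullet> y = 0" using none by (simp add: inner_sum_left)
    with assms(2) show False by simp
  qed
  then obtain i where "0 < (E i \<bullet> y) * (E i \<bullet> y)" by (auto simp: zero_less_mult_iff linorder_neq_iff)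
  then show ?thesis unfolding eq by (intro sum_pos2[of _ i]) auto
qed

lemma pinching_strong_max:
  assumes x0: "x0 \<in> S" and max: "\<And>y. y \<in> S \<Longrightarrow> pinching B f N u y \<le> pinching B f N u x0"
  obtains r where "r > 0" "ball x0 r \<subseteq> S" "\<And>y. y \<in> ball x0 r \<Longrightarrow> pinching B f N u y = pinching B f N u x0"
proof -
  obtain R where R: "R > 0" "cball x0 R \<subseteq> S" using open_S x0 open_contains_cball by blast
  have const: "pinching B f N u y = pinching B f N u x0" if "y \<in> ball x0 (R / 2)" for y
  proof (rule strong_maximum_principle[OF open_S _ _ _ _ smooth_pinching pinching_subsolution R _ that])
    show "continuous_on S (\<lambda>x. inv_metric B f x k l)" for k l
      by (rule smooth_on_continuous[OF smooth_inv_metric])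
    show "continuous_on S (\<lambda>x. 2 / u x * (\<Sigma> l. inv_metric B f x k l * pd l u x) - shrinker_drift B f k x)" for k
      by (intro continuous_intros smooth_on_continuous smooth_inv_metric smooth_on_D smooth_shrinker_drift smooth_u) (simp add: u_nz)
    show "\<exists>E::'m \<Rightarrow> real^'m. \<forall>k l. inv_metric B f x k l = (\<Sigma> i. E i $ k * E i $ l)" if x: "x \<in> S" for x
    proof -
      obtain E :: "'m \<Rightarrow> real^'m" where "\<And>i j. B (D (E i) f x) (D (E j) f x) = (if i = j then 1 else 0)"
        using frame_exists[OF x] by blast
      from inv_metric_frame[OF x this] show ?thesis by blast
    qed
    show "0 < (\<Sigma> k. \<Sigma> l. inv_metric B f x k l * (y $ k * y $ l))" if "x \<in> S" "y \<noteq> 0" for x y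
      by (rule inv_metric_pos[OF that])
    show "pinching B f N u x \<le> pinching B f N u x0" if "x \<in> cball x0 R" for x
      using that R(2) by (intro max) blast
  qed
  have "ball x0 (R / 2) \<subseteq> S"
  proof -
    have "ball x0 (R / 2) \<subseteq> cball x0 R"
    proof
      fix y assume "y \<in> ball x0 (R / 2)"
      then show "y \<in> cball x0 R" using R(1) unfolding mem_ball mem_cball by linarith
    qed
    then show ?thesis using R(2) by (rule subset_trans)
  qed
  moreover have "R / 2 > 0" using R(1) by simp
  ultimately show ?thesis using const by (intro that)
qed

end

section \<open>Projections and the mean curvature vector\<close>

text \<open>The third assumption is nondegeneracy on \<open>T\<close> alone, so the lemma serves the
  tangent space of the immersion as well as that of the hyperquadric.\<close>

lemma tangential_part_eq:
  assumes "bilinear B" "subspace T" "\<And>Z. Z \<in> T \<Longrightarrow> (\<And>W. W \<in> T \<Longrightarrow> B Z W = 0) \<Longrightarrow> Z = 0"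
    and "Y \<in> T" "\<And>Z. Z \<in> T \<Longrightarrow> B (X - Y) Z = 0"
  shows "tangential_part B T X = Y"
  unfolding tangential_part_def
proof (rule the_equality)
  show "Y \<in> T \<and> (\<forall>Z\<in>T. B (X - Y) Z = 0)" using assms(4,5) by blast
next
  fix Y' assume Y': "Y' \<in> T \<and> (\<forall>Z\<in>T. B (X - Y') Z = 0)"
  have "B (Y' - Y) W = 0" if "W \<in> T" for W
    using assms(5)[OF that] Y' that
    by (simp add: bilinear_lsub[OF assms(1)])
  then have "Y' - Y = 0" using Y' assms(2,4) by (intro assms(3)) (auto intro: subspace_diff)
  then show "Y' = Y" by simp
qed

context spacelike_patch
begin

lemma tangent_space_D: "tangent_space f x = range (\<lambda>v. D v f x)"
  by (simp add: tangent_space_def D_def)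

lemma subspace_tangent_space: "x \<in> S \<Longrightarrow> subspace (tangent_space f x)"
  unfolding tangent_space_D by (rule linear_subspace_image[OF linear_D[OF f_diff] subspace_UNIV])

lemma tangential_part_unique:
  assumes "x \<in> S" "Y \<in> tangent_space f x" "\<And>v. B (X - Y) (D v f x) = 0"
  shows "tangential_part B (tangent_space f x) X = Y"
proof (rule tangential_part_eq[OF bilin subspace_tangent_space[OF assms(1)]])
  fix Z assume Z: "Z \<in> tangent_space f x" "\<And>W. W \<in> tangent_space f x \<Longrightarrow> B Z W = 0"
  then obtain v where v: "Z = D v f x" by (auto simp: tangent_space_D)
  then have "v = 0" using Z spacelike[OF assms(1), of v] by force
  then show "Z = 0" using v linear_0[OF linear_D[OF f_diff[OF assms(1)]]] by simp
qed (use assms in \<open>auto simp: tangent_space_D\<close>)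

lemma tangent_coord_inner:
  assumes "x \<in> S"
  shows "B (\<Sigma> k. tangent_coord B f X k x *\<^sub>R pd k f x) (D v f x) = B (X x) (D v f x)"
proof -
  let ?Y = "\<Sigma> k. tangent_coord B f X k x *\<^sub>R pd k f x"
  have pd: "B ?Y (pd l f x) = B (X x) (pd l f x)" for l
  proof -
    have "B ?Y (pd l f x) = (\<Sigma> k. \<Sigma> j. B (X x) (pd j f x) * (inv_metric B f x k j * B (pd k f x) (pd l f x)))"
      by (simp add: B.sum_left B.scaleR_left tangent_coord_def sum_distrib_left sum_distrib_right mult_ac)
    also have "\<dots> = (\<Sigma> j. B (X x) (pd j f x) * (\<Sigma> k. inv_metric B f x j k * B (pd k f x) (pd l f x)))"
      by (subst sum.swap) (simp add: sum_distrib_left inv_metric_sym[OF assms])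
    also have "\<dots> = B (X x) (pd l f x)"
      by (simp add: metric_inverse[OF assms] if_distrib[of "(*) _"] cong: if_cong)
    finally show ?thesis .
  qed
  show ?thesis
    unfolding D_expand_cart[OF f_diff[OF assms], of v] by (simp only: B.sum_right B.scaleR_right pd)
qed

lemma tangential_part_coord:
  assumes "x \<in> S"
  shows "tangential_part B (tangent_space f x) (X x) = (\<Sigma> k. tangent_coord B f X k x *\<^sub>R pd k f x)"
proof (rule tangential_part_unique[OF assms])
  show "(\<Sigma> k. tangent_coord B f X k x *\<^sub>R pd k f x) \<in> tangent_space f x"
    by (intro subspace_sum subspace_scale subspace_tangent_space[OF assms]) (simp add: tangent_space_D)
qed (simp add: B.diff_left tangent_coord_inner[OF assms])

lemma normal_part_coord:
  assumes "x \<in> S"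
  shows "normal_part B (tangent_space f x) (X x) = X x - (\<Sigma> k. tangent_coord B f X k x *\<^sub>R pd k f x)"
  unfolding normal_part_def tangential_part_coord[OF assms] ..

lemma tangential_part_spec:
  assumes "x \<in> S"
  shows "tangential_part B (tangent_space f x) X \<in> tangent_space f x"
    and "B (X - tangential_part B (tangent_space f x) X) (D v f x) = 0"
  unfolding tangential_part_coord[OF assms, of "\<lambda>_. X"]
  by (intro subspace_sum subspace_scale subspace_tangent_space[OF assms])
     (simp_all add: tangent_space_D B.diff_left tangent_coord_inner[OF assms])

lemma normal_part_normal: "x \<in> S \<Longrightarrow> B (normal_part B (tangent_space f x) X) (D v f x) = 0"
  unfolding normal_part_def by (rule tangential_part_spec(2))

lemma normal_part_diff_tangent: "x \<in> S \<Longrightarrow> X - normal_part B (tangent_space f x) X \<in> range (\<lambda>v. D v f x)"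
  using tangential_part_spec(1) by (simp add: normal_part_def tangent_space_D)

lemma normal_part_of_normal:
  assumes "x \<in> S" "\<And>v. B X (D v f x) = 0"
  shows "normal_part B (tangent_space f x) X = X"
  using tangential_part_unique[OF assms(1), of 0 X] subspace_0[OF subspace_tangent_space[OF assms(1)]] assms(2)
  by (simp add: normal_part_def)

lemma normal_part_of_tangent:
  assumes "x \<in> S" "X \<in> range (\<lambda>v. D v f x)"
  shows "normal_part B (tangent_space f x) X = 0"
  using tangential_part_unique[OF assms(1), of X X] assms(2)
  by (simp add: normal_part_def tangent_space_D B.zero_left)

lemma linear_normal_part:
  assumes "x \<in> S"
  shows "linear (normal_part B (tangent_space f x))"
proof -
  let ?t = "tangential_part B (tangent_space f x)"
  note sub = subspace_tangent_space[OF assms] and spec = tangential_part_spec[OF assms]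
  have add: "?t (X + Y) = ?t X + ?t Y" for X Y
  proof (rule tangential_part_unique[OF assms])
    show "?t X + ?t Y \<in> tangent_space f x" by (intro subspace_add[OF sub] spec)
    have "X + Y - (?t X + ?t Y) = (X - ?t X) + (Y - ?t Y)" by simp
    then show "B (X + Y - (?t X + ?t Y)) (D v f x) = 0" for v
      using spec(2)[of X v] spec(2)[of Y v] by (simp only: B.add_left)
  qed
  have scale: "?t (c *\<^sub>R X) = c *\<^sub>R ?t X" for c X
  proof (rule tangential_part_unique[OF assms])
    show "c *\<^sub>R ?t X \<in> tangent_space f x" by (intro subspace_scale[OF sub] spec)
    show "B (c *\<^sub>R X - c *\<^sub>R ?t X) (D v f x) = 0" for v
      using spec(2)[of X v] by (simp add: B.diff_left B.scaleR_left)
  qed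
  show ?thesis by (rule linearI) (simp_all add: normal_part_def add scale scaleR_diff_right)
qed

lemma smooth_normal_part:
  assumes "smooth_on X S"
  shows "smooth_on (\<lambda>x. normal_part B (tangent_space f x) (X x)) S"
proof (rule smooth_on_cong[OF open_S])
  show "smooth_on (\<lambda>x. X x - (\<Sigma> k. tangent_coord B f X k x *\<^sub>R pd k f x)) S"
    by (intro smooth_on_diff smooth_on_sum smooth_on_scaleR smooth_tangent_coord smooth_on_D smooth_f assms open_S finite)
qed (simp add: normal_part_coord)

lemma second_derivative_D: "second_derivative f x v w = D v (D w f) x"
  by (simp add: second_derivative_def D_def[abs_def])

lemma metric_trace_normal_part:
  assumes "x \<in> S"
  shows "metric_trace (induced_metric B f x) (\<lambda>v w. normal_part B (tangent_space f x) (h v w))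
    = normal_part B (tangent_space f x) (metric_trace (induced_metric B f x) h)"
  by (simp add: metric_trace_def linear_sum[OF linear_normal_part[OF assms]] linear_cmul[OF linear_normal_part[OF assms]])

lemma mean_curvature_laplacian:
  assumes "x \<in> S"
  shows "mean_curvature B f x = normal_part B (tangent_space f x) (metric_laplacian B f f x)"
  unfolding mean_curvature_def second_fundamental_form_def[abs_def] metric_trace_normal_part[OF assms]
  by (simp add: metric_trace_def metric_laplacian_def inv_metric_def second_derivative_D)

text \<open>The set \<open>T\<close> collects the points where the squared norm of the mean
  curvature vector has the same sign \<open>e\<close> as at \<open>x0\<close>. There its absolute
  value is \<open>e\<close> times it, so its square root \<open>u\<close> and the principal normal
  are smooth.\<close>

lemma shrinker_patch_exists:
  assumes H: "\<And>x. x \<in> S \<Longrightarrow> mean_curvature B f x = - normal_part B (tangent_space f x) (f x)"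
    and nonnull: "\<And>x. x \<in> S \<Longrightarrow> sqnorm B (mean_curvature B f x) \<noteq> 0"
    and par: "\<And>x v. x \<in> S \<Longrightarrow> normal_derivative B f (principal_normal B f) x v = 0"
    and x0: "x0 \<in> S"
  obtains e T where "x0 \<in> T" "T \<subseteq> S"
    "shrinker_patch B f (principal_normal B f) (\<lambda>x. sqrt \<bar>sqnorm B (mean_curvature B f x)\<bar>) e T"
proof -
  define h where "h = mean_curvature B f"
  define q where "q x = B (h x) (h x)" for x
  define e where "e = sgn (q x0)"
  define T where "T = {x \<in> S. 0 < e * q x}"
  have q: "sqnorm B (mean_curvature B f x) = q x" for x by (simp add: sqnorm_def q_def h_def)
  have qnz: "q x \<noteq> 0" if "x \<in> S" for x using nonnull[OF that] by (simp add: q)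
  have e: "e * e = 1" "e = 1 \<or> e = - 1" using qnz[OF x0] by (auto simp: e_def sgn_if)
  have smooth_h: "smooth_on h S"
  proof (rule smooth_on_cong[OF open_S])
    show "smooth_on (\<lambda>x. - normal_part B (tangent_space f x) (f x)) S"
      by (intro smooth_on_minus smooth_normal_part smooth_f open_S)
  qed (simp add: h_def H)
  have smooth_q: "smooth_on q S"
    unfolding q_def[abs_def] by (intro smooth_B smooth_h)
  have "open T"
  proof -
    have "continuous_on S (\<lambda>x. e * q x)" by (intro continuous_intros smooth_on_continuous smooth_q)
    from continuous_open_preimage[OF this open_S open_greaterThan[of 0]]
    have "open (S \<inter> (\<lambda>x. e * q x) -` {0<..})" .
    also have "S \<inter> (\<lambda>x. e * q x) -` {0<..} = T" by (auto simp: T_def)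
    finally show ?thesis .
  qed
  have TS: "T \<subseteq> S" by (auto simp: T_def)
  have "x0 \<in> T" using x0 qnz[OF x0] by (auto simp: T_def e_def sgn_if)
  have abs_q: "\<bar>q x\<bar> = e * q x" if "x \<in> T" for x using that e(2) by (auto simp: T_def)
  define u where "u x = sqrt \<bar>q x\<bar>" for x
  define N where "N x = h x /\<^sub>R u x" for x
  have u_pos: "u x > 0" if "x \<in> T" for x using qnz that TS by (auto simp: u_def)
  have smooth_u: "smooth_on u T"
  proof (rule smooth_on_cong[OF \<open>open T\<close>])
    show "smooth_on (\<lambda>x. sqrt (e * q x)) T"
      using smooth_on_subset[OF smooth_q TS]
      by (intro smooth_on_sqrt smooth_on_mult smooth_on_const \<open>open T\<close>) (auto simp: T_def)
  qed (simp add: u_def abs_q)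
  have smooth_N: "smooth_on N T"
    unfolding N_def[abs_def]
    by (intro smooth_on_scaleR smooth_on_inverse \<open>open T\<close> smooth_on_subset[OF smooth_h TS] smooth_u)
       (auto dest: u_pos)
  have uN: "u x *\<^sub>R N x = h x" if "x \<in> T" for x using u_pos[OF that] by (simp add: N_def)
  have pn: "principal_normal B f = N" by (rule ext) (simp add: principal_normal_def N_def u_def q h_def)
  have len: "(\<lambda>x. sqrt \<bar>sqnorm B (mean_curvature B f x)\<bar>) = u" by (rule ext) (simp add: u_def q)
  have h_normal: "B (h x) (D v f x) = 0" if "x \<in> S" for x v
    by (simp add: h_def H[OF that] B.minus_left normal_part_normal[OF that])
  have "shrinker_patch B f N u e T"
  proof
    fix x and E :: "'m \<Rightarrow> real^'m"
    assume x: "x \<in> T" and E: "\<And>i j. B (D (E i) f x) (D (E j) f x) = (if i = j then 1 else 0)"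
    have xS: "x \<in> S" using x TS by auto
    have "normal_part B (tangent_space f x) (metric_laplacian B f f x + f x) = 0"
      unfolding linear_add[OF linear_normal_part[OF xS]] mean_curvature_laplacian[OF xS, symmetric] H[OF xS] by simp
    with normal_part_diff_tangent[OF xS, of "metric_laplacian B f f x + f x"]
    show "(\<Sigma> i. D (E i) (D (E i) f) x) + f x \<in> range (\<lambda>v. D v f x)"
      by (simp add: laplacian_frame[OF xS E smooth_f])
  next
    fix x v assume x: "x \<in> T"
    then have xS: "x \<in> S" using TS by auto
    show "B (N x) (D v f x) = 0" by (simp add: N_def B.scaleR_left h_normal[OF xS])
    have "u x * u x = e * q x" using abs_q[OF x] by (simp add: u_def)
    then have "q x = e * (u x * u x)" using e(1) by (simp flip: mult.assoc)
    moreover have "B (N x) (N x) = inverse (u x) * (inverse (u x) * q x)"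
      by (simp add: N_def B.scaleR_left B.scaleR_right q_def)
    ultimately show "B (N x) (N x) = e" using u_pos[OF x] by (simp add: field_simps)
    show "f x + u x *\<^sub>R N x \<in> range (\<lambda>v. D v f x)"
      using normal_part_diff_tangent[OF xS, of "f x"] by (simp add: uN[OF x] h_def H[OF xS])
    have "normal_part B (tangent_space f x) (D v N x) = 0"
      using par[OF xS, of v] by (simp add: normal_derivative_def pn D_def)
    then show "D v N x \<in> range (\<lambda>v. D v f x)"
      using normal_part_diff_tangent[OF xS, of "D v N x"] by simp
    show "u x \<noteq> 0" using u_pos[OF x] by simp
    show "0 < B (D v f x) (D v f x)" if "v \<noteq> 0" using spacelike[OF xS that] .
  qed (fact bilin B_sym \<open>open T\<close> smooth_on_subset[OF smooth_f TS] smooth_N smooth_u e(1))+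
  then show ?thesis using \<open>x0 \<in> T\<close> TS by (intro that[of T e]) (simp_all add: pn len)
qed

subsection \<open>Immersions with image in a hyperquadric\<close>

context
  fixes \<kappa> :: real
  assumes quadric: "\<And>x. x \<in> S \<Longrightarrow> B (f x) (f x) = \<kappa>"
begin

lemma quadric_normal: "x \<in> S \<Longrightarrow> B (f x) (D v f x) = 0"
proof -
  assume x: "x \<in> S"
  have "D v (\<lambda>x. B (f x) (f x)) x = D v (\<lambda>x. \<kappa>) x" by (rule D_cong[OF open_S x quadric])
  then show ?thesis
    using D_bilinear[OF B.bounded_bilinear_axioms f_diff[OF x] f_diff[OF x], of v] B_sym[of "D v f x"] by (simp add: D_const)
qed

lemma quadric_normal_part: "x \<in> S \<Longrightarrow> normal_part B (tangent_space f x) (f x) = f x"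
  by (rule normal_part_of_normal) (simp_all add: quadric_normal)

lemma quadric_second: "x \<in> S \<Longrightarrow> B (f x) (D v (D w f) x) = - B (D v f x) (D w f x)"
proof -
  assume x: "x \<in> S"
  have "D v (\<lambda>x. B (f x) (D w f x)) x = D v (\<lambda>x. 0) x" by (rule D_cong[OF open_S x]) (rule quadric_normal)
  then show ?thesis
    using D_bilinear[OF B.bounded_bilinear_axioms f_diff[OF x] f_diff1[OF x], of v w] by (simp add: D_const)
qed

text \<open>As \<open>\<kappa>\<close> is nonzero, the space splits into the line of
  \<open>f x\<close> and its orthogonal complement. Hence the form stays nondegenerate on the
  complement, and the projection removes a multiple of \<open>f x\<close>.\<close>

lemma quadric_tangential_part:
  assumes nondeg: "nondegenerate_form B" and "\<kappa> \<noteq> 0" and x: "x \<in> S"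
  shows "tangential_part B (hyperquadric_tangent B (f x)) X = X - (B (f x) X / \<kappa>) *\<^sub>R f x"
proof (rule tangential_part_eq[OF bilin])
  let ?T = "hyperquadric_tangent B (f x)"
  show "subspace ?T"
    by (auto simp: subspace_def hyperquadric_tangent_def B.zero_right B.add_right B.scaleR_right)
  show "X - (B (f x) X / \<kappa>) *\<^sub>R f x \<in> ?T"
    using assms(2) by (simp add: hyperquadric_tangent_def B.diff_right B.scaleR_right quadric[OF x])
  show "B (X - (X - (B (f x) X / \<kappa>) *\<^sub>R f x)) Z = 0" if "Z \<in> ?T" for Z
    using that by (simp add: hyperquadric_tangent_def B.scaleR_left)
  fix Z assume Z: "Z \<in> ?T" "\<And>W. W \<in> ?T \<Longrightarrow> B Z W = 0"
  have "B Z Y = 0" for Y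
  proof -
    have "B Z (Y - (B (f x) Y / \<kappa>) *\<^sub>R f x) = 0"
      using assms(2) by (intro Z) (simp add: hyperquadric_tangent_def B.diff_right B.scaleR_right quadric[OF x])
    moreover have "B Z (f x) = 0" using Z(1) B_sym[of Z] by (simp add: hyperquadric_tangent_def)
    ultimately show ?thesis by (simp add: B.diff_right B.scaleR_right)
  qed
  then show "Z = 0" using nondeg by (simp add: nondegenerate_form_def)
qed

text \<open>By \<open>quadric_second\<close> the hyperquadric contributes
  \<open>- g / \<kappa>\<close> times \<open>f\<close> to the second fundamental form. Removing this
  contribution adds the trace \<open>m / \<kappa>\<close> of the metric.\<close>

lemma quadric_mean_curvature:
  fixes E :: "'m \<Rightarrow> real^'m"
  assumes "nondegenerate_form B" and "\<kappa> \<noteq> 0" and x: "x \<in> S"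
  shows "hyperquadric_mean_curvature B f x = mean_curvature B f x + (real CARD('m) / \<kappa>) *\<^sub>R f x"
proof -
  let ?n = "normal_part B (tangent_space f x)"
  have "hyperquadric_second_fundamental_form B f x v w = ?n (second_derivative f x v w) + (B (D v f x) (D w f x) / \<kappa>) *\<^sub>R f x" for v w
    unfolding hyperquadric_second_fundamental_form_def quadric_tangential_part[OF assms]
    by (simp add: linear_add[OF linear_normal_part[OF x]] linear_diff[OF linear_normal_part[OF x]] linear_cmul[OF linear_normal_part[OF x]]
        linear_neg[OF linear_normal_part[OF x]] quadric_normal_part[OF x]
        second_derivative_D quadric_second[OF x])
  then have "hyperquadric_mean_curvature B f x = mean_curvature B f x
      + (\<Sigma> k. \<Sigma> l. (inv_metric B f x k l * B (pd k f x) (pd l f x)) *\<^sub>R (f x /\<^sub>R \<kappa>))"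
    by (simp add: hyperquadric_mean_curvature_def mean_curvature_def metric_trace_def second_fundamental_form_def
        inv_metric_def scaleR_add_right sum.distrib divide_inverse mult_ac)
  also have "(\<Sigma> k. \<Sigma> l. (inv_metric B f x k l * B (pd k f x) (pd l f x)) *\<^sub>R (f x /\<^sub>R \<kappa>))
      = (\<Sigma> k. \<Sigma> l. (inv_metric B f x k l * B (pd l f x) (pd k f x)) *\<^sub>R (f x /\<^sub>R \<kappa>))"
    by (intro sum.cong refl) (subst B_sym, rule refl)
  also have "\<dots> = real CARD('m) *\<^sub>R (f x /\<^sub>R \<kappa>)"
  proof -
    have "(\<Sigma> k. \<Sigma> l. (inv_metric B f x k l * B (pd l f x) (pd k f x)) *\<^sub>R y) = real CARD('m) *\<^sub>R y"
      for y :: "real^'n"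
      using sum_constant_scaleR[of y "UNIV :: 'm set"]
      by (simp add: scaleR_sum_left[symmetric] metric_inverse[OF x])
    then show ?thesis .
  qed
  finally show ?thesis by (simp add: divide_inverse)
qed

end

end

section \<open>Globalization\<close>

lemma (in shrinker_patch) shape_sq_nonneg:
  assumes x: "x \<in> S"
  shows "0 \<le> shape_sq B f N x"
proof -
  obtain E :: "'m \<Rightarrow> real^'m" where E: "\<And>i j. B (D (E i) f x) (D (E j) f x) = (if i = j then 1 else 0)"
    using frame_exists[OF x] by blast
  have "0 \<le> B (D v N x) (D v N x)" for v
  proof -
    obtain w where "D v N x = D w f x" using N_parallel[OF x] by blast
    then show ?thesis
      using spacelike[OF x, of w] linear_0[OF linear_D[OF f_diff[OF x]]] by (cases "w = 0") (auto simp: B.zero_left)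
  qed
  then show ?thesis unfolding shape_sq_frame[OF x E] by (intro sum_nonneg)
qed

lemma pinching_cong:
  assumes "open V" "x \<in> V" "\<And>y. y \<in> V \<Longrightarrow> f y = f' y" "\<And>y. y \<in> V \<Longrightarrow> N y = N' y" "u x = u' x"
  shows "pinching B f N u x = pinching B f' N' u' x"
proof -
  have "induced_metric B f x = induced_metric B f' x"
    using D_cong[OF assms(1-3)] by (simp add: induced_metric_def flip: D_def)
  then have "inv_metric B f x = inv_metric B f' x" by (intro ext) (simp add: inv_metric_def)
  then show ?thesis
    by (simp add: pinching_def shape_sq_def assms(5) D_cong[OF assms(1,2,4)])
qed

locale immersed_shrinker =
  fixes M :: "'a topology" and A :: "('a, 'm::finite) chart set"
    and B :: "real^'n \<Rightarrow> real^'n \<Rightarrow> real" and F :: "'a \<Rightarrow> real^'n"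
  assumes bilin: "bilinear B" and sym: "symmetric_form B" and manifold: "smooth_manifold M A"
    and immersion: "smooth_immersion A F" and spacelike_F: "spacelike A B F"
    and shrinker: "self_shrinker A B F"
begin

section \<open>Charts, and the direction from the hyperquadric to parallel normals\<close>

abbreviation "loc \<equiv> in_chart F"
abbreviation "im c \<equiv> snd c ` fst c"

lemma chart:
  assumes "c \<in> A"
  shows "openin M (fst c)" "open (im c)" "homeomorphic_map (subtopology M (fst c)) (top_of_set (im c)) (snd c)"
  using assms manifold by (auto simp: smooth_manifold_def smooth_atlas_def is_chart_def split_beta)

lemma charts_cover: "topspace M = (\<Union>c\<in>A. fst c)"
  using manifold by (simp add: smooth_manifold_def smooth_atlas_def)

lemma in_topspace: "c \<in> A \<Longrightarrow> p \<in> fst c \<Longrightarrow> p \<in> topspace M"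
  unfolding charts_cover by blast

lemma chart_topspace: "c \<in> A \<Longrightarrow> topspace (subtopology M (fst c)) = fst c"
  using chart(1)[of c] openin_subset by (metis inf.absorb_iff2 topspace_subtopology)

lemma chart_inj: "c \<in> A \<Longrightarrow> inj_on (snd c) (fst c)"
  using homeomorphic_imp_injective_map[OF chart(3)] chart_topspace by metis

lemma chart_inv: "c \<in> A \<Longrightarrow> p \<in> fst c \<Longrightarrow> inv_into (fst c) (snd c) (snd c p) = p"
  using chart_inj by (rule inv_into_f_f)

lemma loc_at: "c \<in> A \<Longrightarrow> p \<in> fst c \<Longrightarrow> loc c (snd c p) = F p"
  by (simp add: in_chart_def split_beta chart_inv)

lemma chart_preimage_open:
  assumes "c \<in> A" "open G"
  shows "openin M {p \<in> fst c. snd c p \<in> G}"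
proof -
  have "openin (top_of_set (im c)) (im c \<inter> G)" using assms(2) by (simp add: openin_open_Int)
  then have "openin (subtopology M (fst c)) {p \<in> topspace (subtopology M (fst c)). snd c p \<in> im c \<inter> G}"
    using homeomorphic_imp_continuous_map[OF chart(3)[OF assms(1)]] openin_continuous_map_preimage by blast
  moreover have "{p \<in> topspace (subtopology M (fst c)). snd c p \<in> im c \<inter> G} = {p \<in> fst c. snd c p \<in> G}"
    using in_topspace[OF assms(1)] by auto
  ultimately show ?thesis using openin_trans_full[OF _ chart(1)[OF assms(1)]] by metis
qed

lemma chart_image_open:
  assumes "c \<in> A" "openin M V" "V \<subseteq> fst c"
  shows "open (snd c ` V)"
proof -
  have "openin (subtopology M (fst c)) V"
    using assms chart(1) openin_open_subtopology by blast
  then have "openin (top_of_set (im c)) (snd c ` V)"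
    using homeomorphic_imp_open_map[OF chart(3)[OF assms(1)]] by (simp add: open_map_def)
  then show ?thesis using chart(2)[OF assms(1)] openin_open_trans by blast
qed

lemma chart_patch: "c \<in> A \<Longrightarrow> spacelike_patch B (loc c) (im c)"
proof
  assume c: "c \<in> A"
  show "smooth_on (loc c) (im c)" using immersion c by (simp add: smooth_immersion_def)
  show "0 < B (D v (loc c) x) (D v (loc c) x)" if "x \<in> im c" "v \<noteq> 0" for x v
    using that spacelike_F c by (auto simp: Defs.spacelike_def sqnorm_def D_def)
qed (use bilin sym chart(2) in \<open>auto simp: symmetric_form_def\<close>)

lemma chart_mean_curvature:
  assumes "c \<in> A" "x \<in> im c"
  shows "mean_curvature B (loc c) x = - normal_part B (tangent_space (loc c) x) (loc c x)"
  using assms shrinker loc_at[OF assms(1)] by (auto simp: self_shrinker_def)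

lemma continuous_map_chartwise:
  fixes h :: "'a \<Rightarrow> real"
  assumes "\<And>c. c \<in> A \<Longrightarrow> continuous_on (im c) (g c)"
    and "\<And>c p. c \<in> A \<Longrightarrow> p \<in> fst c \<Longrightarrow> h p = g c (snd c p)"
  shows "continuous_map M euclideanreal h"
  unfolding continuous_map_def
proof (intro conjI allI impI)
  fix W :: "real set" assume "openin euclideanreal W"
  then have W: "open W" by simp
  have "{p \<in> topspace M. h p \<in> W} = (\<Union>c\<in>A. {p \<in> fst c. snd c p \<in> im c \<inter> g c -` W})"
    using assms(2) by (auto simp: charts_cover)
  moreover have "openin M {p \<in> fst c. snd c p \<in> im c \<inter> g c -` W}" if "c \<in> A" for c
    by (rule chart_preimage_open[OF that continuous_open_preimage[OF assms(1)[OF that] chart(2)[OF that] W]])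
  ultimately show "openin M {p \<in> topspace M. h p \<in> W}" by auto
qed simp

lemma attains_max:
  assumes "compact_space M" "topspace M \<noteq> {}" "continuous_map M euclideanreal h"
  obtains p where "p \<in> topspace M" "\<And>q. q \<in> topspace M \<Longrightarrow> h q \<le> h p"
proof -
  have "compact (h ` topspace M)"
    using image_compactin[OF _ assms(3)] assms(1) by (simp add: compact_space_def)
  then show ?thesis using compact_attains_sup[of "h ` topspace M"] assms(2) that by (metis image_eqI image_iff image_is_empty)
qed

lemma height_continuous: "continuous_map M euclideanreal (\<lambda>p. B (F p) (F p))"
proof (rule continuous_map_chartwise)
  fix c assume c: "c \<in> A"
  interpret spacelike_patch B "loc c" "im c" by (rule chart_patch[OF c])
  show "continuous_on (im c) (\<lambda>x. B (loc c x) (loc c x))"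
    by (rule smooth_on_continuous[OF smooth_B[OF smooth_f smooth_f]])
qed (simp add: loc_at)

text \<open>On the quadric the position vector is normal, so \<open>H = - F\<close> has squared norm
  \<open>m\<close>. The principal normal is \<open>F\<close> times the constant
  \<open>- 1 / sqrt m\<close>, and its derivative is tangent.\<close>

lemma minimal_implies_parallel:
  assumes quadric: "F ` topspace M \<subseteq> hyperquadric B (real CARD('m))"
  shows "mean_curvature_nonnull A B F" "parallel_principal_normal A B F"
proof -
  let ?m = "real CARD('m)"
  have *: "sqnorm B (mean_curvature B (loc c) (snd c p)) = ?m
    \<and> normal_derivative B (loc c) (principal_normal B (loc c)) (snd c p) v = 0"
    if c: "c \<in> A" and p: "p \<in> fst c" for c p v
  proof -
    interpret spacelike_patch B "loc c" "im c" by (rule chart_patch[OF c])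
    have quad: "B (loc c x) (loc c x) = ?m" if "x \<in> im c" for x
      using that quadric in_topspace[OF c] by (auto simp: loc_at[OF c] hyperquadric_def sqnorm_def image_subset_iff)
    have H: "mean_curvature B (loc c) x = - loc c x" if "x \<in> im c" for x
      using chart_mean_curvature[OF c that] quadric_normal_part[OF quad that] by simp
    have x: "snd c p \<in> im c" using p by simp
    have sq: "sqnorm B (- loc c x) = ?m" if "x \<in> im c" for x
      using quad[OF that] by (simp add: sqnorm_def B.minus_left B.minus_right)
    have "D v (principal_normal B (loc c)) (snd c p) = D v (\<lambda>x. (- inverse (sqrt ?m)) *\<^sub>R loc c x) (snd c p)"
      by (rule D_cong[OF open_S x]) (simp add: principal_normal_def sq H)
    also have "\<dots> = (- inverse (sqrt ?m)) *\<^sub>R D v (loc c) (snd c p)"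
      by (simp only: D_scaleR[OF differentiable_const f_diff[OF x]] D_const scaleR_zero_left add_0_right)
    finally have "D v (principal_normal B (loc c)) (snd c p) \<in> range (\<lambda>v. D v (loc c) (snd c p))"
      using linear_cmul[OF linear_D[OF f_diff[OF x]]] by (metis rangeI)
    then show ?thesis
      using normal_part_of_tangent[OF x] sq[OF x] H[OF x] by (simp add: normal_derivative_def D_def)
  qed
  show "mean_curvature_nonnull A B F" unfolding mean_curvature_nonnull_def using * by force
  show "parallel_principal_normal A B F" unfolding parallel_principal_normal_def using * by blast
qed

text \<open>At level \<open>m\<close> the formula of \<open>quadric_mean_curvature\<close> becomes
  \<open>H + F\<close>, which the shrinker equation annihilates as \<open>F\<close> is
  normal.\<close>

lemma quadric_implies_minimal:
  assumes "nondegenerate_form B" and height: "\<And>p. p \<in> topspace M \<Longrightarrow> B (F p) (F p) = real CARD('m)"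
  shows "minimal_in_hyperquadric M A B F (real CARD('m))"
proof -
  have "hyperquadric_mean_curvature B (loc c) (snd c p) = 0" if c: "c \<in> A" and p: "p \<in> fst c" for c p
  proof -
    interpret spacelike_patch B "loc c" "im c" by (rule chart_patch[OF c])
    have quad: "B (loc c x) (loc c x) = real CARD('m)" if "x \<in> im c" for x
      using that height in_topspace[OF c] by (auto simp: loc_at[OF c])
    have x: "snd c p \<in> im c" using p by simp
    show ?thesis
      using quadric_mean_curvature[OF quad assms(1) _ x] chart_mean_curvature[OF c x] quadric_normal_part[OF quad x] by simp
  qed
  then show ?thesis
    using height by (auto simp: minimal_in_hyperquadric_def hyperquadric_def sqnorm_def)
qed

section \<open>The quotient as a function on the manifold, and the direction from parallel normals
  to the hyperquadric\<close>

definition "length_at c x = sqrt \<bar>sqnorm B (mean_curvature B (loc c) x)\<bar>"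
abbreviation "patch_at c \<equiv> shrinker_patch B (loc c) (principal_normal B (loc c)) (length_at c)"
definition "pinch c = pinching B (loc c) (principal_normal B (loc c)) (length_at c)"

context
  assumes nonnull: "mean_curvature_nonnull A B F" and parallel: "parallel_principal_normal A B F"
begin

lemma chart_shrinker_patch:
  assumes c: "c \<in> A" and x: "x \<in> im c"
  obtains e T where "x \<in> T" "T \<subseteq> im c" "patch_at c e T"
proof -
  interpret spacelike_patch B "loc c" "im c" by (rule chart_patch[OF c])
  show ?thesis
  proof (rule shrinker_patch_exists[OF _ _ _ x])
    show "mean_curvature B (loc c) x = - normal_part B (tangent_space (loc c) x) (loc c x)" if "x \<in> im c" for x
      by (rule chart_mean_curvature[OF c that])
    show "sqnorm B (mean_curvature B (loc c) x) \<noteq> 0" if "x \<in> im c" for x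
      using nonnull c that by (auto simp: mean_curvature_nonnull_def)
    show "normal_derivative B (loc c) (principal_normal B (loc c)) x v = 0" if "x \<in> im c" for x v
      using parallel c that by (auto simp: parallel_principal_normal_def)
  qed (rule that, simp_all add: length_at_def[abs_def])
qed

text \<open>The transition map is a change of parameters in the sense of
  \<open>reparametrize\<close>: its differential is injective because that of the immersion read in
  the chart \<open>c\<close> is.\<close>

lemma pinch_transition:
  assumes c: "c \<in> A" and d: "d \<in> A" and p: "p \<in> fst c" "p \<in> fst d"
  shows "pinch c (snd c p) = pinch d (snd d p)"
proof -
  interpret c: spacelike_patch B "loc c" "im c" by (rule chart_patch[OF c])
  have "snd d p \<in> im d" using p by simp
  then obtain e T where T: "snd d p \<in> T" "T \<subseteq> im d"
    and patch: "patch_at d e T"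
    by (rule chart_shrinker_patch[OF d]) blast
  interpret d: shrinker_patch B "loc d" "principal_normal B (loc d)" "length_at d" e T by (rule patch)
  define P where "P = transition c d"
  define V0 where "V0 = snd c ` (fst c \<inter> fst d)"
  define V where "V = V0 \<inter> P -` T"
  have P_at: "P (snd c q) = snd d q" if "q \<in> fst c" for q
    by (simp add: P_def transition_def split_beta chart_inv[OF c that])
  have "open V0"
    unfolding V0_def using chart(1)[OF c] chart(1)[OF d] by (intro chart_image_open[OF c]) auto
  have V0c: "V0 \<subseteq> im c" by (auto simp: V0_def)
  have smooth_P: "smooth_on P V0"
    using manifold c d by (simp add: P_def V0_def smooth_manifold_def smooth_atlas_def)
  have "open V"
    unfolding V_def by (rule continuous_open_preimage[OF smooth_on_continuous[OF smooth_P] \<open>open V0\<close> d.open_S])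
  have PV: "smooth_on P V" by (rule smooth_on_subset[OF smooth_P]) (auto simp: V_def)
  have PT: "P ` V \<subseteq> T" by (auto simp: V_def)
  have x0: "snd c p \<in> V" using p T(1) by (auto simp: V_def V0_def P_at)
  have loc_eq: "loc c x = loc d (P x)" if "x \<in> V" for x
    using that by (auto simp: V_def V0_def P_at loc_at[OF c] loc_at[OF d])
  have Dloc: "D v (loc c) x = D (D v P x) (loc d) (P x)" if x: "x \<in> V" for v x
  proof -
    have "D v (loc c) x = D v (\<lambda>x. loc d (P x)) x" by (rule D_cong[OF \<open>open V\<close> x loc_eq])
    also have "\<dots> = D (D v P x) (loc d) (P x)"
      using x PT by (intro D_compose smooth_diff[OF PV x] d.f_diff) auto
    finally show ?thesis .
  qed
  have inj: "inj (\<lambda>v. D v P x)" if x: "x \<in> V" for x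
  proof (rule injI)
    fix v w assume "D v P x = D w P x"
    then have "D v (loc c) x = D w (loc c) x" by (simp add: Dloc[OF x])
    moreover have "x \<in> im c" using x V0c by (auto simp: V_def)
    ultimately show "v = w" using c.D_f_inj by blast
  qed
  \<comment> \<open>The transformation of the trace is bypassed: on both sides the vector is minus
    the normal part of the same position vector with respect to the same tangent space.\<close>
  have H_eq: "mean_curvature B (loc c) x = mean_curvature B (loc d) (P x)" if x: "x \<in> V" for x
  proof -
    have "surj (\<lambda>v. D v P x)"
      using linear_injective_imp_surjective[OF linear_D[OF smooth_diff[OF PV x]] inj[OF x]] by simp
    then have "range (\<lambda>v. D v (loc d) (P x)) = (\<lambda>v. D v (loc d) (P x)) ` range (\<lambda>v. D v P x)" by simp
    also have "\<dots> = range (\<lambda>v. D v (loc c) x)" by (auto simp: Dloc[OF x])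
    finally have "tangent_space (loc c) x = tangent_space (loc d) (P x)"
      by (simp add: tangent_space_def D_def)
    moreover have "x \<in> im c" "P x \<in> im d" using x V0c PT T(2) by (auto simp: V_def)
    ultimately show ?thesis
      using chart_mean_curvature[OF c, of x] chart_mean_curvature[OF d, of "P x"] loc_eq[OF x] by simp
  qed
  have "pinch c (snd c p) = pinching B (\<lambda>x. loc d (P x)) (\<lambda>x. principal_normal B (loc d) (P x)) (\<lambda>x. length_at d (P x)) (snd c p)"
    unfolding pinch_def
    by (rule pinching_cong[OF \<open>open V\<close> x0 loc_eq]) (simp_all add: principal_normal_def length_at_def H_eq x0)
  also have "\<dots> = pinch d (P (snd c p))"
    unfolding pinch_def by (rule d.pinching_reparametrize[OF \<open>open V\<close> PV PT inj x0])
  finally show ?thesis by (simp add: P_at p)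
qed

text \<open>The choice of chart is harmless by \<open>pinch_transition\<close>.\<close>

definition "pinch_at p = (let c = SOME c. c \<in> A \<and> p \<in> fst c in pinch c (snd c p))"

lemma pinch_at_eq:
  assumes "c \<in> A" "p \<in> fst c"
  shows "pinch_at p = pinch c (snd c p)"
proof -
  have "(SOME c. c \<in> A \<and> p \<in> fst c) \<in> A \<and> p \<in> fst (SOME c. c \<in> A \<and> p \<in> fst c)"
    using assms by (intro someI[of "\<lambda>c. c \<in> A \<and> p \<in> fst c"]) simp
  then show ?thesis unfolding pinch_at_def Let_def using pinch_transition assms by blast
qed

lemma pinch_at_continuous: "continuous_map M euclideanreal pinch_at"
proof (rule continuous_map_chartwise[where g = pinch])
  fix c assume c: "c \<in> A"
  show "continuous_on (im c) (pinch c)"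
  proof (rule continuous_at_imp_continuous_on, rule ballI)
    fix x assume "x \<in> im c"
    then obtain e T where T: "x \<in> T" and patch: "patch_at c e T"
      by (rule chart_shrinker_patch[OF c]) blast
    interpret shrinker_patch B "loc c" "principal_normal B (loc c)" "length_at c" e T by (rule patch)
    show "isCont (pinch c) x"
      using smooth_on_continuous[OF smooth_pinching] open_S T by (simp add: continuous_on_eq_continuous_at pinch_def)
  qed
qed (rule pinch_at_eq)

text \<open>The set where the maximum is attained is closed by continuity and open by the strong
  maximum principle.\<close>

lemma pinch_at_const:
  assumes "connected_space M" and p: "p \<in> topspace M" and max: "\<And>q. q \<in> topspace M \<Longrightarrow> pinch_at q \<le> pinch_at p"
    and q: "q \<in> topspace M"
  shows "pinch_at q = pinch_at p"
proof -
  define Z where "Z = {q \<in> topspace M. pinch_at q = pinch_at p}"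
  have "closedin M {q \<in> topspace M. pinch_at q \<in> {pinch_at p}}"
    by (rule closedin_continuous_map_preimage[OF pinch_at_continuous]) simp
  then have "closedin M Z" by (simp add: Z_def)
  moreover have "openin M Z"
  proof (subst openin_subopen, rule ballI)
    fix z assume z: "z \<in> Z"
    then obtain c where c: "c \<in> A" "z \<in> fst c" unfolding Z_def charts_cover by blast
    have "snd c z \<in> im c" using c by simp
    then obtain e T where T: "snd c z \<in> T" "T \<subseteq> im c"
      and patch: "patch_at c e T"
      by (rule chart_shrinker_patch[OF c(1)]) blast
    interpret shrinker_patch B "loc c" "principal_normal B (loc c)" "length_at c" e T by (rule patch)
    have sub: "fst c \<subseteq> topspace M" using in_topspace[OF c(1)] by auto
    have "pinch c y \<le> pinch c (snd c z)" if "y \<in> T" for y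
    proof -
      obtain q where q: "q \<in> fst c" "y = snd c q" using \<open>y \<in> T\<close> T(2) by auto
      then show ?thesis
        using max[of q] z sub pinch_at_eq[OF c(1) q(1)] pinch_at_eq[OF c] by (auto simp: Z_def)
    qed
    then obtain r where r: "r > 0" "\<And>y. y \<in> ball (snd c z) r \<Longrightarrow> pinch c y = pinch c (snd c z)"
      unfolding pinch_def using pinching_strong_max[OF T(1)] by metis
    let ?N = "{q \<in> fst c. snd c q \<in> ball (snd c z) r}"
    have "openin M ?N" by (rule chart_preimage_open[OF c(1) open_ball])
    moreover have "z \<in> ?N" using c r(1) by simp
    moreover have "?N \<subseteq> Z"
      using r(2) sub z pinch_at_eq[OF c(1)] c(2) by (auto simp: Z_def)
    ultimately show "\<exists>T. openin M T \<and> z \<in> T \<and> T \<subseteq> Z" by blast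
  qed
  moreover have "p \<in> Z" using p by (simp add: Z_def)
  ultimately have "Z = topspace M" using assms(1) unfolding connected_space_clopen_in by blast
  then show ?thesis using q by (auto simp: Z_def)
qed

text \<open>Constancy of \<open>w\<close> globalizes the argument. Each patch yields only a
  vanishing derivative of \<open>u\<close> and \<open>e |a|^2 = 1\<close>, but these give
  \<open>w u^2 = 1\<close> at every point. Thus \<open>u^2\<close> is the same number at the
  maximum, at the minimum and at \<open>p\<close>, although the patches around them are
  unrelated.\<close>

lemma parallel_implies_quadric:
  assumes "compact_space M" "connected_space M" "CARD('m) \<noteq> 1" and p: "p \<in> topspace M"
  shows "B (F p) (F p) = real CARD('m)"
proof -
  let ?m = "real CARD('m)" and ?b = "\<lambda>p. B (F p) (F p)"
  have ne: "topspace M \<noteq> {}" using p by blast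
  obtain pw where pw: "pw \<in> topspace M" "\<And>q. q \<in> topspace M \<Longrightarrow> pinch_at q \<le> pinch_at pw"
    using attains_max[OF assms(1) ne pinch_at_continuous] by blast
  define w where "w = pinch_at pw"
  have const: "pinch_at q = w" if "q \<in> topspace M" for q
    unfolding w_def by (rule pinch_at_const[OF assms(2) pw that])
  obtain pmax where pmax: "pmax \<in> topspace M" "\<And>q. q \<in> topspace M \<Longrightarrow> ?b q \<le> ?b pmax"
    using attains_max[OF assms(1) ne height_continuous] by blast
  obtain pmin where pmin: "pmin \<in> topspace M" "\<And>q. q \<in> topspace M \<Longrightarrow> - ?b q \<le> - ?b pmin"
    using attains_max[OF assms(1) ne continuous_map_minus[OF height_continuous]] by blast
  have local: thesis if q: "q \<in> topspace M"
    and *: "\<And>c e T. \<lbrakk>c \<in> A; q \<in> fst c; snd c q \<in> T; T \<subseteq> im c;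
      patch_at c e T\<rbrakk> \<Longrightarrow> thesis" for q thesis
  proof -
    obtain c where c: "c \<in> A" "q \<in> fst c" using q unfolding charts_cover by blast
    then have "snd c q \<in> im c" by simp
    then show thesis by (rule chart_shrinker_patch[OF c(1)]) (rule *[OF c])
  qed
  have chart_point: "\<exists>q\<in>topspace M. y = snd c q \<and> loc c y = F q \<and> pinch c y = w"
    if c: "c \<in> A" and y: "T \<subseteq> im c" "y \<in> T" for c T y
  proof -
    obtain q where q: "q \<in> fst c" "y = snd c q" using y by auto
    then have "q \<in> topspace M" using in_topspace[OF c] by auto
    then show ?thesis using q const pinch_at_eq[OF c q(1)] loc_at[OF c q(1)] by auto
  qed
  have "w < 1"
  proof (rule local[OF pmax(1)])
    fix c e T assume c: "c \<in> A" "pmax \<in> fst c" "snd c pmax \<in> T" "T \<subseteq> im c"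
      and patch: "patch_at c e T"
    interpret shrinker_patch B "loc c" "principal_normal B (loc c)" "length_at c" e T by (rule patch)
    have "B (loc c y) (loc c y) \<le> B (loc c (snd c pmax)) (loc c (snd c pmax))" if "y \<in> T" for y
      using chart_point[OF c(1,4) that] pmax(2) loc_at[OF c(1,2)] by auto
    from height_max_pinching[OF c(3) this assms(3)] show "w < 1"
      using const[OF pmax(1)] pinch_at_eq[OF c(1,2)] by (simp add: pinch_def)
  qed
  have key: "e = 1 \<and> shape_sq B (loc c) (principal_normal B (loc c)) y = 1 \<and> (\<forall>v. D v (length_at c) y = 0)
      \<and> w * (length_at c y * length_at c y) = 1"
    if c: "c \<in> A" "T \<subseteq> im c" "y \<in> T"
      and patch: "patch_at c e T" for c e T y
  proof -
    interpret shrinker_patch B "loc c" "principal_normal B (loc c)" "length_at c" e T by (rule patch)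
    have Du: "D v (length_at c) y = 0" if "y \<in> T" for v y
      using \<open>w < 1\<close> chart_point[OF c(1,2)] by (intro pinching_const[OF that, of w]) (auto simp: pinch_def)
    have eW: "e * shape_sq B (loc c) (principal_normal B (loc c)) y = 1"
      by (rule shape_sq_const[OF c(3) Du])
    have w_eq: "w = shape_sq B (loc c) (principal_normal B (loc c)) y / (length_at c y * length_at c y)"
      using chart_point[OF c] by (auto simp: pinch_def pinching_def)
    have "0 \<le> shape_sq B (loc c) (principal_normal B (loc c)) y"
      by (rule shape_sq_nonneg[OF c(3)])
    \<comment> \<open>The sign is decided here by \<open>e |a|^2 = 1\<close>: derivatives of the
      normal are tangent, hence spacelike or zero, so \<open>|a|^2\<close> is nonnegative.\<close>
    moreover have "e = 1 \<or> e = - 1" using e by (simp add: square_eq_1_iff)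
    ultimately have "e = 1" using eW by auto
    with eW w_eq Du[OF c(3)] u_nz[OF c(3)] show ?thesis by simp
  qed
  \<comment> \<open>Since \<open>u^2 = 1 / w\<close> everywhere, the trace inequality at the maximum
    gives \<open>1 / w \<ge> m\<close> and the one at the minimum gives
    \<open>1 / w \<le> m\<close>.\<close>
  have wm: "w * ?m = 1"
  proof -
    have "1 \<ge> w * ?m \<and> w > 0"
    proof (rule local[OF pmax(1)])
      fix c e T assume c: "c \<in> A" "pmax \<in> fst c" "snd c pmax \<in> T" "T \<subseteq> im c"
        and patch: "patch_at c e T"
      interpret shrinker_patch B "loc c" "principal_normal B (loc c)" "length_at c" e T by (rule patch)
      have "B (loc c y) (loc c y) \<le> B (loc c (snd c pmax)) (loc c (snd c pmax))" if "y \<in> T" for y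
        using chart_point[OF c(1,4) that] pmax(2) loc_at[OF c(1,2)] by auto
      note len = height_max_length[OF c(3) this] and k = key[OF c(1,4,3) patch]
      have "w > 0" using k by (metis mult_le_0_iff not_one_le_zero not_less zero_le_square)
      moreover have "w * ?m \<le> w * (length_at c (snd c pmax) * length_at c (snd c pmax))"
        using len k \<open>w > 0\<close> by (intro mult_left_mono) auto
      ultimately show "1 \<ge> w * ?m \<and> w > 0" using k by simp
    qed
    moreover have "w > 0 \<Longrightarrow> 1 \<le> w * ?m"
    proof (rule local[OF pmin(1)])
      fix c e T assume c: "c \<in> A" "pmin \<in> fst c" "snd c pmin \<in> T" "T \<subseteq> im c" and "w > 0"
        and patch: "patch_at c e T"
      interpret shrinker_patch B "loc c" "principal_normal B (loc c)" "length_at c" e T by (rule patch)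
      have "B (loc c (snd c pmin)) (loc c (snd c pmin)) \<le> B (loc c y) (loc c y)" if "y \<in> T" for y
        using chart_point[OF c(1,4) that] pmin(2) loc_at[OF c(1,2)] by auto
      note len = height_min_length[OF c(3) this] and k = key[OF c(1,4,3) patch]
      have "w * (length_at c (snd c pmin) * length_at c (snd c pmin)) \<le> w * ?m"
        using len k \<open>w > 0\<close> by (intro mult_left_mono) auto
      then show "1 \<le> w * ?m" using k by simp
    qed
    ultimately show ?thesis by linarith
  qed
  show ?thesis
  proof (rule local[OF p])
    fix c e T assume c: "c \<in> A" "p \<in> fst c" "snd c p \<in> T" "T \<subseteq> im c"
      and patch: "patch_at c e T"
    interpret shrinker_patch B "loc c" "principal_normal B (loc c)" "length_at c" e T by (rule patch)
    note k = key[OF c(1,4,3) patch]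
    have "w * (length_at c (snd c p) * length_at c (snd c p)) = w * ?m" using k wm by simp
    then have "length_at c (snd c p) * length_at c (snd c p) = ?m" using wm by (metis mult_cancel_left mult_zero_left zero_neq_one)
    then show "?b p = ?m" using height_umbilic[OF c(3)] k loc_at[OF c(1,2)] by simp
  qed
qed

end

end

theorem theorem4p1:
  fixes M :: "'a topology"
    and A :: "('a, 'm::finite) chart set"
    and B :: "real^'n \<Rightarrow> real^'n \<Rightarrow> real"
    and F :: "'a \<Rightarrow> real^'n"
  assumes "bilinear B" and "symmetric_form B" and "nondegenerate_form B"
    and "smooth_manifold M A" and "compact_space M" and "connected_space M" and "orientable M A"
    and "CARD('m) \<noteq> 1"
    and "smooth_immersion A F" and "spacelike A B F"
    and "self_shrinker A B F"
  shows "mean_curvature_nonnull A B F \<and> parallel_principal_normal A B F \<longleftrightarrow>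
         minimal_in_hyperquadric M A B F (real CARD('m))"
proof -
  interpret immersed_shrinker M A B F
    using assms by unfold_locales
  show ?thesis
  proof
    assume "mean_curvature_nonnull A B F \<and> parallel_principal_normal A B F"
    then have "B (F p) (F p) = real CARD('m)" if "p \<in> topspace M" for p
      using parallel_implies_quadric assms(5,6,8) that by blast
    then show "minimal_in_hyperquadric M A B F (real CARD('m))"
      by (rule quadric_implies_minimal[OF assms(3)])
  next
    assume "minimal_in_hyperquadric M A B F (real CARD('m))"
    then have "F ` topspace M \<subseteq> hyperquadric B (real CARD('m))" by (simp add: minimal_in_hyperquadric_def)
    then show "mean_curvature_nonnull A B F \<and> parallel_principal_normal A B F"
      using minimal_implies_parallel by blast
  qed
qed

end
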